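(* Let $\Theta\subset\mathbb R^p$ be compact with $\|\theta\|\le D_\Theta$ for all $\theta\in\Theta$, let $T>0$, and let $\theta_1,\dots,\theta_H$ ($H\ge2$) be i.i.d. samples from $\rho\in\mathcal P(\Theta)$, independent of the token dynamics (i.e. of the initial token $x_0\sim\mu_0$, with $\mathrm{Supp}(\mu_0)\subset B_{R_0}$). Set $V_H(x,\mu)=\frac1H\sum_{r=1}^HA(x,\mu,\theta_r)$. Let $x^H(t)$ solve the finite-head dynamics $\dot x^H(t)=V_H(x^H(t),\mu^H_t)$, where $\mu^H_t$ is the law of $x^H(t)$ given the heads, and let $x(t)$ solve the mean-field equation $\dot x(t)=V_{\rho,\mu_t}(x(t))$, $\mu_t=\mathrm{Law}(x(t))$, both started from the same $x_0$. Then there is a constant $C(T)$, independent of $H$, such that $$\mathbb E\Big[\sup_{t\in[0,T]}|x^H(t)-x(t)|^2\Big]^{1/2}\le C(T)\,H^{-1/2}\sqrt{\log H}.$$ Moreover, the empirical velocity field satisfies $$\sup_{x\in B_{R(T)}}\big|V_H(x,\mu)-V_{\rho,\mu}(x)\big|=O_{\mathbb P}\big(H^{-1/2}\sqrt{\log H}\big)$$ uniformly for all $\mu$ supported in $B_{R(T)}$ (i.e. with constants in $O_{\mathbb P}$ not depending on $\mu$).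
   Context: $B_R=\{|x|\le R\}\subset\mathbb R^d$. A parameter (attention head) $\theta=(Q,K,V)$ is a triple of matrices identified with a point of $\mathbb R^p$, with $Qx,Ky$ in a common Euclidean space and $V$ of size $d\times d$. For a probability measure $\mu$ on $\mathbb R^d$, $$K^\theta_\mu(x,y)=\frac{\exp(\frac1{\sqrt d}\langle Qx,Ky\rangle)}{\int\exp(\frac1{\sqrt d}\langle Qx,Ky'\rangle)\,d\mu(y')},\quad A(x,\mu,\theta)=\int K^\theta_\mu(x,y)\,Vy\,d\mu(y),\quad V_{\rho,\mu}(x)=\int_\Theta A(x,\mu,\theta)\,\rho(d\theta).$$ $R(T)$ is the a priori confinement radius: a radius of the form $R_0e^{CT}+(e^{CT}-1)$, with $C$ depending only on $D_\Theta$ (in particular not on $H$ or on the parameter measure), such that token laws started in $B_{R_0}$ remain supported in $B_{R(T)}$ for $t\in[0,T]$. *)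

theory Defs
  imports "HOL-Probability.Probability"
begin

text \<open>
  A head is a triple \<open>(Q, K, V)\<close> with \<open>Q\<close>, \<open>K\<close> of size \<open>k \<times> d\<close> and \<open>V\<close> of size \<open>d \<times> d\<close>. The product
  norm on this type is the Euclidean norm of all the entries, so the type is \<open>\<real>\<^sup>p\<close> with
  \<open>p = 2 k d + d\<^sup>2\<close>.
\<close>

type_synonym ('d, 'k) head = "(real ^ 'd ^ 'k) \<times> (real ^ 'd ^ 'k) \<times> (real ^ 'd ^ 'd)"

definition attn_weight :: "('d::finite, 'k::finite) head \<Rightarrow> real ^ 'd \<Rightarrow> real ^ 'd \<Rightarrow> real" where
  "attn_weight = (\<lambda>(Q, K, V) x y. exp (1 / sqrt (real CARD('d)) * ((Q *v x) \<bullet> (K *v y))))"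

definition attn_kernel ::
    "('d::finite, 'k::finite) head \<Rightarrow> (real ^ 'd) measure \<Rightarrow> real ^ 'd \<Rightarrow> real ^ 'd \<Rightarrow> real" where
  "attn_kernel \<theta> \<mu> x y = attn_weight \<theta> x y / (\<integral>y'. attn_weight \<theta> x y' \<partial>\<mu>)"

definition attention ::
    "real ^ 'd \<Rightarrow> (real ^ 'd) measure \<Rightarrow> ('d::finite, 'k::finite) head \<Rightarrow> real ^ 'd" where
  "attention x \<mu> \<theta> = (\<integral>y. attn_kernel \<theta> \<mu> x y *\<^sub>R (snd (snd \<theta>) *v y) \<partial>\<mu>)"

definition mean_velocity ::
    "('d::finite, 'k::finite) head measure \<Rightarrow> (real ^ 'd) measure \<Rightarrow> real ^ 'd \<Rightarrow> real ^ 'd" where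
  "mean_velocity \<rho> \<mu> x = (\<integral>\<theta>. attention x \<mu> \<theta> \<partial>\<rho>)"

text \<open>The heads are numbered from \<open>1\<close> to \<open>H\<close>.\<close>

definition head_velocity ::
    "nat \<Rightarrow> (nat \<Rightarrow> ('d::finite, 'k::finite) head) \<Rightarrow> real ^ 'd \<Rightarrow> (real ^ 'd) measure \<Rightarrow> real ^ 'd" where
  "head_velocity H \<theta> x \<mu> = (1 / real H) *\<^sub>R (\<Sum>r = 1..H. attention x \<mu> (\<theta> r))"

definition measure_support :: "'a::topological_space measure \<Rightarrow> 'a set" where
  "measure_support \<mu> = {x. \<forall>U. open U \<longrightarrow> x \<in> U \<longrightarrow> emeasure \<mu> U > 0}"

definition borel_prob :: "'a::topological_space measure \<Rightarrow> bool" where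
  "borel_prob \<mu> \<longleftrightarrow> prob_space \<mu> \<and> sets \<mu> = sets borel"

text \<open>
  An element of \<open>\<P>(S)\<close> is represented by a Borel probability measure on the ambient space that
  gives mass one to \<open>S\<close>; integrals over \<open>S\<close> are then integrals over the whole space.
\<close>

definition prob_measure_on :: "'a::topological_space set \<Rightarrow> 'a measure \<Rightarrow> bool" where
  "prob_measure_on S \<rho> \<longleftrightarrow> borel_prob \<rho> \<and> (AE \<theta> in \<rho>. \<theta> \<in> S)"

text \<open>
  Solutions of \<open>x'(t) = V\<^bsub>\<rho>,\<mu>\<^esub>(x(t))\<close> with \<open>\<mu> = Law(x(t))\<close> on \<open>[0, T]\<close>, for almost every path, with
  one-sided derivatives at the endpoints. The law of the tokens is required to stay in some ball,
  so that the integrals in the velocity field exist; the radius is not prescribed.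
\<close>

definition mean_field_solution ::
    "'w measure \<Rightarrow> ('d::finite, 'k::finite) head measure \<Rightarrow> real \<Rightarrow> (real \<Rightarrow> 'w \<Rightarrow> real ^ 'd) \<Rightarrow> bool" where
  "mean_field_solution M \<rho> T x \<longleftrightarrow>
     (\<forall>t\<in>{0..T}. x t \<in> borel_measurable M) \<and>
     (\<exists>r. \<forall>t\<in>{0..T}. measure_support (distr M borel (x t)) \<subseteq> cball 0 r) \<and>
     (AE \<omega> in M. \<forall>t\<in>{0..T}.
        ((\<lambda>s. x s \<omega>) has_vector_derivative mean_velocity \<rho> (distr M borel (x t)) (x t \<omega>))
          (at t within {0..T}))"

definition confinement_radius :: "real \<Rightarrow> real \<Rightarrow> real \<Rightarrow> real" where
  "confinement_radius C R0 T = R0 * exp (C * T) + (exp (C * T) - 1)"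

text \<open>
  \<open>C\<close> confines the dynamics of all parameter measures on \<open>P\<close>, in particular of all empirical
  measures \<open>(1/H) \<Sum>\<^sub>r \<delta>\<^bsub>\<theta>\<^sub>r\<^esub>\<close>. Taking \<open>P\<close> to be the ball of radius \<open>D\<close> expresses that \<open>C\<close> depends
  on \<open>D\<close> only. Every law on \<open>\<real>\<^sup>d\<close> is the law of a random variable on a probability space
  \<open>M\<close> over the type \<open>real ^ 'd\<close>.
\<close>

definition confinement_constant :: "('d::finite, 'k::finite) head set \<Rightarrow> real \<Rightarrow> bool" where
  "confinement_constant P C \<longleftrightarrow> 0 \<le> C \<and>
     (\<forall>\<rho> (M :: (real ^ 'd) measure) x R0 T.
        0 < T \<longrightarrow> prob_measure_on P \<rho> \<longrightarrow> prob_space M \<longrightarrow> mean_field_solution M \<rho> T x \<longrightarrow>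
        measure_support (distr M borel (x 0)) \<subseteq> cball 0 R0 \<longrightarrow>
        (\<forall>t\<in>{0..T}. measure_support (distr M borel (x t)) \<subseteq> cball 0 (confinement_radius C R0 T)))"

definition iid_heads ::
    "'w measure \<Rightarrow> ('d::finite, 'k::finite) head measure \<Rightarrow> nat \<Rightarrow> (nat \<Rightarrow> 'w \<Rightarrow> ('d, 'k) head) \<Rightarrow> bool" where
  "iid_heads M \<rho> H \<theta> \<longleftrightarrow> prob_space M \<and>
     prob_space.indep_vars M (\<lambda>_. borel) \<theta> {1..H} \<and> (\<forall>r\<in>{1..H}. distr M borel (\<theta> r) = \<rho>)"

definition heads_tuple ::
    "nat \<Rightarrow> (nat \<Rightarrow> 'w \<Rightarrow> ('d::finite, 'k::finite) head) \<Rightarrow> 'w \<Rightarrow> nat \<Rightarrow> ('d, 'k) head" where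
  "heads_tuple H \<theta> \<omega> = (\<lambda>r\<in>{1..H}. \<theta> r \<omega>)"

definition heads_sigma ::
    "'w measure \<Rightarrow> nat \<Rightarrow> (nat \<Rightarrow> 'w \<Rightarrow> ('d::finite, 'k::finite) head) \<Rightarrow> 'w measure" where
  "heads_sigma M H \<theta> = vimage_algebra (space M) (heads_tuple H \<theta>) (\<Pi>\<^sub>M r\<in>{1..H}. borel)"

text \<open>Regular conditional distribution of \<open>X\<close> given the sub-sigma-algebra \<open>F\<close>.\<close>

definition cond_law ::
    "'w measure \<Rightarrow> 'w measure \<Rightarrow> ('w \<Rightarrow> 'a::topological_space) \<Rightarrow> ('w \<Rightarrow> 'a measure) \<Rightarrow> bool" where
  "cond_law M F X \<kappa> \<longleftrightarrow> \<kappa> \<in> F \<rightarrow>\<^sub>M prob_algebra borel \<and>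
     (\<forall>B\<in>sets borel. AE \<omega> in M.
        measure (\<kappa> \<omega>) B = real_cond_exp M F (indicator (X -` B \<inter> space M)) \<omega>)"

text \<open>
  The counterpart of \<^const>\<open>mean_field_solution\<close> for finitely many heads, with the law of the tokens
  replaced by the law \<open>\<kappa> t\<close> given the heads. The radius of the ball may depend on the heads.
\<close>

definition finite_head_solution ::
    "'w measure \<Rightarrow> nat \<Rightarrow> (nat \<Rightarrow> 'w \<Rightarrow> ('d::finite, 'k::finite) head) \<Rightarrow> real \<Rightarrow>
     (real \<Rightarrow> 'w \<Rightarrow> real ^ 'd) \<Rightarrow> (real \<Rightarrow> 'w \<Rightarrow> (real ^ 'd) measure) \<Rightarrow> bool" where
  "finite_head_solution M H \<theta> T x \<kappa> \<longleftrightarrow>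
     (\<forall>t\<in>{0..T}. x t \<in> borel_measurable M \<and> cond_law M (heads_sigma M H \<theta>) (x t) (\<kappa> t)) \<and>
     (AE \<omega> in M. \<exists>r. \<forall>t\<in>{0..T}. measure_support (\<kappa> t \<omega>) \<subseteq> cball 0 r) \<and>
     (AE \<omega> in M. \<forall>t\<in>{0..T}.
        ((\<lambda>s. x s \<omega>) has_vector_derivative head_velocity H (\<lambda>r. \<theta> r \<omega>) (x t \<omega>) (\<kappa> t \<omega>))
          (at t within {0..T}))"

text \<open>
  The remaining facts show that confinement constants exist: \<open>C = D\<close> is one.
\<close>

lemma measure_support_subset_iff:
  fixes \<mu> :: "'a::second_countable_topology measure"
  assumes \<mu>: "sets \<mu> = sets borel" and S: "closed S"
  shows "measure_support \<mu> \<subseteq> S \<longleftrightarrow> (AE x in \<mu>. x \<in> S)"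
proof
  assume *: "measure_support \<mu> \<subseteq> S"
  define F where "F = {U. open U \<and> emeasure \<mu> U = 0}"
  have "\<forall>U. U \<in> F \<longrightarrow> open U" by (auto simp: F_def)
  then obtain F' where F': "F' \<subseteq> F" "countable F'" "\<Union>F' = \<Union>F"
    using Lindelof[of F] by blast
  have "\<Union>F' \<in> null_sets \<mu>"
  proof -
    have "(\<Union>U\<in>F'. U) \<in> null_sets \<mu>"
      by (rule null_sets_UN'[OF F'(2)]) (use F'(1) in \<open>auto simp: F_def \<mu> null_sets_def\<close>)
    then show ?thesis by simp
  qed
  moreover have "- S \<subseteq> \<Union>F"
  proof
    fix x assume "x \<in> - S"
    then have "x \<notin> measure_support \<mu>" using * by auto
    then obtain U where "open U" "x \<in> U" "emeasure \<mu> U = 0"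
      by (auto simp: measure_support_def)
    then show "x \<in> \<Union>F" by (auto simp: F_def)
  qed
  ultimately show "AE x in \<mu>. x \<in> S"
    using F'(3) by (intro AE_I'[of "\<Union>F'"]) auto
next
  assume "AE x in \<mu>. x \<in> S"
  then have "emeasure \<mu> (- S) = 0"
    using S sets_eq_imp_space_eq[OF \<mu>] by (subst (asm) AE_iff_measurable[of "- S"]) (auto simp: \<mu>)
  then show "measure_support \<mu> \<subseteq> S"
    using S by (auto simp: measure_support_def dest!: spec[of _ "- S"])
qed

lemma norm_matrix_vector_le:
  fixes A :: "real ^ 'm ^ 'n"
  shows "norm (A *v x) \<le> norm A * norm x"
proof -
  have "norm (A *v x) = L2_set (\<lambda>i. norm ((A *v x) $ i)) UNIV"
    by (simp add: norm_vec_def)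
  also have "\<dots> \<le> L2_set (\<lambda>i. norm (A $ i) * norm x) UNIV"
    by (intro L2_set_mono)
       (auto simp: matrix_vector_mul_component Cauchy_Schwarz_ineq2)
  also have "\<dots> = norm A * norm x"
    by (simp add: L2_set_left_distrib norm_vec_def)
  finally show ?thesis .
qed

lemma norm_integral_le_AE:
  fixes f :: "'a \<Rightarrow> 'b::{banach, second_countable_topology}"
  assumes "integrable M f" "integrable M g" "AE x in M. norm (f x) \<le> g x"
  shows "norm (\<integral>x. f x \<partial>M) \<le> (\<integral>x. g x \<partial>M)"
  using assms by (intro order.trans[OF integral_norm_bound] integral_mono_AE) auto

lemma norm_attention_le:
  assumes \<mu>: "borel_prob \<mu>" and b: "AE y in \<mu>. norm y \<le> b" and \<theta>: "norm \<theta> \<le> D"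
    and pos: "0 \<le> b" "0 \<le> D"
  shows "norm (attention x \<mu> \<theta>) \<le> D * b"
proof -
  interpret prob_space \<mu> using \<mu> by (simp add: borel_prob_def)
  have [simp, measurable_cong]: "sets \<mu> = sets borel" using \<mu> by (simp add: borel_prob_def)
  obtain Q K V where \<theta>_eq: "\<theta> = (Q, K, V)" by (cases \<theta>) auto
  have V: "norm V \<le> D"
    using norm_snd_le[of V K] norm_snd_le[of "(K, V)" Q] \<theta> by (simp add: \<theta>_eq)
  have meas: "attn_weight \<theta> x \<in> borel_measurable \<mu>"
  proof -
    have "continuous_on UNIV (attn_weight \<theta> x)"
      by (auto simp: \<theta>_eq attn_weight_def intro!: continuous_intros)
    then have "attn_weight \<theta> x \<in> borel_measurable borel" by (rule borel_measurable_continuous_onI)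
    then show ?thesis by simp
  qed
  let ?w = "attn_weight \<theta> x"
  let ?Z = "\<integral>y'. ?w y' \<partial>\<mu>"
  have w0: "0 < ?w y" for y by (simp add: \<theta>_eq attn_weight_def)
  define c where "c = exp (norm (1 / sqrt (real CARD('a))) * (norm (Q *v x) * (norm K * b)))"
  have wle: "?w y \<le> c" if "norm y \<le> b" for y
  proof -
    have "(Q *v x) \<bullet> (K *v y) \<le> norm (Q *v x) * (norm K * b)"
      by (rule order.trans[OF norm_cauchy_schwarz] mult_left_mono
            order.trans[OF norm_matrix_vector_le] that norm_ge_zero)+
    then show ?thesis
      by (simp add: \<theta>_eq attn_weight_def c_def divide_right_mono)
  qed
  have int_w: "integrable \<mu> ?w"
    by (rule integrable_const_bound[of _ c])
       (use b wle w0 meas in \<open>auto elim!: eventually_mono simp: less_imp_le\<close>)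
  have Z0: "0 \<le> ?Z" by (rule integral_nonneg_AE) (use w0 in \<open>auto simp: less_imp_le\<close>)
  have "norm (attention x \<mu> \<theta>) \<le> (\<integral>y. ?w y / ?Z * (D * b) \<partial>\<mu>)"
    unfolding attention_def attn_kernel_def
  proof (cases "integrable \<mu> (\<lambda>y. (?w y / ?Z) *\<^sub>R (snd (snd \<theta>) *v y))")
    case True
    show "norm (\<integral>y. (?w y / ?Z) *\<^sub>R (snd (snd \<theta>) *v y) \<partial>\<mu>) \<le> (\<integral>y. ?w y / ?Z * (D * b) \<partial>\<mu>)"
    proof (rule norm_integral_le_AE[OF True])
      show "integrable \<mu> (\<lambda>y. ?w y / ?Z * (D * b))" using int_w by simp
      show "AE y in \<mu>. norm ((?w y / ?Z) *\<^sub>R (snd (snd \<theta>) *v y)) \<le> ?w y / ?Z * (D * b)"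
        using b
      proof eventually_elim
        case (elim y)
        have "norm (V *v y) \<le> D * b"
          using norm_matrix_vector_le[of V y] mult_mono[OF V elim pos(2) norm_ge_zero] by linarith
        then have "(?w y / ?Z) * norm (V *v y) \<le> (?w y / ?Z) * (D * b)"
          using w0[of y] Z0 by (intro mult_left_mono) auto
        then show ?case using w0[of y] Z0 by (simp add: \<theta>_eq)
      qed
    qed
  next
    case False
    have "0 \<le> (\<integral>y. ?w y / ?Z * (D * b) \<partial>\<mu>)"
      using w0 Z0 pos by (intro integral_nonneg_AE AE_I2 mult_nonneg_nonneg divide_nonneg_nonneg) (auto simp: less_imp_le)
    with False show "norm (\<integral>y. (?w y / ?Z) *\<^sub>R (snd (snd \<theta>) *v y) \<partial>\<mu>) \<le> (\<integral>y. ?w y / ?Z * (D * b) \<partial>\<mu>)"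
      by (simp add: not_integrable_integral_eq)
  qed
  also have "\<dots> = (?Z / ?Z) * (D * b)" by simp
  also have "\<dots> \<le> D * b" using pos by (cases "?Z = 0") auto
  finally show ?thesis .
qed

lemma norm_mean_velocity_le:
  assumes \<rho>: "prob_measure_on (cball 0 D) \<rho>"
    and \<mu>: "borel_prob \<mu>" "AE y in \<mu>. norm y \<le> b" and pos: "0 \<le> b" "0 \<le> D"
  shows "norm (mean_velocity \<rho> \<mu> x) \<le> D * b"
proof -
  interpret prob_space \<rho> using \<rho> by (simp add: prob_measure_on_def borel_prob_def)
  show ?thesis
  proof (cases "integrable \<rho> (attention x \<mu>)")
    case True
    have "norm (mean_velocity \<rho> \<mu> x) \<le> (\<integral>\<theta>. D * b \<partial>\<rho>)"
      unfolding mean_velocity_def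
    proof (rule norm_integral_le_AE[OF True])
      have "AE \<theta> in \<rho>. \<theta> \<in> cball 0 D" using \<rho> by (simp add: prob_measure_on_def)
      then show "AE \<theta> in \<rho>. norm (attention x \<mu> \<theta>) \<le> D * b"
        by eventually_elim (use norm_attention_le[OF \<mu>] pos in auto)
    qed auto
    then show ?thesis by (simp add: prob_space)
  next
    case False
    then show ?thesis using pos by (simp add: mean_velocity_def not_integrable_integral_eq)
  qed
qed

lemma confinement_constant_cball:
  assumes D: "0 \<le> D"
  shows "confinement_constant (cball 0 D) D"
  unfolding confinement_constant_def
proof (intro conjI D allI impI)
  fix \<rho> :: "('a, 'b) head measure" and M :: "(real ^ 'a) measure"
    and x :: "real \<Rightarrow> real ^ 'a \<Rightarrow> real ^ 'a" and R0 T :: real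
  assume T: "0 < T" and \<rho>: "prob_measure_on (cball 0 D) \<rho>" and "prob_space M"
    and sol: "mean_field_solution M \<rho> T x"
    and init: "measure_support (distr M borel (x 0)) \<subseteq> cball 0 R0"
  interpret prob_space M by fact
  have meas: "x t \<in> borel_measurable M" if "t \<in> {0..T}" for t
    using sol that by (auto simp: mean_field_solution_def)
  have supp: "measure_support (distr M borel (x t)) \<subseteq> cball 0 b \<longleftrightarrow> (AE \<omega> in M. norm (x t \<omega>) \<le> b)"
    if "t \<in> {0..T}" for t b
    using meas[OF that] by (simp add: measure_support_subset_iff AE_distr_iff)
  have law: "borel_prob (distr M borel (x t))" if "t \<in> {0..T}" for t
    using meas[OF that] by (simp add: borel_prob_def prob_space_distr)
  have nonneg: "0 \<le> b" if "AE \<omega> in M. norm (x t \<omega>) \<le> b" for t b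
  proof -
    have "AE \<omega> in M. 0 \<le> b" using that by eventually_elim (meson norm_ge_zero order.trans)
    then show ?thesis by simp
  qed
  have x0: "AE \<omega> in M. norm (x 0 \<omega>) \<le> R0" using init T by (simp add: supp)
  obtain r where "\<forall>t\<in>{0..T}. measure_support (distr M borel (x t)) \<subseteq> cball 0 r"
    using sol by (auto simp: mean_field_solution_def)
  then have r: "AE \<omega> in M. norm (x t \<omega>) \<le> r" if "t \<in> {0..T}" for t
    using that supp[OF that] by blast
  have R0: "0 \<le> R0" using nonneg[OF x0] .
  have r0: "0 \<le> r" using nonneg[OF r, of 0] T by simp
  define b where "b n t = R0 * exp (D * t) + r * ((D * t) ^ n / fact n)" for n and t :: real
  have b0: "0 \<le> b n t" if "0 \<le> t" for n t
    using that R0 r0 D by (simp add: b_def)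
  have deriv_b: "((b (Suc n)) has_vector_derivative D * b n t) (at t)" for n t
  proof -
    have pow: "((\<lambda>t. (D * t) ^ Suc n / fact (Suc n)) has_real_derivative D * ((D * t) ^ n / fact n)) (at t)"
    proof (rule DERIV_cong)
      have lin: "((*) D has_real_derivative D) (at t)" by (auto intro!: derivative_eq_intros)
      show "((\<lambda>t. (D * t) ^ Suc n / fact (Suc n)) has_real_derivative
          real (Suc n) * (D * (D * t) ^ (Suc n - Suc 0)) / fact (Suc n)) (at t)"
        by (intro DERIV_cdivide DERIV_power lin)
      have "1 + real n \<noteq> 0" by linarith
      then show "real (Suc n) * (D * (D * t) ^ (Suc n - Suc 0)) / fact (Suc n) = D * ((D * t) ^ n / fact n)"
        by (simp add: fact_Suc)
    qed
    have expo: "((\<lambda>t. exp (D * t)) has_real_derivative D * exp (D * t)) (at t)"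
      by (auto intro!: derivative_eq_intros)
    have "((b (Suc n)) has_real_derivative
        R0 * (D * exp (D * t)) + r * (D * ((D * t) ^ n / fact n))) (at t)"
      unfolding b_def by (intro DERIV_add DERIV_cmult pow expo)
    also have "R0 * (D * exp (D * t)) + r * (D * ((D * t) ^ n / fact n)) = D * b n t"
      unfolding b_def by (simp add: algebra_simps)
    finally show ?thesis by (simp add: has_real_derivative_iff_has_vector_derivative)
  qed
  have bound: "\<forall>t\<in>{0..T}. AE \<omega> in M. norm (x t \<omega>) \<le> b n t" for n
  proof (induction n)
    case 0
    show ?case
    proof
      fix t assume "t \<in> {0..T}"
      from r[OF this] show "AE \<omega> in M. norm (x t \<omega>) \<le> b 0 t"
      proof eventually_elim
        case (elim \<omega>)
        have "r \<le> b 0 t" using R0 by (simp add: b_def)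
        with elim show ?case by (rule order.trans)
      qed
    qed
  next
    case (Suc n)
    have vel: "norm (mean_velocity \<rho> (distr M borel (x t)) y) \<le> D * b n t" if "t \<in> {0..T}" for t y
      using that Suc.IH meas[OF that] b0[of t n] D
      by (intro norm_mean_velocity_le \<rho> law) (auto simp: AE_distr_iff)
    have "AE \<omega> in M. \<forall>t\<in>{0..T}. ((\<lambda>s. x s \<omega>) has_vector_derivative
            mean_velocity \<rho> (distr M borel (x t)) (x t \<omega>)) (at t within {0..T})"
      using sol by (simp add: mean_field_solution_def)
    with x0 have "AE \<omega> in M. \<forall>t\<in>{0..T}. norm (x t \<omega>) \<le> b (Suc n) t"
    proof eventually_elim
      case (elim \<omega>)
      show ?case
      proof
        fix t assume t: "t \<in> {0..T}"
        show "norm (x t \<omega>) \<le> b (Suc n) t"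
        proof (cases "t = 0")
          case True
          then show ?thesis using elim(1) by (simp add: b_def)
        next
          case False
          then have t0: "0 < t" using t by simp
          have "norm (x t \<omega> - x 0 \<omega>) \<le> b (Suc n) t - b (Suc n) 0"
          proof (rule differentiable_bound_general[OF t0,
                where f' = "\<lambda>s. mean_velocity \<rho> (distr M borel (x s)) (x s \<omega>)" and \<phi>' = "\<lambda>s. D * b n s"])
            have "continuous_on {0..T} (\<lambda>s. x s \<omega>)"
              using elim(2) by (intro continuous_on_vector_derivative) auto
            then show "continuous_on {0..t} (\<lambda>s. x s \<omega>)"
              by (rule continuous_on_subset) (use t in auto)
            show "continuous_on {0..t} (b (Suc n))"
              unfolding b_def by (intro continuous_intros) auto
            fix s assume s: "0 < s" "s < t"
            show "((\<lambda>s. x s \<omega>) has_vector_derivative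
                mean_velocity \<rho> (distr M borel (x s)) (x s \<omega>)) (at s)"
              using elim(2)[rule_format, of s] s t at_within_Icc_at[of 0 s T] by simp
            show "(b (Suc n) has_vector_derivative D * b n s) (at s)" by (rule deriv_b)
            show "norm (mean_velocity \<rho> (distr M borel (x s)) (x s \<omega>)) \<le> D * b n s"
              using s t by (intro vel) auto
          qed
          moreover have "b (Suc n) 0 = R0" by (simp add: b_def)
          ultimately show ?thesis
            using elim(1) norm_triangle_sub[of "x t \<omega>" "x 0 \<omega>"] by linarith
        qed
      qed
    qed
    then show ?case by (intro ballI) (erule eventually_mono, blast)
  qed
  show "\<forall>t\<in>{0..T}. measure_support (distr M borel (x t)) \<subseteq> cball 0 (confinement_radius D R0 T)"
  proof
    fix t assume t: "t \<in> {0..T}"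
    have lim: "(\<lambda>n. b n t) \<longlonglongrightarrow> R0 * exp (D * t) + r * 0"
      unfolding b_def
      using summable_LIMSEQ_zero[OF summable_exp[of "D * t"]]
      by (intro tendsto_intros) (simp add: field_simps)
    have DT: "D * t \<le> D * T" "0 \<le> D * T" using t D T by (simp_all add: mult_left_mono)
    have "R0 * exp (D * t) \<le> R0 * exp (D * T)" using DT(1) R0 by (simp add: mult_left_mono)
    moreover have "1 \<le> exp (D * T)" using DT(2) by simp
    ultimately have le: "R0 * exp (D * t) + r * 0 \<le> confinement_radius D R0 T"
      unfolding confinement_radius_def by linarith
    have "AE \<omega> in M. \<forall>n. norm (x t \<omega>) \<le> b n t"
      using bound t by (simp add: AE_all_countable)
    then have "AE \<omega> in M. norm (x t \<omega>) \<le> confinement_radius D R0 T"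
    proof eventually_elim
      case (elim \<omega>)
      then have "norm (x t \<omega>) \<le> R0 * exp (D * t) + r * 0"
        by (intro LIMSEQ_le_const[OF lim]) auto
      with le show ?case by simp
    qed
    then show "measure_support (distr M borel (x t)) \<subseteq> cball 0 (confinement_radius D R0 T)"
      using supp[OF t] by blast
  qed
qed

end

(*
  Both velocity fields are Lipschitz in the token on the confining ball, and changing the token law
  changes the attention output by at most a constant times the distance in any coupling of the laws.
  The mean-field token x(t) is a deterministic function of x(0), hence independent of the heads.
  Conditioning on the heads, (xH(t), x(t)) therefore couples the law of xH(t) given the heads with
  mu_t. So the derivative of |xH - x|^2 is bounded by |xH - x|^2, by the squared conditional mean of
  |xH - x|, and by the squared sampling error of the velocity along x(t). By independence the latter
  has expectation O(1/H), and a Gronwall argument gives the first bound, even without the logarithm.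

  The uniform bound follows from Hoeffding's inequality on the points of a grid of mesh H^(-1/2),
  which has O(H^(d/2)) points, and the Lipschitz continuity of both fields.
*)
theory Submission
  imports Defs
begin

section \<open>Regularity of the attention output\<close>

text \<open>The estimates that involve \<open>\<kappa> t\<close> hold almost surely for each fixed
  time, with an exceptional set depending on that time, and no measurability of
  \<open>\<kappa> t\<close> in \<open>t\<close> is assumed. Gronwall's inequality is therefore
  replaced by an iteration. With \<open>a\<close> the growth rate of a squared norm, a bound
  \<open>c * exp (2 * a * t)\<close> on it is inserted into its derivative; integrating in time
  returns half of \<open>c\<close> plus the inhomogeneity, and the limit is the wanted bound. This
  halving both confines the tokens and controls the mean square error. The integration in time is
  done by \<open>AE_increment_le\<close>, which yields one exceptional set for all times.

  The attention output is a quotient of integrals. It is treated as the value \<open>a\<close> at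
  which the integral of \<open>attn_residual\<close> vanishes, so that differences of outputs become
  differences of integrals.

  The sampling error is measured along x(t) because xH(t) depends on the heads, and at xH(t) the
  average over the heads would not be one of independent terms.

  The logarithm in the uniform bound is the price of a union bound over polynomially many grid
  points.\<close>

lemma norm_head_components:
  fixes Q Q' K K' :: "real ^ 'd ^ 'k" and V V' :: "real ^ 'd ^ 'd"
  shows "norm Q \<le> norm (Q, K, V)" "norm K \<le> norm (Q, K, V)" "norm V \<le> norm (Q, K, V)"
proof -
  show "norm Q \<le> norm (Q, K, V)" using norm_fst_le[of Q "(K, V)"] by simp
  have "norm (K, V) \<le> norm (Q, K, V)" using norm_snd_le[of "(K, V)" Q] by simp
  then show "norm K \<le> norm (Q, K, V)" "norm V \<le> norm (Q, K, V)"
    using norm_fst_le[of K V] norm_snd_le[of V K] by auto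
qed

lemma norm_matrix_vector_diff_le:
  fixes A A' :: "real ^ 'm ^ 'n"
  assumes "norm A \<le> D" "norm (A - A') \<le> \<delta>" "norm x' \<le> R" "0 \<le> D"
  shows "norm (A *v x - A' *v x') \<le> D * norm (x - x') + R * \<delta>"
proof -
  have "A *v x - A' *v x' = A *v (x - x') + (A - A') *v x'"
    by (simp add: matrix_vector_mult_diff_distrib matrix_vector_mult_diff_rdistrib)
  also have "norm \<dots> \<le> norm A * norm (x - x') + norm (A - A') * norm x'"
    by (intro order.trans[OF norm_triangle_ineq] add_mono norm_matrix_vector_le)
  also have "\<dots> \<le> D * norm (x - x') + \<delta> * R"
    using assms by (intro add_mono mult_mono mult_right_mono)
      (auto intro: order.trans[OF norm_ge_zero])
  finally show ?thesis by (simp add: mult.commute)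
qed

text \<open>Cauchy-Schwarz bounds the exponent by \<open>(D * R) * (D * R)\<close> in absolute
  value. Hence this constant bounds the weights from above, and its inverse bounds them, and with
  them the normaliser, from below.\<close>

definition attn_bound :: "real \<Rightarrow> real \<Rightarrow> real" where
  "attn_bound D R = exp ((D * R) * (D * R))"

text \<open>The exponent, bilinear in \<open>Q *v x\<close> and \<open>K *v y\<close>, has Lipschitz
  constant \<open>(D * R) * (D + 2 * R)\<close> in tokens and head together;
  \<open>attn_bound\<close> is the largest slope of the exponential on its range.\<close>

definition attn_lip :: "real \<Rightarrow> real \<Rightarrow> real" where
  "attn_lip D R = attn_bound D R * ((D * R) * (D + 2 * R))"

lemma attn_bound_ge_1: "1 \<le> attn_bound D R"
  by (simp add: attn_bound_def)

lemma attn_lip_nonneg: "0 \<le> D \<Longrightarrow> 0 \<le> R \<Longrightarrow> 0 \<le> attn_lip D R"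
  using attn_bound_ge_1[of D R] by (simp add: attn_lip_def)

lemma attn_weight_pos: "0 < attn_weight \<theta> x y"
  by (cases \<theta>) (simp add: attn_weight_def)

lemma abs_exp_diff_le:
  fixes a b c :: real
  assumes "a \<le> c" "b \<le> c"
  shows "\<bar>exp a - exp b\<bar> \<le> exp c * \<bar>a - b\<bar>"
proof -
  have *: "exp u - exp v \<le> exp c * (u - v)" if "v \<le> u" "u \<le> c" for u v :: real
  proof -
    have "exp u * (1 - (u - v)) \<le> exp u * exp (v - u)"
    proof (rule mult_left_mono)
      show "1 - (u - v) \<le> exp (v - u)" using exp_ge_add_one_self[of "v - u"] by linarith
    qed simp
    then have "exp u - exp v \<le> exp u * (u - v)"
      by (simp add: exp_diff algebra_simps)
    also have "\<dots> \<le> exp c * (u - v)" using that by (intro mult_right_mono) auto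
    finally show ?thesis .
  qed
  show ?thesis using *[of a b] *[of b a] assms by (cases "a \<le> b") (auto simp: abs_if)
qed

context
  fixes D R :: real
  assumes D0: "0 \<le> D" and R0: "0 \<le> R"
begin

lemma attn_exponent_le:
  fixes Q K :: "real ^ 'd ^ 'k"
  assumes "norm Q \<le> D" "norm K \<le> D" "norm x \<le> R" "norm y \<le> R"
  shows "\<bar>1 / sqrt (real CARD('d)) * ((Q *v x) \<bullet> (K *v y))\<bar> \<le> (D * R) * (D * R)"
proof -
  have s: "\<bar>1 / sqrt (real CARD('d))\<bar> \<le> 1" by simp
  have Qx: "norm (Q *v x) \<le> D * R" "norm (K *v y) \<le> D * R"
    using assms D0 by (auto intro!: order.trans[OF norm_matrix_vector_le] mult_mono)
  have "\<bar>(Q *v x) \<bullet> (K *v y)\<bar> \<le> (D * R) * (D * R)"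
    using Qx D0 R0 by (auto intro!: order.trans[OF Cauchy_Schwarz_ineq2] mult_mono)
  then show ?thesis
    using mult_mono[OF s] D0 R0 by (fastforce simp: abs_mult)
qed

lemma attn_weight_le:
  assumes "norm \<theta> \<le> D" "norm x \<le> R" "norm y \<le> R"
  shows "attn_weight \<theta> x y \<le> attn_bound D R" "1 / attn_bound D R \<le> attn_weight \<theta> x y"
proof -
  obtain Q K V where \<theta>: "\<theta> = (Q, K, V)" by (cases \<theta>)
  have "norm Q \<le> D" "norm K \<le> D" using norm_head_components[where Q=Q and K=K and V=V] assms(1) by (auto simp: \<theta>)
  note * = attn_exponent_le[OF this assms(2,3)]
  show "attn_weight \<theta> x y \<le> attn_bound D R" "1 / attn_bound D R \<le> attn_weight \<theta> x y"
    unfolding attn_weight_def attn_bound_def \<theta> prod.case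
    using * by (auto simp: exp_minus[symmetric] inverse_eq_divide[symmetric] simp del: mult_divide_mult_cancel_left_if times_divide_eq_left)
qed

lemma attn_weight_lipschitz:
  fixes \<theta> \<theta>' :: "('d::finite, 'k::finite) head"
  assumes "norm \<theta> \<le> D" "norm x \<le> R" "norm y \<le> R" "norm \<theta>' \<le> D" "norm x' \<le> R" "norm y' \<le> R"
  shows "\<bar>attn_weight \<theta> x y - attn_weight \<theta>' x' y'\<bar>
    \<le> attn_lip D R * (norm (x - x') + norm (y - y') + norm (\<theta> - \<theta>'))"
proof -
  obtain Q K V where \<theta>: "\<theta> = (Q, K, V)" by (cases \<theta>)
  obtain Q' K' V' where \<theta>': "\<theta>' = (Q', K', V')" by (cases \<theta>')
  have c: "norm Q \<le> D" "norm K \<le> D" "norm Q' \<le> D" "norm K' \<le> D"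
    using norm_head_components[where Q=Q and K=K and V=V] norm_head_components[where Q=Q' and K=K' and V=V'] assms(1,4)
    by (auto simp: \<theta> \<theta>')
  have d: "norm (Q - Q') \<le> norm (\<theta> - \<theta>')" "norm (K - K') \<le> norm (\<theta> - \<theta>')"
    using norm_head_components[where Q="Q-Q'" and K="K-K'" and V="V-V'"] by (auto simp: \<theta> \<theta>')
  define s where "s = 1 / sqrt (real CARD('d))"
  have s: "\<bar>s\<bar> \<le> 1" by (simp add: s_def)
  define a where "a = s * ((Q *v x) \<bullet> (K *v y))"
  define b where "b = s * ((Q' *v x') \<bullet> (K' *v y'))"
  define \<delta> where "\<delta> = norm (\<theta> - \<theta>')"
  have \<delta>: "0 \<le> \<delta>" by (simp add: \<delta>_def)
  have ab: "\<bar>a\<bar> \<le> (D * R) * (D * R)" "\<bar>b\<bar> \<le> (D * R) * (D * R)"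
    using attn_exponent_le[OF c(1,2) assms(2,3)] attn_exponent_le[OF c(3,4) assms(5,6)]
    by (simp_all add: a_def b_def s_def)
  have "\<bar>attn_weight \<theta> x y - attn_weight \<theta>' x' y'\<bar> = \<bar>exp a - exp b\<bar>"
    by (simp add: attn_weight_def \<theta> \<theta>' a_def b_def s_def)
  also have "\<dots> \<le> attn_bound D R * \<bar>a - b\<bar>"
    unfolding attn_bound_def using ab by (intro abs_exp_diff_le) auto
  also have "\<dots> \<le> attn_bound D R * ((D * R) * (D + 2 * R) * (norm (x - x') + norm (y - y') + norm (\<theta> - \<theta>')))"
  proof (intro mult_left_mono)
    have Qx: "norm (Q *v x - Q' *v x') \<le> D * norm (x - x') + R * \<delta>"
      using c d assms D0 unfolding \<delta>_def by (intro norm_matrix_vector_diff_le) auto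
    have Ky: "norm (K *v y - K' *v y') \<le> D * norm (y - y') + R * \<delta>"
      using c d assms D0 unfolding \<delta>_def by (intro norm_matrix_vector_diff_le) auto
    have n: "norm (Q' *v x') \<le> D * R" "norm (K *v y) \<le> D * R"
      using c assms D0 by (auto intro!: order.trans[OF norm_matrix_vector_le] mult_mono)
    \<comment> \<open>One factor of the inner product changes at a time, and the other one is at
      most \<open>D * R\<close>.\<close>
    have "a - b = s * ((Q *v x - Q' *v x') \<bullet> (K *v y) + (Q' *v x') \<bullet> (K *v y - K' *v y'))"
      by (simp add: a_def b_def inner_diff_left inner_diff_right algebra_simps)
    then have "\<bar>a - b\<bar> \<le> 1 * \<bar>(Q *v x - Q' *v x') \<bullet> (K *v y) + (Q' *v x') \<bullet> (K *v y - K' *v y')\<bar>"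
      unfolding abs_mult[symmetric] using s by (simp add: abs_mult mult_left_le_one_le)
    also have "\<dots> \<le> norm (Q *v x - Q' *v x') * norm (K *v y) + norm (Q' *v x') * norm (K *v y - K' *v y')"
      unfolding mult_1 by (intro order.trans[OF abs_triangle_ineq] add_mono Cauchy_Schwarz_ineq2)
    also have "\<dots> \<le> (D * norm (x - x') + R * \<delta>) * (D * R) + (D * R) * (D * norm (y - y') + R * \<delta>)"
      using Qx Ky n D0 R0 \<delta> by (intro add_mono mult_mono) auto
    also have "\<dots> = (D * R) * (D * (norm (x - x') + norm (y - y')) + 2 * R * \<delta>)"
      by (simp add: algebra_simps)
    also have "\<dots> \<le> (D * R) * ((D + 2 * R) * (norm (x - x') + norm (y - y') + \<delta>))"
    proof (intro mult_left_mono)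
      have "0 \<le> 2 * R * (norm (x - x') + norm (y - y')) + D * \<delta>" using D0 R0 \<delta> by simp
      then show "D * (norm (x - x') + norm (y - y')) + 2 * R * \<delta> \<le> (D + 2 * R) * (norm (x - x') + norm (y - y') + \<delta>)"
        by (simp add: algebra_simps)
    qed (use D0 R0 in simp)
    finally show "\<bar>a - b\<bar> \<le> (D * R) * (D + 2 * R) * (norm (x - x') + norm (y - y') + norm (\<theta> - \<theta>'))"
      by (simp add: \<delta>_def mult.assoc)
  qed (use attn_bound_ge_1[of D R] in linarith)
  finally show ?thesis by (simp add: attn_lip_def mult.assoc)
qed

end

section \<open>The attention output as the zero of an integrated residual\<close>

definition attn_residual ::
    "('d::finite, 'k::finite) head \<Rightarrow> real ^ 'd \<Rightarrow> real ^ 'd \<Rightarrow> real ^ 'd \<Rightarrow> real ^ 'd" where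
  "attn_residual \<theta> x a y = attn_weight \<theta> x y *\<^sub>R (snd (snd \<theta>) *v y - a)"

text \<open>Product rule: Lipschitz constant of the weight times the bound
  \<open>2 * (D * R)\<close> on \<open>V *v y - a\<close>, plus the bound on the weight times the
  Lipschitz constant \<open>D + R\<close> of \<open>V *v y\<close> in \<open>y\<close> and
  \<open>V\<close>.\<close>

definition residual_lip :: "real \<Rightarrow> real \<Rightarrow> real" where
  "residual_lip D R = attn_lip D R * (2 * (D * R)) + attn_bound D R * (D + R)"

lemma residual_lip_nonneg: "0 \<le> D \<Longrightarrow> 0 \<le> R \<Longrightarrow> 0 \<le> residual_lip D R"
  using attn_bound_ge_1[of D R] attn_lip_nonneg[of D R] by (simp add: residual_lip_def)

lemma continuous_attn_weight: "continuous_on UNIV (attn_weight \<theta> x)"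
  by (cases \<theta>) (auto simp: attn_weight_def intro!: continuous_intros)

lemma measurable_attn_weight[measurable]: "attn_weight \<theta> x \<in> borel_measurable borel"
  by (rule borel_measurable_continuous_onI[OF continuous_attn_weight])

lemma measurable_attn_residual[measurable]: "attn_residual \<theta> x a \<in> borel_measurable borel"
  unfolding attn_residual_def
  by (intro borel_measurable_continuous_onI continuous_intros continuous_attn_weight)

context
  fixes D R :: real
  assumes D0: "0 \<le> D" and R0: "0 \<le> R"
begin

lemma attn_residual_lipschitz:
  fixes \<theta> \<theta>' :: "('d::finite, 'k::finite) head"
  assumes "norm \<theta> \<le> D" "norm x \<le> R" "norm y \<le> R" "norm \<theta>' \<le> D" "norm x' \<le> R" "norm y' \<le> R"
    and a: "norm a \<le> D * R"
  shows "norm (attn_residual \<theta> x a y - attn_residual \<theta>' x' a y')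
    \<le> residual_lip D R * (norm (x - x') + norm (y - y') + norm (\<theta> - \<theta>'))" (is "_ \<le> _ * ?d")
proof -
  obtain Q K V where \<theta>: "\<theta> = (Q, K, V)" by (cases \<theta>)
  obtain Q' K' V' where \<theta>': "\<theta>' = (Q', K', V')" by (cases \<theta>')
  have c: "norm V \<le> D" "norm V' \<le> D"
    using norm_head_components[where Q=Q and K=K and V=V] norm_head_components[where Q=Q' and K=K' and V=V'] assms(1,4)
    by (auto simp: \<theta> \<theta>')
  have d: "norm (V - V') \<le> norm (\<theta> - \<theta>')"
    using norm_head_components[where Q="Q-Q'" and K="K-K'" and V="V-V'"] by (auto simp: \<theta> \<theta>')
  let ?w = "attn_weight \<theta> x y" and ?w' = "attn_weight \<theta>' x' y'"
  have Vy: "norm (V *v y - a) \<le> 2 * (D * R)"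
  proof -
    have "norm (V *v y) \<le> D * R"
      using c assms D0 by (auto intro!: order.trans[OF norm_matrix_vector_le] mult_mono)
    then show ?thesis using a norm_triangle_ineq4[of "V *v y" a] by linarith
  qed
  have VV: "norm (V *v y - V' *v y') \<le> (D + R) * ?d"
  proof -
    have "norm (V *v y - V' *v y') \<le> D * norm (y - y') + R * norm (\<theta> - \<theta>')"
      using c d assms D0 by (intro norm_matrix_vector_diff_le) auto
    moreover have "0 \<le> R * norm (y - y') + D * norm (\<theta> - \<theta>') + (D + R) * norm (x - x')"
      using D0 R0 by simp
    ultimately show ?thesis by (simp add: algebra_simps)
  qed
  have "attn_residual \<theta> x a y - attn_residual \<theta>' x' a y'
      = (?w - ?w') *\<^sub>R (V *v y - a) + ?w' *\<^sub>R (V *v y - V' *v y')"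
    by (simp add: attn_residual_def \<theta> \<theta>' algebra_simps)
  also have "norm \<dots> \<le> \<bar>?w - ?w'\<bar> * norm (V *v y - a) + ?w' * norm (V *v y - V' *v y')"
    using norm_triangle_ineq[of "(?w - ?w') *\<^sub>R (V *v y - a)" "?w' *\<^sub>R (V *v y - V' *v y')"]
      attn_weight_pos[of \<theta>' x' y'] by simp
  also have "\<dots> \<le> (attn_lip D R * ?d) * (2 * (D * R)) + attn_bound D R * ((D + R) * ?d)"
    using attn_weight_lipschitz[OF D0 R0 assms(1-6)] Vy VV attn_weight_le[OF D0 R0 assms(4-6)]
      attn_bound_ge_1[of D R] attn_lip_nonneg[OF D0 R0] D0 R0
    by (intro add_mono mult_mono) auto
  also have "\<dots> = residual_lip D R * ?d"
    unfolding residual_lip_def by (simp only: algebra_simps)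
  finally show ?thesis .
qed

lemma norm_attn_residual_le:
  assumes "norm \<theta> \<le> D" "norm x \<le> R" "norm y \<le> R" "norm a \<le> D * R"
  shows "norm (attn_residual \<theta> x a y) \<le> attn_bound D R * (2 * (D * R))"
proof -
  obtain Q K V where \<theta>: "\<theta> = (Q, K, V)" by (cases \<theta>)
  have "norm V \<le> D" using norm_head_components[where Q=Q and K=K and V=V] assms(1) by (auto simp: \<theta>)
  then have "norm (V *v y) \<le> D * R"
    using assms D0 by (auto intro!: order.trans[OF norm_matrix_vector_le] mult_mono)
  then have "norm (V *v y - a) \<le> 2 * (D * R)"
    using assms norm_triangle_ineq4[of "V *v y" a] by linarith
  then have "attn_weight \<theta> x y * norm (V *v y - a) \<le> attn_bound D R * (2 * (D * R))"
    using attn_weight_le[OF D0 R0 assms(1-3)] attn_bound_ge_1[of D R] by (intro mult_mono) auto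
  then show ?thesis using attn_weight_pos[of \<theta> x y] by (simp add: attn_residual_def \<theta>)
qed

lemma attn_integrable:
  fixes \<theta> :: "('d::finite, 'k::finite) head"
  assumes \<mu>: "borel_prob \<mu>" "AE y in \<mu>. norm y \<le> R" and \<theta>: "norm \<theta> \<le> D" and x: "norm x \<le> R"
  shows "integrable \<mu> (attn_weight \<theta> x)" "norm a \<le> D * R \<Longrightarrow> integrable \<mu> (attn_residual \<theta> x a)"
    "1 / attn_bound D R \<le> (\<integral>y. attn_weight \<theta> x y \<partial>\<mu>)"
proof -
  interpret prob_space \<mu> using \<mu> by (simp add: borel_prob_def)
  have [simp, measurable_cong]: "sets \<mu> = sets borel" using \<mu> by (simp add: borel_prob_def)
  show int: "integrable \<mu> (attn_weight \<theta> x)"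
  proof (rule integrable_const_bound[of _ "attn_bound D R"])
    show "AE y in \<mu>. norm (attn_weight \<theta> x y) \<le> attn_bound D R"
      using \<mu>(2) by eventually_elim (use attn_weight_le[OF D0 R0 \<theta> x] attn_weight_pos[of \<theta> x] in \<open>auto simp: less_imp_le\<close>)
  qed measurable
  show "integrable \<mu> (attn_residual \<theta> x a)" if a: "norm a \<le> D * R"
  proof (rule integrable_const_bound)
    show "AE y in \<mu>. norm (attn_residual \<theta> x a y) \<le> attn_bound D R * (2 * (D * R))"
      using \<mu>(2) by eventually_elim (use norm_attn_residual_le[OF \<theta> x _ a] in auto)
  qed measurable
  have "(\<integral>y. 1 / attn_bound D R \<partial>\<mu>) \<le> (\<integral>y. attn_weight \<theta> x y \<partial>\<mu>)"
    using int \<mu>(2) by (intro integral_mono_AE) (auto elim!: eventually_mono intro: attn_weight_le[OF D0 R0 \<theta> x])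
  then show "1 / attn_bound D R \<le> (\<integral>y. attn_weight \<theta> x y \<partial>\<mu>)" by (simp add: prob_space)
qed

text \<open>The output is a quotient with positive normaliser, hence the only \<open>a\<close> whose
  residual has integral zero. Its distance from any other \<open>a\<close> involves a single
  normaliser, which avoids estimating a difference of two quotients.\<close>

lemma attention_minus_eq:
  fixes \<theta> :: "('d::finite, 'k::finite) head"
  assumes \<mu>: "borel_prob \<mu>" "AE y in \<mu>. norm y \<le> R" and \<theta>: "norm \<theta> \<le> D" and x: "norm x \<le> R"
    and a: "norm a \<le> D * R"
  shows "attention x \<mu> \<theta> - a = (1 / (\<integral>y. attn_weight \<theta> x y \<partial>\<mu>)) *\<^sub>R (\<integral>y. attn_residual \<theta> x a y \<partial>\<mu>)"
proof -
  interpret prob_space \<mu> using \<mu> by (simp add: borel_prob_def)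
  have [simp, measurable_cong]: "sets \<mu> = sets borel" using \<mu> by (simp add: borel_prob_def)
  define Z where "Z = (\<integral>y. attn_weight \<theta> x y \<partial>\<mu>)"
  have "0 < 1 / attn_bound D R" using attn_bound_ge_1[of D R] by simp
  also have "\<dots> \<le> Z" unfolding Z_def by (rule attn_integrable(3)[OF \<mu> \<theta> x])
  finally have Z: "0 < Z" .
  have a0: "norm (0 :: real ^ 'd) \<le> D * R" using D0 R0 by simp
  note int = attn_integrable(1)[OF \<mu> \<theta> x] attn_integrable(2)[OF \<mu> \<theta> x]
  have "(\<integral>y. attn_residual \<theta> x a y \<partial>\<mu>) = (\<integral>y. attn_residual \<theta> x 0 y - attn_weight \<theta> x y *\<^sub>R a \<partial>\<mu>)"
    by (simp add: attn_residual_def algebra_simps)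
  also have "\<dots> = (\<integral>y. attn_residual \<theta> x 0 y \<partial>\<mu>) - Z *\<^sub>R a"
    using int(1) int(2)[OF a0] by (simp add: Z_def)
  also have "(\<integral>y. attn_residual \<theta> x 0 y \<partial>\<mu>) = Z *\<^sub>R attention x \<mu> \<theta>"
  proof -
    have "attention x \<mu> \<theta> = (\<integral>y. (1 / Z) *\<^sub>R attn_residual \<theta> x 0 y \<partial>\<mu>)"
      by (simp add: attention_def attn_kernel_def attn_residual_def Z_def)
    also have "\<dots> = (1 / Z) *\<^sub>R (\<integral>y. attn_residual \<theta> x 0 y \<partial>\<mu>)"
      by (rule integral_scaleR_right)
    finally show ?thesis using Z by simp
  qed
  finally have "(\<integral>y. attn_residual \<theta> x a y \<partial>\<mu>) = Z *\<^sub>R (attention x \<mu> \<theta> - a)"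
    by (simp add: scaleR_diff_right)
  then show ?thesis using Z by (simp add: Z_def[symmetric])
qed

lemma attention_residual_zero:
  fixes \<theta> :: "('d::finite, 'k::finite) head"
  assumes \<mu>: "borel_prob \<mu>" "AE y in \<mu>. norm y \<le> R" and \<theta>: "norm \<theta> \<le> D" and x: "norm x \<le> R"
  shows "(\<integral>y. attn_residual \<theta> x (attention x \<mu> \<theta>) y \<partial>\<mu>) = 0"
proof -
  have "norm (attention x \<mu> \<theta>) \<le> D * R" by (rule norm_attention_le[OF \<mu> \<theta> R0 D0])
  note eq = attention_minus_eq[OF \<mu> \<theta> x this]
  have "0 < 1 / attn_bound D R" using attn_bound_ge_1[of D R] by simp
  also have "\<dots> \<le> (\<integral>y. attn_weight \<theta> x y \<partial>\<mu>)" by (rule attn_integrable(3)[OF \<mu> \<theta> x])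
  finally show ?thesis using eq by simp
qed

text \<open>Meant for \<open>a\<close> equal to the output at another token, head or law. The
  residual integral of that output is zero and may be subtracted on the right, leaving a difference
  of two residual integrals with the same \<open>a\<close>.\<close>

lemma norm_attention_minus_le:
  fixes \<theta> :: "('d::finite, 'k::finite) head"
  assumes \<mu>: "borel_prob \<mu>" "AE y in \<mu>. norm y \<le> R" and \<theta>: "norm \<theta> \<le> D" and x: "norm x \<le> R"
    and a: "norm a \<le> D * R"
  shows "norm (attention x \<mu> \<theta> - a) \<le> attn_bound D R * norm (\<integral>y. attn_residual \<theta> x a y \<partial>\<mu>)"
proof -
  define Z where "Z = (\<integral>y. attn_weight \<theta> x y \<partial>\<mu>)"
  have b: "0 < attn_bound D R" using attn_bound_ge_1[of D R] by linarith
  have Z: "1 / attn_bound D R \<le> Z" using attn_integrable(3)[OF \<mu> \<theta> x] unfolding Z_def .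
  moreover have "0 < 1 / attn_bound D R" using b by simp
  ultimately have Z0: "0 < Z" by (rule less_le_trans[rotated])
  have "norm (attention x \<mu> \<theta> - a) = (1 / Z) * norm (\<integral>y. attn_residual \<theta> x a y \<partial>\<mu>)"
    using Z0 by (simp add: attention_minus_eq[OF assms] Z_def[symmetric])
  also have "\<dots> \<le> attn_bound D R * norm (\<integral>y. attn_residual \<theta> x a y \<partial>\<mu>)"
  proof (rule mult_right_mono)
    show "1 / Z \<le> attn_bound D R" using Z b Z0 by (simp add: field_simps)
  qed simp
  finally show ?thesis .
qed

end

section \<open>Lipschitz bounds and continuity of the attention output and the velocity
  fields\<close>

definition attention_lip :: "real \<Rightarrow> real \<Rightarrow> real" where
  "attention_lip D R = attn_bound D R * residual_lip D R"

lemma attention_lip_nonneg: "0 \<le> D \<Longrightarrow> 0 \<le> R \<Longrightarrow> 0 \<le> attention_lip D R"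
  using residual_lip_nonneg[of D R] attn_bound_ge_1[of D R] by (simp add: attention_lip_def)

lemma attention_lipschitz:
  fixes \<theta> \<theta>' :: "('d::finite, 'k::finite) head"
  assumes D0: "0 \<le> D" and R0: "0 \<le> R"
    and \<mu>: "borel_prob \<mu>" "AE y in \<mu>. norm y \<le> R" and \<theta>: "norm \<theta> \<le> D" "norm \<theta>' \<le> D"
    and x: "norm x \<le> R" "norm x' \<le> R"
  shows "norm (attention x \<mu> \<theta> - attention x' \<mu> \<theta>') \<le> attention_lip D R * (norm (x - x') + norm (\<theta> - \<theta>'))"
proof -
  interpret prob_space \<mu> using \<mu> by (simp add: borel_prob_def)
  let ?a = "attention x' \<mu> \<theta>'" and ?d = "norm (x - x') + norm (\<theta> - \<theta>')"
  have a: "norm ?a \<le> D * R" by (rule norm_attention_le[OF \<mu> \<theta>(2) R0 D0])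
  note int = attn_integrable(2)[OF D0 R0 \<mu> \<theta>(1) x(1) a] attn_integrable(2)[OF D0 R0 \<mu> \<theta>(2) x(2) a]
  have "norm (\<integral>y. attn_residual \<theta> x ?a y \<partial>\<mu>)
      = norm (\<integral>y. attn_residual \<theta> x ?a y - attn_residual \<theta>' x' ?a y \<partial>\<mu>)"
    using int attention_residual_zero[OF D0 R0 \<mu> \<theta>(2) x(2)] by simp
  also have "\<dots> \<le> (\<integral>y. residual_lip D R * ?d \<partial>\<mu>)"
  proof (rule norm_integral_le_AE)
    show "AE y in \<mu>. norm (attn_residual \<theta> x ?a y - attn_residual \<theta>' x' ?a y) \<le> residual_lip D R * ?d"
      using \<mu>(2)
    proof eventually_elim
      case (elim y)
      from attn_residual_lipschitz[OF D0 R0 \<theta>(1) x(1) elim \<theta>(2) x(2) elim a] show ?case by simp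
    qed
  qed (use int in auto)
  also have "\<dots> = residual_lip D R * ?d" by (simp add: prob_space)
  finally have "norm (\<integral>y. attn_residual \<theta> x ?a y \<partial>\<mu>) \<le> residual_lip D R * ?d" .
  then have "attn_bound D R * norm (\<integral>y. attn_residual \<theta> x ?a y \<partial>\<mu>) \<le> attention_lip D R * ?d"
    unfolding attention_lip_def mult.assoc using attn_bound_ge_1[of D R] by (intro mult_left_mono) simp_all
  with norm_attention_minus_le[OF D0 R0 \<mu> \<theta>(1) x(1) a] show ?thesis by (rule order.trans)
qed

text \<open>Continuity is local, so Lipschitz bounds on the balls of radius \<open>n\<close>
  suffice; there the larger of \<open>n\<close> and \<open>R\<close> bounds token, head and support
  at once. Continuity in both arguments makes the output measurable along random tokens and
  heads.\<close>

lemma continuous_attention: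
  fixes \<mu> :: "(real ^ 'd::finite) measure"
  assumes \<mu>: "borel_prob \<mu>" "AE y in \<mu>. norm y \<le> R"
  shows "continuous_on UNIV (\<lambda>p :: (real ^ 'd) \<times> ('d, 'k::finite) head. attention (fst p) \<mu> (snd p))"
proof -
  have "continuous_on (\<Union>n :: nat. ball (0 :: (real ^ 'd) \<times> ('d, 'k) head) (real n)) (\<lambda>p. attention (fst p) \<mu> (snd p))"
  proof (rule continuous_on_open_UN)
    fix n :: nat
    define r where "r = max (real n) R"
    have r0: "0 \<le> r" and rn: "real n \<le> r" by (auto simp: r_def)
    have \<mu>r: "AE y in \<mu>. norm y \<le> r" using \<mu>(2) by eventually_elim (auto simp: r_def)
    show "continuous_on (ball 0 (real n)) (\<lambda>p :: (real ^ 'd) \<times> ('d, 'k) head. attention (fst p) \<mu> (snd p))"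
    proof (rule lipschitz_on_continuous_on)
      show "(attention_lip r r * 2)-lipschitz_on (ball 0 (real n)) (\<lambda>p :: (real ^ 'd) \<times> ('d, 'k) head. attention (fst p) \<mu> (snd p))"
      proof (rule lipschitz_onI)
        fix p q :: "(real ^ 'd) \<times> ('d, 'k) head"
        assume pq: "p \<in> ball 0 (real n)" "q \<in> ball 0 (real n)"
        have b: "norm (fst u) \<le> r \<and> norm (snd u) \<le> r" if "u \<in> ball 0 (real n)" for u :: "(real ^ 'd) \<times> ('d, 'k) head"
          using that norm_fst_le[of "fst u" "snd u"] norm_snd_le[of "snd u" "fst u"] rn by simp
        have "norm (attention (fst p) \<mu> (snd p) - attention (fst q) \<mu> (snd q))
            \<le> attention_lip r r * (norm (fst p - fst q) + norm (snd p - snd q))"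
          using b[OF pq(1)] b[OF pq(2)] by (intro attention_lipschitz[OF r0 r0 \<mu>(1) \<mu>r]) auto
        also have "\<dots> \<le> attention_lip r r * (2 * norm (p - q))"
        proof (rule mult_left_mono)
          have "p - q = (fst p - fst q, snd p - snd q)" by (simp add: prod_eq_iff)
          then show "norm (fst p - fst q) + norm (snd p - snd q) \<le> 2 * norm (p - q)"
            using norm_fst_le[of "fst p - fst q" "snd p - snd q"] norm_snd_le[of "snd p - snd q" "fst p - fst q"]
            by simp
        qed (rule attention_lip_nonneg[OF r0 r0])
        finally show "dist (attention (fst p) \<mu> (snd p)) (attention (fst q) \<mu> (snd q)) \<le> attention_lip r r * 2 * dist p q"
          by (simp add: dist_norm mult.assoc)
      qed (use attention_lip_nonneg[OF r0 r0] in simp)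
    qed
  qed auto
  moreover have "(\<Union>n :: nat. ball (0 :: (real ^ 'd) \<times> ('d, 'k) head) (real n)) = UNIV"
    using reals_Archimedean2 by auto
  ultimately show ?thesis by simp
qed

lemma continuous_attention_fst:
  assumes "borel_prob \<mu>" "AE y in \<mu>. norm y \<le> R"
  shows "continuous_on UNIV (\<lambda>x. attention x \<mu> \<theta>)"
  by (rule continuous_on_compose2[OF continuous_attention[OF assms], of _ "\<lambda>x. (x, \<theta>)", simplified])
     (intro continuous_intros)

lemma measurable_attention:
  fixes \<mu> :: "(real ^ 'd::finite) measure"
  assumes \<mu>: "borel_prob \<mu>" "AE y in \<mu>. norm y \<le> R"
    and f: "f \<in> borel_measurable N" and g: "g \<in> borel_measurable N"
  shows "(\<lambda>\<omega>. attention (f \<omega>) \<mu> (g \<omega> :: ('d, 'k::finite) head)) \<in> borel_measurable N"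
proof -
  have "(\<lambda>\<omega>. (f \<omega>, g \<omega>)) \<in> borel_measurable N" using f g by (rule borel_measurable_Pair)
  from measurable_compose[OF this borel_measurable_continuous_onI[OF continuous_attention[OF \<mu>]]]
  show ?thesis by simp
qed

text \<open>The dependence on the law is reduced to integrating one fixed Lipschitz function against
  both laws, which any coupling of the two laws can estimate.\<close>

lemma norm_attention_measure_diff_le:
  fixes \<theta> :: "('d::finite, 'k::finite) head"
  assumes "0 \<le> D" "0 \<le> R"
    and \<kappa>: "borel_prob \<kappa>" "AE y in \<kappa>. norm y \<le> R" and \<mu>: "borel_prob \<mu>" "AE y in \<mu>. norm y \<le> R"
    and \<theta>: "norm \<theta> \<le> D" and x: "norm x \<le> R"
  shows "norm (attention x \<kappa> \<theta> - attention x \<mu> \<theta>) \<le> attn_bound D R *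
    norm ((\<integral>y. attn_residual \<theta> x (attention x \<mu> \<theta>) y \<partial>\<kappa>) - (\<integral>y. attn_residual \<theta> x (attention x \<mu> \<theta>) y \<partial>\<mu>))"
  using norm_attention_minus_le[OF assms(1,2) \<kappa> \<theta> x norm_attention_le[OF \<mu> \<theta> assms(2,1)]]
    attention_residual_zero[OF assms(1,2) \<mu> \<theta> x] by simp

lemma norm_head_velocity_diff_le:
  assumes "1 \<le> H" "\<And>r. r \<in> {1..H} \<Longrightarrow> norm (attention x \<mu> (\<theta> r) - attention x' \<mu>' (\<theta> r)) \<le> c"
  shows "norm (head_velocity H \<theta> x \<mu> - head_velocity H \<theta> x' \<mu>') \<le> c"
proof -
  have "head_velocity H \<theta> x \<mu> - head_velocity H \<theta> x' \<mu>'
      = (1 / real H) *\<^sub>R (\<Sum>r = 1..H. attention x \<mu> (\<theta> r) - attention x' \<mu>' (\<theta> r))"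
    by (simp add: head_velocity_def sum_subtractf scaleR_diff_right)
  also have "norm \<dots> \<le> (1 / real H) * (\<Sum>r = 1..H. norm (attention x \<mu> (\<theta> r) - attention x' \<mu>' (\<theta> r)))"
    by (simp add: norm_sum divide_right_mono)
  also have "\<dots> \<le> (1 / real H) * (\<Sum>r = 1..H. c)"
    using assms by (intro mult_left_mono sum_mono) auto
  finally show ?thesis using assms(1) by simp
qed

lemma norm_head_velocity_le:
  assumes "1 \<le> H" "0 \<le> D" "0 \<le> R" "borel_prob \<mu>" "AE y in \<mu>. norm y \<le> R" "\<And>r. r \<in> {1..H} \<Longrightarrow> norm (\<theta> r) \<le> D"
  shows "norm (head_velocity H \<theta> x \<mu>) \<le> D * R"
proof -
  have "norm (head_velocity H \<theta> x \<mu>) \<le> (1 / real H) * (\<Sum>r = 1..H. norm (attention x \<mu> (\<theta> r)))"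
    by (simp add: head_velocity_def norm_sum divide_right_mono)
  also have "\<dots> \<le> (1 / real H) * (\<Sum>r = 1..H. D * R)"
    using assms by (intro mult_left_mono sum_mono norm_attention_le) auto
  finally show ?thesis using assms(1) by simp
qed

context
  fixes D R :: real and \<mu> :: "(real ^ 'd::finite) measure" and \<rho> :: "('d, 'k::finite) head measure"
  assumes D0: "0 \<le> D" and R0: "0 \<le> R"
    and \<mu>: "borel_prob \<mu>" "AE y in \<mu>. norm y \<le> R" and \<rho>: "prob_measure_on (cball 0 D) \<rho>"
begin

lemma integrable_attention: "integrable \<rho> (attention x \<mu>)"
proof -
  interpret prob_space \<rho> using \<rho> by (simp add: prob_measure_on_def borel_prob_def)
  have [measurable_cong]: "sets \<rho> = sets borel" using \<rho> by (simp add: prob_measure_on_def borel_prob_def)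
  show ?thesis
  proof (rule integrable_const_bound)
    have "AE \<theta> in \<rho>. \<theta> \<in> cball 0 D" using \<rho> by (simp add: prob_measure_on_def)
    then show "AE \<theta> in \<rho>. norm (attention x \<mu> \<theta>) \<le> D * R"
      by eventually_elim (use norm_attention_le[OF \<mu> _ R0 D0] in auto)
    show "attention x \<mu> \<in> borel_measurable \<rho>" by (rule measurable_attention[OF \<mu>]) measurable
  qed
qed

lemma mean_velocity_lipschitz:
  assumes "norm x \<le> R" "norm x' \<le> R"
  shows "norm (mean_velocity \<rho> \<mu> x - mean_velocity \<rho> \<mu> x') \<le> attention_lip D R * norm (x - x')"
proof -
  interpret prob_space \<rho> using \<rho> by (simp add: prob_measure_on_def borel_prob_def)
  have "mean_velocity \<rho> \<mu> x - mean_velocity \<rho> \<mu> x' = (\<integral>\<theta>. attention x \<mu> \<theta> - attention x' \<mu> \<theta> \<partial>\<rho>)"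
    by (simp add: mean_velocity_def integrable_attention)
  also have "norm \<dots> \<le> (\<integral>\<theta>. attention_lip D R * norm (x - x') \<partial>\<rho>)"
  proof (rule norm_integral_le_AE)
    have "AE \<theta> in \<rho>. \<theta> \<in> cball 0 D" using \<rho> by (simp add: prob_measure_on_def)
    then show "AE \<theta> in \<rho>. norm (attention x \<mu> \<theta> - attention x' \<mu> \<theta>) \<le> attention_lip D R * norm (x - x')"
    proof eventually_elim
      case (elim \<theta>)
      then show ?case using attention_lipschitz[OF D0 R0 \<mu>, of \<theta> \<theta> x x'] assms by simp
    qed
  qed (auto simp: integrable_attention)
  finally show ?thesis by (simp add: prob_space)
qed

end

lemma continuous_mean_velocity:
  fixes \<rho> :: "('d::finite, 'k::finite) head measure"
  assumes D0: "0 \<le> D" and \<mu>: "borel_prob \<mu>" "AE y in \<mu>. norm y \<le> R" and \<rho>: "prob_measure_on (cball 0 D) \<rho>"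
  shows "continuous_on UNIV (mean_velocity \<rho> \<mu>)"
proof -
  have "continuous_on (\<Union>n :: nat. ball 0 (real n)) (mean_velocity \<rho> \<mu>)"
  proof (rule continuous_on_open_UN)
    fix n :: nat
    define r where "r = max (real n) R"
    have r0: "0 \<le> r" and rn: "real n \<le> r" by (auto simp: r_def)
    have \<mu>r: "AE y in \<mu>. norm y \<le> r" using \<mu>(2) by eventually_elim (auto simp: r_def)
    have "(attention_lip D r)-lipschitz_on (ball 0 (real n)) (mean_velocity \<rho> \<mu>)"
      using mean_velocity_lipschitz[OF D0 r0 \<mu>(1) \<mu>r \<rho>] attention_lip_nonneg[OF D0 r0] rn
      by (intro lipschitz_onI) (auto simp: dist_norm)
    then show "continuous_on (ball 0 (real n)) (mean_velocity \<rho> \<mu>)" by (rule lipschitz_on_continuous_on)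
  qed auto
  moreover have "(\<Union>n :: nat. ball (0 :: real ^ 'd) (real n)) = UNIV"
    using reals_Archimedean2 by auto
  ultimately show ?thesis by simp
qed

section \<open>Concentration for independent heads\<close>

lemma measurable_attention_component:
  fixes \<mu> :: "(real ^ 'd::finite) measure"
  assumes "borel_prob \<mu>" "AE y in \<mu>. norm y \<le> R"
  shows "(\<lambda>\<theta> :: ('d, 'k::finite) head. attention x \<mu> \<theta> $ i) \<in> borel_measurable borel"
proof -
  have "(\<lambda>v :: real ^ 'd. v $ i) \<in> borel_measurable borel"
    by (intro borel_measurable_continuous_onI continuous_intros)
  then show ?thesis by (rule measurable_compose[OF measurable_attention[OF assms], rotated 2]) measurable
qed

locale sampled_heads = prob_space M for M :: "'w measure" +
  fixes \<rho> :: "('d::finite, 'k::finite) head measure" and H :: nat and \<theta> :: "nat \<Rightarrow> 'w \<Rightarrow> ('d, 'k) head" and D :: real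
  assumes heads: "iid_heads M \<rho> H \<theta>" and D0: "0 \<le> D" and \<rho>: "prob_measure_on (cball 0 D) \<rho>" and H: "1 \<le> H"
begin

lemma head_indep: "indep_vars (\<lambda>_. borel) \<theta> {1..H}"
  using heads by (simp add: iid_heads_def)

lemma head_measurable[measurable]: "r \<in> {1..H} \<Longrightarrow> \<theta> r \<in> borel_measurable M"
  using head_indep by (auto simp: indep_vars_def)

lemma head_distr: "r \<in> {1..H} \<Longrightarrow> distr M borel (\<theta> r) = \<rho>"
  using heads by (simp add: iid_heads_def)

lemma head_bounded: "AE \<omega> in M. \<forall>r\<in>{1..H}. norm (\<theta> r \<omega>) \<le> D"
proof -
  have "AE \<omega> in M. norm (\<theta> r \<omega>) \<le> D" if r: "r \<in> {1..H}" for r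
  proof -
    have "AE x in distr M borel (\<theta> r). norm x \<le> D"
      using \<rho> unfolding head_distr[OF r] by (simp add: prob_measure_on_def)
    then show ?thesis using r by (subst (asm) AE_distr_iff) auto
  qed
  then show ?thesis by (intro AE_finite_allI) auto
qed

context
  fixes \<mu> :: "(real ^ 'd) measure" and R :: real and x :: "real ^ 'd"
  assumes \<mu>: "borel_prob \<mu>" "AE y in \<mu>. norm y \<le> R" and R0: "0 \<le> R"
begin

lemma head_component_indep: "indep_vars (\<lambda>_. borel) (\<lambda>r \<omega>. attention x \<mu> (\<theta> r \<omega>) $ i) {1..H}"
  by (rule indep_vars_compose2[OF head_indep])
     (rule measurable_attention_component[OF \<mu>])

lemma head_component_bounded:
  "r \<in> {1..H} \<Longrightarrow> AE \<omega> in M. \<bar>attention x \<mu> (\<theta> r \<omega>) $ i\<bar> \<le> D * R"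
  using head_bounded
proof eventually_elim
  case (elim \<omega>)
  then have "norm (attention x \<mu> (\<theta> r \<omega>)) \<le> D * R"
    by (intro norm_attention_le[OF \<mu> _ R0 D0]) auto
  then show ?case using component_le_norm_cart[of "attention x \<mu> (\<theta> r \<omega>)" i] by linarith
qed

lemma head_component_expectation:
  assumes r: "r \<in> {1..H}"
  shows "expectation (\<lambda>\<omega>. attention x \<mu> (\<theta> r \<omega>) $ i) = mean_velocity \<rho> \<mu> x $ i"
proof -
  have "mean_velocity \<rho> \<mu> x $ i = (\<integral>h. attention x \<mu> h $ i \<partial>\<rho>)"
    unfolding mean_velocity_def
    by (rule integral_bounded_linear[OF bounded_linear_vec_nth integrable_attention[OF D0 R0 \<mu> \<rho>], symmetric])
  also have "\<dots> = (\<integral>h. attention x \<mu> h $ i \<partial>distr M borel (\<theta> r))" by (simp add: head_distr[OF r])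
  also have "\<dots> = expectation (\<lambda>\<omega>. attention x \<mu> (\<theta> r \<omega>) $ i)"
    by (rule integral_distr[OF head_measurable[OF r]])
       (rule measurable_attention_component[OF \<mu>])
  finally show ?thesis ..
qed

lemma head_velocity_component:
  "(head_velocity H (\<lambda>r. \<theta> r \<omega>) x \<mu> - mean_velocity \<rho> \<mu> x) $ i
    = (\<Sum>r = 1..H. attention x \<mu> (\<theta> r \<omega>) $ i - mean_velocity \<rho> \<mu> x $ i) / real H"
  using H by (simp add: head_velocity_def sum_subtractf diff_divide_distrib)

lemma head_velocity_measurable: "(\<lambda>\<omega>. head_velocity H (\<lambda>r. \<theta> r \<omega>) x \<mu>) \<in> borel_measurable M"
  unfolding head_velocity_def
  by (intro borel_measurable_scaleR borel_measurable_const borel_measurable_sum measurable_attention[OF \<mu>] head_measurable)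

text \<open>Hoeffding's inequality is scalar, so it is applied to each coordinate. The norm is at
  most the sum of the absolute coordinates; a deviation beyond \<open>d * s\<close> thus forces some
  coordinate beyond \<open>s\<close>, whence the factor \<open>d\<close> in front of the scalar
  tail.\<close>

lemma head_velocity_deviation:
  assumes K: "0 < K" "D * R \<le> K" and s: "0 \<le> s"
  shows "prob {\<omega> \<in> space M. norm (head_velocity H (\<lambda>r. \<theta> r \<omega>) x \<mu> - mean_velocity \<rho> \<mu> x) > real CARD('d) * s}
    \<le> real CARD('d) * (2 * exp (- (real H * s\<^sup>2) / (2 * K\<^sup>2)))"
proof -
  let ?m = "mean_velocity \<rho> \<mu> x" and ?V = "\<lambda>\<omega>. head_velocity H (\<lambda>r. \<theta> r \<omega>) x \<mu>"
  note [measurable] = head_velocity_measurable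
  define B where "B i = {\<omega> \<in> space M. \<bar>(\<Sum>r = 1..H. attention x \<mu> (\<theta> r \<omega>) $ i) - (\<Sum>r = 1..H. expectation (\<lambda>\<omega>. attention x \<mu> (\<theta> r \<omega>) $ i))\<bar> \<ge> real H * s}" for i
  have B: "prob (B i) \<le> 2 * exp (- (real H * s\<^sup>2) / (2 * K\<^sup>2))" for i
  proof -
    interpret Hf: Hoeffding_ineq M "{1..H}" "\<lambda>r \<omega>. attention x \<mu> (\<theta> r \<omega>) $ i" "\<lambda>_. - K" "\<lambda>_. K"
      "\<Sum>r = 1..H. expectation (\<lambda>\<omega>. attention x \<mu> (\<theta> r \<omega>) $ i)"
    proof unfold_locales
      fix r assume r: "r \<in> {1..H}"
      show "AE \<omega> in M. attention x \<mu> (\<theta> r \<omega>) $ i \<in> {- K..K}"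
        using head_component_bounded[OF r, of i] by eventually_elim (use K in auto)
    qed (use head_component_indep in auto)
    have pos: "(\<Sum>r = 1..H. (K - - K)\<^sup>2) > 0" using H K by simp
    have "prob (B i) \<le> 2 * exp (- 2 * (real H * s)\<^sup>2 / (\<Sum>r = 1..H. (K - - K)\<^sup>2))"
      unfolding B_def using Hf.Hoeffding_ineq_abs_ge[OF _ pos, of "real H * s"] s by simp
    also have "- 2 * (real H * s)\<^sup>2 / (\<Sum>r = 1..H. (K - - K)\<^sup>2) = - (real H * s\<^sup>2) / (2 * K\<^sup>2)"
      using H K by (simp add: power2_eq_square field_simps)
    finally show ?thesis .
  qed
  have Bm: "B i \<in> events" for i
  proof -
    have [measurable]: "(\<lambda>\<omega>. attention x \<mu> (\<theta> r \<omega>) $ i) \<in> borel_measurable M" if "r \<in> {1..H}" for r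
      using head_component_indep[of i] that by (auto simp: indep_vars_def)
    show ?thesis unfolding B_def by measurable
  qed
  have "prob {\<omega> \<in> space M. norm (?V \<omega> - ?m) > real CARD('d) * s} \<le> prob (\<Union>i\<in>UNIV. B i)"
  proof (rule finite_measure_mono)
    show "{\<omega> \<in> space M. norm (?V \<omega> - ?m) > real CARD('d) * s} \<subseteq> (\<Union>i\<in>UNIV. B i)"
    proof (rule subsetI, rule ccontr)
      fix \<omega> assume \<omega>: "\<omega> \<in> {\<omega> \<in> space M. norm (?V \<omega> - ?m) > real CARD('d) * s}" "\<omega> \<notin> (\<Union>i\<in>UNIV. B i)"
      have "\<bar>(?V \<omega> - ?m) $ i\<bar> \<le> s" for i
      proof -
        have "\<bar>\<Sum>r = 1..H. attention x \<mu> (\<theta> r \<omega>) $ i - ?m $ i\<bar> \<le> real H * s"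
          using \<omega> by (auto simp: B_def sum_subtractf head_component_expectation not_le less_imp_le)
        then show ?thesis unfolding head_velocity_component using H by (simp add: field_simps)
      qed
      then have "norm (?V \<omega> - ?m) \<le> (\<Sum>i\<in>(UNIV::'d set). s)"
        by (intro order.trans[OF norm_le_l1_cart] sum_mono)
      with \<omega>(1) show False by simp
    qed
  qed (use Bm in auto)
  also have "\<dots> \<le> (\<Sum>i\<in>UNIV. prob (B i))" using Bm by (intro measure_UNION_le) auto
  also have "\<dots> \<le> (\<Sum>i\<in>(UNIV::'d set). 2 * exp (- (real H * s\<^sup>2) / (2 * K\<^sup>2)))"
    by (intro sum_mono B)
  finally show ?thesis by simp
qed

text \<open>In each coordinate the centred terms are independent with mean zero, so of the
  \<open>H^2\<close> products only the \<open>H\<close> diagonal ones survive, each at most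
  \<open>(2 * (D * R))^2\<close>. The token is fixed here, so no logarithm appears.\<close>

lemma head_velocity_variance:
  "(\<integral>\<^sup>+ \<omega>. ennreal ((norm (head_velocity H (\<lambda>r. \<theta> r \<omega>) x \<mu> - mean_velocity \<rho> \<mu> x))\<^sup>2) \<partial>M)
    \<le> ennreal (real CARD('d) * (2 * (D * R))\<^sup>2 / real H)"
proof -
  let ?m = "mean_velocity \<rho> \<mu> x" and ?V = "\<lambda>\<omega>. head_velocity H (\<lambda>r. \<theta> r \<omega>) x \<mu>"
  define Y where "Y i r \<omega> = attention x \<mu> (\<theta> r \<omega>) $ i - ?m $ i" for i r \<omega>
  have Y_indep: "indep_vars (\<lambda>_. borel) (Y i) {1..H}" for i
    unfolding Y_def by (rule indep_vars_compose2[OF head_component_indep]) auto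
  then have [measurable]: "r \<in> {1..H} \<Longrightarrow> Y i r \<in> borel_measurable M" for i r
    by (auto simp: indep_vars_def)
  have Y_bound: "AE \<omega> in M. \<bar>Y i r \<omega>\<bar> \<le> 2 * (D * R)" if "r \<in> {1..H}" for i r
    using head_component_bounded[OF that, of i]
  proof eventually_elim
    case (elim \<omega>)
    have "norm ?m \<le> D * R" by (rule norm_mean_velocity_le[OF \<rho> \<mu> R0 D0])
    then have "\<bar>?m $ i\<bar> \<le> D * R" using component_le_norm_cart[of ?m i] by linarith
    then show ?case using elim by (simp add: Y_def)
  qed
  have Y_int: "integrable M (Y i r)" if "r \<in> {1..H}" for i r
    using Y_bound[OF that, of i] that by (intro integrable_const_bound[of _ "2 * (D * R)"]) auto
  have Y_mean: "expectation (Y i r) = 0" if r: "r \<in> {1..H}" for i r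
  proof -
    have "integrable M (\<lambda>\<omega>. Y i r \<omega> + ?m $ i)" using Y_int[OF r] by (intro Bochner_Integration.integrable_add) auto
    then have "integrable M (\<lambda>\<omega>. attention x \<mu> (\<theta> r \<omega>) $ i)" by (simp add: Y_def)
    then show ?thesis unfolding Y_def using head_component_expectation[OF r, of i] by (simp add: prob_space)
  qed
  have YY_int: "integrable M (\<lambda>\<omega>. Y i r \<omega> * Y i q \<omega>)" if "r \<in> {1..H}" "q \<in> {1..H}" for i r q
  proof (rule integrable_const_bound)
    show "AE \<omega> in M. norm (Y i r \<omega> * Y i q \<omega>) \<le> (2 * (D * R)) * (2 * (D * R))"
      using Y_bound[OF that(1), of i] Y_bound[OF that(2), of i]
      by eventually_elim (simp only: real_norm_def abs_mult, intro mult_mono, auto)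
  qed (use that in measurable)
  have YY: "expectation (\<lambda>\<omega>. Y i r \<omega> * Y i q \<omega>) \<le> (if r = q then (2 * (D * R))\<^sup>2 else 0)"
    if r: "r \<in> {1..H}" and q: "q \<in> {1..H}" for i r q
  proof (cases "r = q")
    case True
    have "expectation (\<lambda>\<omega>. Y i r \<omega> * Y i r \<omega>) \<le> expectation (\<lambda>\<omega>. (2 * (D * R))\<^sup>2)"
    proof (rule integral_mono_AE)
      show "AE \<omega> in M. Y i r \<omega> * Y i r \<omega> \<le> (2 * (D * R))\<^sup>2"
        using Y_bound[OF r, of i]
        by eventually_elim (metis power2_eq_square abs_le_square_iff abs_of_nonneg abs_ge_zero order.trans)
    qed (use YY_int[OF r r] in auto)
    then show ?thesis using True by (simp add: prob_space)
  next
    case False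
    \<comment> \<open>Independence factors the expectation of the product, and each factor is
      zero.\<close>
    have "indep_vars (\<lambda>_. borel) (Y i) {r, q}"
      by (rule indep_vars_subset[OF Y_indep]) (use r q in auto)
    from indep_vars_lebesgue_integral[OF _ this]
    have "expectation (\<lambda>\<omega>. \<Prod>j\<in>{r, q}. Y i j \<omega>) = (\<Prod>j\<in>{r, q}. expectation (Y i j))"
      using Y_int r q by blast
    then show ?thesis using False Y_mean[OF r, of i] by simp
  qed
  have comp: "expectation (\<lambda>\<omega>. ((?V \<omega> - ?m) $ i)\<^sup>2) \<le> (2 * (D * R))\<^sup>2 / real H"
    and comp_int: "integrable M (\<lambda>\<omega>. ((?V \<omega> - ?m) $ i)\<^sup>2)" for i
  proof -
    have eq: "((?V \<omega> - ?m) $ i)\<^sup>2 = (\<Sum>r=1..H. \<Sum>q=1..H. Y i r \<omega> * Y i q \<omega>) / (real H)\<^sup>2" for \<omega>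
      unfolding head_velocity_component Y_def power_divide by (simp add: power2_eq_square sum_product)
    show "integrable M (\<lambda>\<omega>. ((?V \<omega> - ?m) $ i)\<^sup>2)"
      unfolding eq by (intro integrable_divide Bochner_Integration.integrable_sum YY_int) auto
    have "expectation (\<lambda>\<omega>. ((?V \<omega> - ?m) $ i)\<^sup>2) = (\<Sum>r=1..H. \<Sum>q=1..H. expectation (\<lambda>\<omega>. Y i r \<omega> * Y i q \<omega>)) / (real H)\<^sup>2"
    proof -
      have "expectation (\<lambda>\<omega>. \<Sum>r=1..H. \<Sum>q=1..H. Y i r \<omega> * Y i q \<omega>)
          = (\<Sum>r=1..H. expectation (\<lambda>\<omega>. \<Sum>q=1..H. Y i r \<omega> * Y i q \<omega>))"
        by (intro Bochner_Integration.integral_sum Bochner_Integration.integrable_sum YY_int)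
      also have "\<dots> = (\<Sum>r=1..H. \<Sum>q=1..H. expectation (\<lambda>\<omega>. Y i r \<omega> * Y i q \<omega>))"
        by (intro sum.cong refl Bochner_Integration.integral_sum YY_int)
      finally show ?thesis unfolding eq by simp
    qed
    also have "\<dots> \<le> (\<Sum>r=1..H. \<Sum>q=1..H. if r = q then (2 * (D * R))\<^sup>2 else 0) / (real H)\<^sup>2"
      by (intro divide_right_mono sum_mono YY) auto
    also have "\<dots> = (2 * (D * R))\<^sup>2 / real H"
      using H by (simp add: power2_eq_square)
    finally show "expectation (\<lambda>\<omega>. ((?V \<omega> - ?m) $ i)\<^sup>2) \<le> (2 * (D * R))\<^sup>2 / real H" .
  qed
  have norm_eq: "(norm v)\<^sup>2 = (\<Sum>i\<in>UNIV. (v $ i)\<^sup>2)" for v :: "real ^ 'd"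
    by (simp add: norm_vec_def L2_set_def sum_nonneg)
  have "(\<integral>\<^sup>+ \<omega>. ennreal ((norm (?V \<omega> - ?m))\<^sup>2) \<partial>M) = ennreal (expectation (\<lambda>\<omega>. (norm (?V \<omega> - ?m))\<^sup>2))"
    unfolding norm_eq using comp_int by (intro nn_integral_eq_integral) (auto intro!: sum_nonneg)
  also have "expectation (\<lambda>\<omega>. (norm (?V \<omega> - ?m))\<^sup>2) = (\<Sum>i\<in>UNIV. expectation (\<lambda>\<omega>. ((?V \<omega> - ?m) $ i)\<^sup>2))"
    unfolding norm_eq using comp_int by (rule Bochner_Integration.integral_sum)
  also have "\<dots> \<le> (\<Sum>i\<in>(UNIV::'d set). (2 * (D * R))\<^sup>2 / real H)" by (intro sum_mono comp)
  finally show ?thesis by (simp add: ennreal_leI)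
qed

end

end

section \<open>Uniform deviation bound by a grid\<close>

lemma finite_net_cball:
  fixes R \<delta> :: real
  assumes R: "0 \<le> R" and \<delta>: "0 < \<delta>"
  obtains N :: "(real ^ 'd::finite) set" where "finite N" "real (card N) \<le> (2 * (R / \<delta>) + 5) ^ CARD('d)"
    "\<And>x. norm x \<le> R \<Longrightarrow> \<exists>z\<in>N. norm (x - z) \<le> real CARD('d) * \<delta>"
proof -
  define m where "m = \<lceil>R / \<delta>\<rceil> + 1"
  have "0 \<le> R / \<delta>" using R \<delta> by simp
  then have m0: "0 \<le> m" unfolding m_def by linarith
  define Z where "Z = PiE (UNIV :: 'd set) (\<lambda>_. {- m..m})"
  define N where "N = (\<lambda>z. \<chi> i. \<delta> * of_int (z i)) ` Z"
  have fin: "finite Z" unfolding Z_def by (intro finite_PiE) auto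
  show thesis
  proof (rule that)
    show "finite N" unfolding N_def using fin by simp
    have "real (card N) \<le> real (card Z)" unfolding N_def by (intro of_nat_mono card_image_le fin)
    also have "card Z = nat (2 * m + 1) ^ CARD('d)" by (simp add: Z_def card_PiE)
    also have "real (\<dots>) = (2 * of_int m + 1) ^ CARD('d)" using m0 by simp
    \<comment> \<open>\<open>m\<close> is at most \<open>R / \<delta> + 2\<close>, which gives the
      5.\<close>
    also have "\<dots> \<le> (2 * (R / \<delta>) + 5) ^ CARD('d)"
    proof (rule power_mono)
      define u where "u = real_of_int \<lceil>R / \<delta>\<rceil>"
      have "u \<le> R / \<delta> + 1" unfolding u_def by (rule of_int_ceiling_le_add_one)
      then show "2 * real_of_int m + 1 \<le> 2 * (R / \<delta>) + 5" by (simp add: m_def u_def[symmetric])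
    qed (use m0 in auto)
    finally show "real (card N) \<le> (2 * (R / \<delta>) + 5) ^ CARD('d)" .
    fix x :: "real ^ 'd" assume x: "norm x \<le> R"
    define z where "z i = \<lfloor>x $ i / \<delta>\<rfloor>" for i
    have "\<bar>x $ i\<bar> \<le> R" for i using component_le_norm_cart[of x i] x by linarith
    then have xi: "\<bar>x $ i / \<delta>\<bar> \<le> R / \<delta>" for i using \<delta> by (simp add: divide_right_mono)
    have "z i \<in> {- m..m}" for i
    proof -
      have "- (R / \<delta>) \<le> x $ i / \<delta>" "x $ i / \<delta> \<le> R / \<delta>" using xi[of i] by linarith+
      then have "- \<lceil>R / \<delta>\<rceil> \<le> z i" "z i \<le> \<lceil>R / \<delta>\<rceil>"
        unfolding z_def floor_minus[symmetric] using floor_le_ceiling[of "R / \<delta>"]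
        by (blast intro: floor_mono order.trans)+
      then show ?thesis by (simp add: m_def)
    qed
    then have "(\<chi> i. \<delta> * of_int (z i)) \<in> N" unfolding N_def Z_def by auto
    moreover have "norm (x - (\<chi> i. \<delta> * of_int (z i))) \<le> real CARD('d) * \<delta>"
    proof -
      have "\<bar>(x - (\<chi> i. \<delta> * of_int (z i))) $ i\<bar> \<le> \<delta>" for i
      proof -
        have "x $ i - \<delta> * of_int (z i) = \<delta> * (x $ i / \<delta> - of_int (z i))" using \<delta> by (simp add: field_simps)
        moreover have "\<bar>x $ i / \<delta> - of_int (z i)\<bar> \<le> 1" unfolding z_def by linarith
        ultimately show ?thesis using \<delta> by (simp add: abs_mult mult_left_le)
      qed
      then have "norm (x - (\<chi> i. \<delta> * of_int (z i))) \<le> (\<Sum>i\<in>(UNIV::'d set). \<delta>)"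
        by (intro order.trans[OF norm_le_l1_cart] sum_mono)
      then show ?thesis by simp
    qed
    ultimately show "\<exists>z\<in>N. norm (x - z) \<le> real CARD('d) * \<delta>" by blast
  qed
qed

text \<open>With \<open>P\<close> countable this makes a supremum over the uncountable ball
  measurable. If the value at \<open>x\<close> exceeded the supremum over \<open>P\<close>, it would
  do so in a neighbourhood of \<open>x\<close>, and \<open>P\<close> has points there.\<close>

lemma SUP_dense_eq:
  fixes f :: "'a::topological_space \<Rightarrow> real"
  assumes cont: "continuous_on S f" and P: "P \<subseteq> S" "S \<subseteq> closure P" and S: "compact S" "S \<noteq> {}"
  shows "(SUP x\<in>S. f x) = (SUP x\<in>P. f x)"
proof (rule antisym)
  have bdd: "bdd_above (f ` S)"
    using compact_continuous_image[OF cont S(1)] by (intro bounded_imp_bdd_above compact_imp_bounded)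
  have Pne: "P \<noteq> {}" using P(2) S(2) by auto
  have bddP: "bdd_above (f ` P)" using bdd P(1) by (meson bdd_above_mono image_mono)
  show "(SUP x\<in>P. f x) \<le> (SUP x\<in>S. f x)" using P(1) Pne bdd by (intro cSUP_subset_mono) auto
  show "(SUP x\<in>S. f x) \<le> (SUP x\<in>P. f x)"
  proof (rule cSUP_least[OF S(2)])
    fix x assume x: "x \<in> S"
    have "continuous_on (S \<inter> closure P) f" using cont by (rule continuous_on_subset) auto
    show "f x \<le> (SUP x\<in>P. f x)"
    proof (rule ccontr)
      assume "\<not> ?thesis"
      then have "(SUP x\<in>P. f x) < f x" by simp
      moreover have "(f \<longlongrightarrow> f x) (at x within S)" using cont x by (simp add: continuous_on_def)
      ultimately have "\<forall>\<^sub>F y in at x within S. (SUP x\<in>P. f x) < f y" by (rule order_tendstoD[rotated])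
      then obtain U where U: "open U" "x \<in> U" "\<And>y. y \<in> U \<Longrightarrow> y \<in> S \<Longrightarrow> y \<noteq> x \<Longrightarrow> (SUP x\<in>P. f x) < f y"
        unfolding eventually_at_topological by blast
      have "U \<inter> P \<noteq> {}" using U P(2) x open_Int_closure_eq_empty[OF U(1), of P] by auto
      then obtain y where y: "y \<in> U" "y \<in> P" by auto
      then have "(SUP x\<in>P. f x) < f y" using U(3)[of y] P(1) \<open>(SUP x\<in>P. f x) < f x\<close> by (cases "y = x") auto
      moreover have "f y \<le> (SUP x\<in>P. f x)" by (rule cSUP_upper[OF y(2) bddP])
      ultimately show False by simp
    qed
  qed
qed

text \<open>The second part absorbs any error of order \<open>1 / sqrt H\<close> into the rate with
  the logarithm, at the price of a factor \<open>1 / sqrt (ln 2)\<close>.\<close>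

lemma powr_half_sqrt_ln:
  assumes "2 \<le> (H :: nat)"
  shows "(real H powr (- 1 / 2) * sqrt (ln (real H)))\<^sup>2 = ln (real H) / real H"
    and "sqrt (ln 2) / sqrt (real H) \<le> real H powr (- 1 / 2) * sqrt (ln (real H))"
proof -
  have H: "0 < real H" "2 \<le> real H" using assms by auto
  have powr: "real H powr (- 1 / 2) = 1 / sqrt (real H)"
    using H by (simp add: powr_minus powr_half_sqrt inverse_eq_divide)
  have "0 \<le> ln (real H)" using H by simp
  then show "(real H powr (- 1 / 2) * sqrt (ln (real H)))\<^sup>2 = ln (real H) / real H"
    unfolding powr using H by (simp add: power_mult_distrib power_divide)
  have "sqrt (ln 2) \<le> sqrt (ln (real H))" using H by (intro real_sqrt_le_mono) simp
  then show "sqrt (ln 2) / sqrt (real H) \<le> real H powr (- 1 / 2) * sqrt (ln (real H))"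
    unfolding powr using H by (simp add: divide_right_mono)
qed

context sampled_heads
begin

lemma sup_deviation_measurable:
  assumes \<mu>: "borel_prob \<mu>" "AE y in \<mu>. norm y \<le> r" and R0: "0 \<le> R"
  shows "(\<lambda>\<omega>. SUP x\<in>cball 0 R. norm (head_velocity H (\<lambda>r. \<theta> r \<omega>) x \<mu> - mean_velocity \<rho> \<mu> x)) \<in> borel_measurable M"
proof -
  let ?f = "\<lambda>\<omega> x. norm (head_velocity H (\<lambda>r. \<theta> r \<omega>) x \<mu> - mean_velocity \<rho> \<mu> x)"
  obtain P where P: "countable P" "P \<subseteq> cball 0 R" "cball (0 :: real ^ 'd) R \<subseteq> closure P"
    using separable[of "cball (0 :: real ^ 'd) R"] by blast
  have r: "AE y in \<mu>. norm y \<le> \<bar>r\<bar>" using \<mu>(2) by eventually_elim auto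
  have cont: "continuous_on (cball 0 R) (?f \<omega>)" for \<omega>
    unfolding head_velocity_def
    using continuous_on_subset[OF continuous_attention_fst[OF \<mu>]] continuous_on_subset[OF continuous_mean_velocity[OF D0 \<mu> \<rho>]]
    by (intro continuous_on_norm continuous_on_diff continuous_on_scaleR continuous_on_const continuous_on_sum) (blast intro: subset_UNIV)+
  have "(\<lambda>\<omega>. SUP x\<in>cball 0 R. ?f \<omega> x) = (\<lambda>\<omega>. SUP x\<in>P. ?f \<omega> x)"
    using cont P(2,3) R0 by (intro ext SUP_dense_eq) auto
  also have "\<dots> \<in> borel_measurable M"
  proof (rule borel_measurable_cSUP[OF P(1)])
    show "(\<lambda>\<omega>. ?f \<omega> x) \<in> borel_measurable M" for x
      using head_velocity_measurable[OF \<mu>(1) r] by measurable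
    show "bdd_above ((\<lambda>x. ?f \<omega> x) ` P)" for \<omega>
    proof (rule bdd_above_mono)
      show "bdd_above ((\<lambda>x. ?f \<omega> x) ` cball 0 R)"
        using compact_continuous_image[OF cont compact_cball] by (intro bounded_imp_bdd_above compact_imp_bounded)
    qed (use P(2) in auto)
  qed
  finally show ?thesis .
qed

text \<open>With mesh \<open>1 / sqrt H\<close> there are at most \<open>(2 * R + 5)^d * H^d\<close>
  grid points. The value of \<open>a\<close> makes each of them deviate with probability at most
  \<open>2 * d / H^(d + p)\<close>, so the union bound leaves \<open>H^p\<close> in the denominator,
  and \<open>p\<close> is free to make the result small. The second term of \<open>C\<close> is the
  Lipschitz error of the two fields over one mesh width. The law \<open>\<mu>\<close> enters the
  constants through \<open>R\<close> alone.\<close>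

lemma sup_deviation_tail:
  fixes \<mu> :: "(real ^ 'd) measure" and R :: real and p :: nat
  defines "d \<equiv> CARD('d)"
  defines "L \<equiv> attention_lip D (R + real d)"
  defines "a \<equiv> sqrt (2 * (D * R + 1)\<^sup>2 * real (d + p))"
  defines "C \<equiv> real d * a + 2 * L * real d / sqrt (ln 2)"
  assumes \<mu>: "borel_prob \<mu>" "AE y in \<mu>. norm y \<le> R" and R0: "0 \<le> R" and H2: "2 \<le> H"
  shows "prob {\<omega> \<in> space M. (SUP x\<in>cball 0 R. norm (head_velocity H (\<lambda>r. \<theta> r \<omega>) x \<mu> - mean_velocity \<rho> \<mu> x))
        > C * (real H powr (- 1 / 2) * sqrt (ln (real H)))}
      \<le> 2 * real d * (2 * R + 5) ^ d / 2 ^ p"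
proof -
  let ?f = "\<lambda>\<omega> x. norm (head_velocity H (\<lambda>r. \<theta> r \<omega>) x \<mu> - mean_velocity \<rho> \<mu> x)"
  define s where "s = real H powr (- 1 / 2) * sqrt (ln (real H))"
  define \<delta> where "\<delta> = 1 / sqrt (real H)"
  have H0: "0 < real H" "2 \<le> real H" using H2 by auto
  have s2: "s\<^sup>2 = ln (real H) / real H" using powr_half_sqrt_ln(1)[OF H2] by (simp add: s_def)
  have s0: "0 \<le> s" using H0 by (simp add: s_def)
  have sqH: "1 \<le> sqrt (real H)" using H0 by simp
  have \<delta>: "0 < \<delta>" "\<delta> \<le> 1" using sqH H0 by (auto simp: \<delta>_def)
  have \<delta>s: "\<delta> \<le> s / sqrt (ln 2)"
    using powr_half_sqrt_ln(2)[OF H2] by (simp add: \<delta>_def s_def field_simps)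
  have L0: "0 \<le> L" unfolding L_def using D0 R0 by (intro attention_lip_nonneg) auto
  have a0: "0 \<le> a" by (simp add: a_def)
  \<comment> \<open>The added 1 keeps the interval for Hoeffding's inequality nondegenerate when
    \<open>D * R\<close> is zero.\<close>
  have K: "0 < D * R + 1" "D * R \<le> D * R + 1" using D0 R0 by (auto intro: add_nonneg_pos)
  obtain N :: "(real ^ 'd) set" where N: "finite N" "real (card N) \<le> (2 * (R / \<delta>) + 5) ^ d"
    "\<And>x. norm x \<le> R \<Longrightarrow> \<exists>z\<in>N. norm (x - z) \<le> real d * \<delta>"
    using finite_net_cball[OF R0 \<delta>(1), where 'd = 'd] unfolding d_def by metis
  define B where "B z = {\<omega> \<in> space M. ?f \<omega> z > real d * (a * s)}" for z
  have Bm: "B z \<in> events" for z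
    unfolding B_def using head_velocity_measurable[OF \<mu> R0, of z] by measurable
  have Bp: "prob (B z) \<le> real d * (2 * (1 / real H ^ (d + p)))" for z
  proof -
    have as: "0 \<le> a * s" using a0 s0 by simp
    have a2: "a\<^sup>2 = 2 * (D * R + 1)\<^sup>2 * real (d + p)" by (simp add: a_def)
    \<comment> \<open>The factor \<open>ln H\<close> inside \<open>s^2\<close> turns the Gaussian
      tail into a power of \<open>H\<close>.\<close>
    have "real H * (a * s)\<^sup>2 / (2 * (D * R + 1)\<^sup>2) = real (d + p) * ln (real H)"
      unfolding power_mult_distrib a2 s2 using H0 K(1) by (simp add: field_simps)
    then have "exp (- (real H * (a * s)\<^sup>2) / (2 * (D * R + 1)\<^sup>2)) = exp (- (real (d + p) * ln (real H)))"
      by simp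
    also have "\<dots> = 1 / real H ^ (d + p)"
      using H0 by (simp add: exp_minus exp_of_nat_mult inverse_eq_divide del: of_nat_add)
    finally show ?thesis
      using head_velocity_deviation[OF \<mu> R0 K as, of z] unfolding B_def d_def by simp
  qed
  have "prob {\<omega> \<in> space M. (SUP x\<in>cball 0 R. ?f \<omega> x) > C * s} \<le> prob (\<Union>z\<in>N. B z)"
  proof (rule finite_measure_mono_AE)
    show "(\<Union>z\<in>N. B z) \<in> events" using Bm N(1) by auto
    show "AE \<omega> in M. \<omega> \<in> {\<omega> \<in> space M. (SUP x\<in>cball 0 R. ?f \<omega> x) > C * s} \<longrightarrow> \<omega> \<in> (\<Union>z\<in>N. B z)"
      using head_bounded AE_space
    proof eventually_elim
      case (elim \<omega>)
      \<comment> \<open>Grid points may lie outside the ball of radius \<open>R\<close>, but those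
        used are within \<open>d * \<delta> \<le> d\<close> of it, so the Lipschitz constants are
        taken for the radius \<open>R + d\<close>.\<close>
      have R'0: "0 \<le> R + real d" using R0 by simp
      have \<mu>': "AE y in \<mu>. norm y \<le> R + real d" using \<mu>(2) by eventually_elim simp
      have le: "?f \<omega> x \<le> C * s" if x: "norm x \<le> R" and nB: "\<And>z. z \<in> N \<Longrightarrow> \<omega> \<notin> B z" for x
      proof -
        obtain z where z: "z \<in> N" "norm (x - z) \<le> real d * \<delta>" using N(3)[OF x] by blast
        have fz: "?f \<omega> z \<le> real d * (a * s)" using nB[OF z(1)] elim(2) by (auto simp: B_def not_less)
        have "real d * \<delta> \<le> real d" using \<delta> by (simp add: mult_left_le)
        then have nz: "norm z \<le> R + real d" using z(2) x norm_triangle_ineq2[of z x] by (simp add: norm_minus_commute)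
        have nx: "norm x \<le> R + real d" using x by simp
        have "norm (head_velocity H (\<lambda>r. \<theta> r \<omega>) x \<mu> - head_velocity H (\<lambda>r. \<theta> r \<omega>) z \<mu>) \<le> L * norm (x - z)"
        proof (rule norm_head_velocity_diff_le[OF H])
          fix r assume "r \<in> {1..H}"
          then have "norm (\<theta> r \<omega>) \<le> D" using elim(1) by blast
          from attention_lipschitz[OF D0 R'0 \<mu>(1) \<mu>' this this nx nz]
          show "norm (attention x \<mu> (\<theta> r \<omega>) - attention z \<mu> (\<theta> r \<omega>)) \<le> L * norm (x - z)" by (simp add: L_def)
        qed
        moreover have "norm (mean_velocity \<rho> \<mu> x - mean_velocity \<rho> \<mu> z) \<le> L * norm (x - z)"
          unfolding L_def by (rule mean_velocity_lipschitz[OF D0 R'0 \<mu>(1) \<mu>' \<rho> nx nz])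
        ultimately have "?f \<omega> x \<le> ?f \<omega> z + 2 * L * norm (x - z)"
          using norm_triangle_ineq[of "head_velocity H (\<lambda>r. \<theta> r \<omega>) z \<mu> - mean_velocity \<rho> \<mu> z"
              "(head_velocity H (\<lambda>r. \<theta> r \<omega>) x \<mu> - head_velocity H (\<lambda>r. \<theta> r \<omega>) z \<mu>) - (mean_velocity \<rho> \<mu> x - mean_velocity \<rho> \<mu> z)"]
            norm_triangle_ineq4[of "head_velocity H (\<lambda>r. \<theta> r \<omega>) x \<mu> - head_velocity H (\<lambda>r. \<theta> r \<omega>) z \<mu>" "mean_velocity \<rho> \<mu> x - mean_velocity \<rho> \<mu> z"]
          by simp
        also have "\<dots> \<le> real d * (a * s) + 2 * L * (real d * (s / sqrt (ln 2)))"
          using fz z(2) L0 \<delta>s by (intro add_mono mult_left_mono order.trans[OF z(2)]) auto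
        also have "\<dots> = C * s" by (simp add: C_def algebra_simps)
        finally show ?thesis .
      qed
      show ?case
      proof (intro impI, rule ccontr)
        assume *: "\<omega> \<in> {\<omega> \<in> space M. (SUP x\<in>cball 0 R. ?f \<omega> x) > C * s}" "\<omega> \<notin> (\<Union>z\<in>N. B z)"
        have "(SUP x\<in>cball 0 R. ?f \<omega> x) \<le> C * s"
          using *(2) R0 by (intro cSUP_least) (auto intro!: le)
        with *(1) show False by simp
      qed
    qed
  qed
  also have "\<dots> \<le> (\<Sum>z\<in>N. prob (B z))" using Bm N(1) by (intro measure_UNION_le) auto
  also have "\<dots> \<le> (\<Sum>z\<in>N. real d * (2 * (1 / real H ^ (d + p))))" by (intro sum_mono Bp)
  also have "\<dots> = real (card N) * (2 * real d / real H ^ (d + p))" by simp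
  also have "\<dots> \<le> ((2 * R + 5) ^ d * real H ^ d) * (2 * real d / real H ^ (d + p))"
  proof (rule mult_right_mono)
    have "2 * (R / \<delta>) + 5 \<le> (2 * R + 5) * sqrt (real H)"
      using sqH R0 by (simp add: \<delta>_def algebra_simps)
    \<comment> \<open>Coarsening \<open>sqrt H\<close> to \<open>H\<close> keeps all exponents
      natural numbers; the summand \<open>d\<close> in the definition of \<open>a\<close> pays for
      it.\<close>
    also have "\<dots> \<le> (2 * R + 5) * real H"
      using R0 H0 by (intro mult_left_mono) (auto simp: sqrt_le_D real_le_lsqrt power2_eq_square)
    finally have "(2 * (R / \<delta>) + 5) ^ d \<le> ((2 * R + 5) * real H) ^ d"
      using R0 \<delta> by (intro power_mono) auto
    with N(2) show "real (card N) \<le> (2 * R + 5) ^ d * real H ^ d" by (simp add: power_mult_distrib)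
  qed simp
  also have "\<dots> = 2 * real d * (2 * R + 5) ^ d / real H ^ p"
    using H0 by (simp add: power_add)
  also have "\<dots> \<le> 2 * real d * (2 * R + 5) ^ d / 2 ^ p"
    using H0 R0 by (intro divide_left_mono power_mono mult_pos_pos mult_nonneg_nonneg zero_le_power) auto
  finally show ?thesis unfolding s_def .
qed

end

text \<open>The order of quantifiers is the point: \<open>\<epsilon>\<close> fixes \<open>p\<close>,
  and \<open>p\<close>, \<open>D\<close>, \<open>R\<close> and the dimension fix \<open>C\<close>,
  before \<open>H\<close>, the sample space, the heads and the law are chosen.\<close>

lemma head_velocity_uniform:
  fixes \<rho> :: "('d::finite, 'k::finite) head measure"
  assumes D0: "0 \<le> D" and \<rho>: "prob_measure_on (cball 0 D) \<rho>" and R0: "0 \<le> R" and \<epsilon>: "0 < (\<epsilon> :: real)"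
  obtains C :: real where "\<And>H (M :: 'w measure) \<theta> \<mu>. 2 \<le> H \<Longrightarrow> iid_heads M \<rho> H \<theta> \<Longrightarrow> borel_prob \<mu> \<Longrightarrow> AE y in \<mu>. norm y \<le> R \<Longrightarrow>
    measure M {\<omega> \<in> space M. (SUP x\<in>cball 0 R. norm (head_velocity H (\<lambda>r. \<theta> r \<omega>) x \<mu> - mean_velocity \<rho> \<mu> x))
        > C * (real H powr (- 1 / 2) * sqrt (ln (real H)))} \<le> \<epsilon>"
proof -
  let ?A = "2 * real CARD('d) * (2 * R + 5) ^ CARD('d)"
  obtain p :: nat where p: "?A / \<epsilon> < 2 ^ p" using real_arch_pow[of 2 "?A / \<epsilon>"] by auto
  then have A: "?A / 2 ^ p \<le> \<epsilon>" using \<epsilon> by (simp add: field_simps)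
  show thesis
  proof (rule that)
    fix H and M :: "'w measure" and \<theta> and \<mu> :: "(real ^ 'd) measure"
    assume *: "2 \<le> H" "iid_heads M \<rho> H \<theta>" "borel_prob \<mu>" "AE y in \<mu>. norm y \<le> R"
    interpret prob_space M using *(2) by (simp add: iid_heads_def)
    interpret sampled_heads M \<rho> H \<theta> D using * D0 \<rho> by unfold_locales auto
    from order.trans[OF sup_deviation_tail[OF *(3,4) R0 *(1), of p] A]
    show "measure M {\<omega> \<in> space M. (SUP x\<in>cball 0 R. norm (head_velocity H (\<lambda>r. \<theta> r \<omega>) x \<mu> - mean_velocity \<rho> \<mu> x))
        > (real CARD('d) * sqrt (2 * (D * R + 1)\<^sup>2 * real (CARD('d) + p)) + 2 * attention_lip D (R + real CARD('d)) * real CARD('d) / sqrt (ln 2))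
          * (real H powr (- 1 / 2) * sqrt (ln (real H)))} \<le> \<epsilon>" .
  qed
qed

section \<open>Processes with differentiable paths\<close>

text \<open>Rounding the time down to multiples of \<open>1 / (n + 1)\<close> leaves countably many
  measurable functions to choose from, so the rounded process is jointly measurable; continuity in
  time gives convergence.\<close>

lemma borel_measurable_Caratheodory:
  fixes F :: "real \<Rightarrow> 'w \<Rightarrow> real"
  assumes meas: "\<And>t. F t \<in> borel_measurable M"
    and cont: "\<And>\<omega>. continuous_on UNIV (\<lambda>t. F t \<omega>)"
  shows "(\<lambda>(t, \<omega>). F t \<omega>) \<in> borel_measurable (borel \<Otimes>\<^sub>M M)"
proof -
  define G where "G n p = F (of_int \<lfloor>real (Suc n) * fst p\<rfloor> / real (Suc n)) (snd p)"
    for n :: nat and p :: "real \<times> 'w"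
  show ?thesis
  proof (rule borel_measurable_LIMSEQ_metric)
    show "G n \<in> borel_measurable (borel \<Otimes>\<^sub>M M)" for n
      unfolding G_def
    proof (rule measurable_compose_countable[where g = "\<lambda>p. \<lfloor>real (Suc n) * fst p\<rfloor>"])
      show "(\<lambda>p. F (real_of_int i / real (Suc n)) (snd p)) \<in> borel_measurable (borel \<Otimes>\<^sub>M M)" for i
        by (rule measurable_compose[OF measurable_snd meas])
    qed measurable
    fix p :: "real \<times> 'w"
    obtain t \<omega> where p: "p = (t, \<omega>)" by (cases p)
    have "(\<lambda>n. of_int \<lfloor>real (Suc n) * t\<rfloor> / real (Suc n)) \<longlonglongrightarrow> t"
    proof (rule LIMSEQ_I)
      fix e :: real assume "0 < e"
      obtain N where N: "inverse (real (Suc N)) < e" using reals_Archimedean[OF \<open>0 < e\<close>] by blast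
      show "\<exists>N. \<forall>n\<ge>N. norm (of_int \<lfloor>real (Suc n) * t\<rfloor> / real (Suc n) - t) < e"
      proof (intro exI allI impI)
        fix n assume n: "N \<le> n"
        have "\<bar>of_int \<lfloor>real (Suc n) * t\<rfloor> / real (Suc n) - t\<bar>
            = \<bar>of_int \<lfloor>real (Suc n) * t\<rfloor> - real (Suc n) * t\<bar> / real (Suc n)"
          by (subst abs_of_pos[of "real (Suc n)", symmetric], simp, subst abs_divide[symmetric])
             (simp add: diff_divide_distrib del: of_nat_Suc)
        also have "\<dots> \<le> 1 / real (Suc n)"
          by (intro divide_right_mono) linarith+
        also have "\<dots> \<le> inverse (real (Suc N))" using n by (simp add: field_simps)
        finally show "norm (of_int \<lfloor>real (Suc n) * t\<rfloor> / real (Suc n) - t) < e" using N by simp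
      qed
    qed
    moreover have "isCont (\<lambda>t. F t \<omega>) t"
      using cont[of \<omega>] by (simp add: continuous_on_eq_continuous_at)
    ultimately show "(\<lambda>n. G n p) \<longlonglongrightarrow> (case p of (t, \<omega>) \<Rightarrow> F t \<omega>)"
      unfolding G_def p prod.case fst_conv snd_conv by (rule isCont_tendsto_compose[rotated])
  qed
qed

text \<open>
  The bound on the derivative holds only almost surely for each fixed time, with an exceptional set
  that may depend on the time. Since the derivative is jointly measurable, Tonelli's theorem
  exchanges the quantifiers.
\<close>

lemma AE_increment_le:
  fixes f f' :: "real \<Rightarrow> 'w \<Rightarrow> real" and T :: real
  assumes M: "prob_space M" and T: "0 < T"
    and meas: "\<And>t. t \<in> {0..T} \<Longrightarrow> f t \<in> borel_measurable M"
    and deriv: "AE \<omega> in M. \<forall>t\<in>{0..T}. ((\<lambda>s. f s \<omega>) has_real_derivative f' t \<omega>) (at t within {0..T})"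
    and bound: "\<And>t. t \<in> {0..T} \<Longrightarrow> (\<integral>\<^sup>+ \<omega>. ennreal (f' t \<omega>) \<partial>M) \<le> ennreal (\<psi> t)"
    and \<Psi>: "\<And>t. t \<in> {0..T} \<Longrightarrow> (\<Psi> has_real_derivative \<psi> t) (at t)"
    and \<psi>: "continuous_on UNIV \<psi>" "\<And>t. t \<in> {0..T} \<Longrightarrow> 0 \<le> \<psi> t"
  obtains W where "W \<in> borel_measurable M" "AE \<omega> in M. \<forall>t\<in>{0..T}. ennreal (f t \<omega> - f 0 \<omega>) \<le> W \<omega>"
    "(\<integral>\<^sup>+ \<omega>. W \<omega> \<partial>M) \<le> ennreal (\<Psi> T - \<Psi> 0)"
proof -
  interpret prob_space M by fact
  interpret P: pair_sigma_finite lborel M ..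
  define D where "D \<omega> \<longleftrightarrow> (\<forall>t\<in>{0..T}. ((\<lambda>s. f s \<omega>) has_real_derivative f' t \<omega>) (at t within {0..T}))" for \<omega>
  obtain N where N: "{\<omega>\<in>space M. \<not> D \<omega>} \<subseteq> N" "N \<in> null_sets M"
    using deriv unfolding D_def[symmetric] eventually_ae_filter by auto
  have DN: "D \<omega>" if "\<omega> \<in> space M" "\<omega> \<notin> N" for \<omega> using N that by auto
  \<comment> \<open>Clamping the time and setting the paths to zero on the null set \<open>N\<close>
    gives a process that is continuous on the whole line for every outcome.\<close>
  define c where "c t = max 0 (min T t)" for t
  have c: "c t \<in> {0..T}" for t using T by (auto simp: c_def)
  have c_id: "c t = t" if "t \<in> {0..T}" for t using that by (auto simp: c_def)
  define F where "F t \<omega> = (if \<omega> \<in> space M - N then f (c t) \<omega> else 0)" for t \<omega>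
  have F_meas: "F t \<in> borel_measurable M" for t
    unfolding F_def using meas[OF c] N(2) by (intro measurable_If_set) auto
  have F_cont: "continuous_on UNIV (\<lambda>t. F t \<omega>)" for \<omega>
  proof (cases "\<omega> \<in> space M - N")
    case True
    then have "continuous_on {0..T} (\<lambda>s. f s \<omega>)"
      using DN[of \<omega>] unfolding D_def
      by (meson DERIV_continuous_on Diff_iff)
    moreover have "continuous_on UNIV c" unfolding c_def by (intro continuous_intros)
    ultimately have "continuous_on UNIV (\<lambda>t. f (c t) \<omega>)"
      by (rule continuous_on_compose2) (use c in auto)
    then show ?thesis using True by (simp add: F_def)
  next
    case False
    then have "F t \<omega> = 0" for t by (auto simp: F_def)
    then show ?thesis by simp
  qed
  note Fm[measurable] = borel_measurable_Caratheodory[OF F_meas F_cont]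
  \<comment> \<open>\<open>f'\<close> is not assumed measurable. This limit of right difference
    quotients is jointly measurable, and it equals \<open>f'\<close> off \<open>N\<close> at all
    times before \<open>T\<close>.\<close>
  define v where "v = (\<lambda>(t, \<omega>). lim (\<lambda>n. real (Suc n) * (F (t + 1 / real (Suc n)) \<omega> - F t \<omega>)))"
  have v_meas: "v \<in> borel_measurable (borel \<Otimes>\<^sub>M M)"
  proof -
    have "(\<lambda>(t, \<omega>). F (t + a) \<omega>) \<in> borel_measurable (borel \<Otimes>\<^sub>M M)" for a
    proof -
      have "(\<lambda>p::real \<times> _. (fst p + a, snd p)) \<in> (borel \<Otimes>\<^sub>M M) \<rightarrow>\<^sub>M (borel \<Otimes>\<^sub>M M)" by measurable
      from measurable_compose[OF this Fm] show ?thesis by (simp add: case_prod_beta)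
    qed
    note [measurable] = this[unfolded case_prod_beta] Fm[unfolded case_prod_beta]
    show ?thesis unfolding v_def case_prod_beta by measurable
  qed
  have v_eq: "v (t, \<omega>) = f' t \<omega>" if \<omega>: "\<omega> \<in> space M" "\<omega> \<notin> N" and t: "0 \<le> t" "t < T" for t \<omega>
  proof -
    have "((\<lambda>s. f s \<omega>) has_real_derivative f' t \<omega>) (at t within {0..T})"
      using DN[OF \<omega>] t by (auto simp: D_def)
    then have lim: "((\<lambda>s. (f s \<omega> - f t \<omega>) / (s - t)) \<longlongrightarrow> f' t \<omega>) (at t within {0..T})"
      by (simp add: has_field_derivative_iff)
    have ev: "\<forall>\<^sub>F n in sequentially. t + 1 / real (Suc n) \<in> {0..T} \<and> t + 1 / real (Suc n) \<noteq> t"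
    proof -
      have "(\<lambda>n. 1 / real (Suc n)) \<longlonglongrightarrow> 0" by (rule LIMSEQ_Suc[OF lim_1_over_n])
      then have "\<forall>\<^sub>F n in sequentially. 1 / real (Suc n) < T - t"
        using t by (intro order_tendstoD(2)[where y = 0]) auto
      then show ?thesis by eventually_elim (use t in auto)
    qed
    have "(\<lambda>n. t + 1 / real (Suc n)) \<longlonglongrightarrow> t + 0"
      by (intro tendsto_add tendsto_const LIMSEQ_Suc[OF lim_1_over_n])
    then have "filterlim (\<lambda>n. t + 1 / real (Suc n)) (at t within {0..T}) sequentially"
      using ev by (auto simp: filterlim_at)
    from filterlim_compose[OF lim this]
    have "(\<lambda>n. (f (t + 1 / real (Suc n)) \<omega> - f t \<omega>) / (t + 1 / real (Suc n) - t)) \<longlonglongrightarrow> f' t \<omega>" .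
    moreover have "\<forall>\<^sub>F n in sequentially. (f (t + 1 / real (Suc n)) \<omega> - f t \<omega>) / (t + 1 / real (Suc n) - t)
        = real (Suc n) * (F (t + 1 / real (Suc n)) \<omega> - F t \<omega>)"
      using ev by eventually_elim (use \<omega> t in \<open>auto simp: F_def c_id\<close>)
    ultimately have "(\<lambda>n. real (Suc n) * (F (t + 1 / real (Suc n)) \<omega> - F t \<omega>)) \<longlonglongrightarrow> f' t \<omega>"
      by (rule Lim_transform_eventually)
    then show ?thesis by (simp add: v_def limI)
  qed
  \<comment> \<open>\<open>ennreal\<close> keeps only the positive part. Time \<open>T\<close> is
    left out because the clamped process has zero right quotients there, so that \<open>v\<close>
    may differ from \<open>f'\<close>.\<close>
  define g where "g p = ennreal (v p) * indicator {0..<T} (fst p)" for p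
  have g_meas[measurable]: "g \<in> borel_measurable (lborel \<Otimes>\<^sub>M M)"
  proof -
    have [measurable]: "v \<in> borel_measurable (lborel \<Otimes>\<^sub>M M)"
      using v_meas by (simp cong: measurable_cong_sets add: sets_pair_measure_cong[OF sets_lborel refl])
    show ?thesis unfolding g_def by measurable
  qed
  \<comment> \<open>Integrating the positive part over the whole interval dominates the increments
    up to all times simultaneously.\<close>
  define W where "W \<omega> = (\<integral>\<^sup>+t. g (t, \<omega>) \<partial>lborel)" for \<omega>
  have W_meas: "W \<in> borel_measurable M"
    unfolding W_def by measurable
  have "(\<integral>\<^sup>+\<omega>. W \<omega> \<partial>M) = (\<integral>\<^sup>+t. \<integral>\<^sup>+\<omega>. g (t, \<omega>) \<partial>M \<partial>lborel)"
    unfolding W_def by (rule P.Fubini) simp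
  also have "\<dots> \<le> (\<integral>\<^sup>+t. ennreal (\<psi> t) * indicator {0..T} t \<partial>lborel)"
  proof (rule nn_integral_mono)
    fix t :: real
    show "(\<integral>\<^sup>+\<omega>. g (t, \<omega>) \<partial>M) \<le> ennreal (\<psi> t) * indicator {0..T} t"
    proof (cases "t \<in> {0..<T}")
      case True
      have "(\<integral>\<^sup>+\<omega>. g (t, \<omega>) \<partial>M) = (\<integral>\<^sup>+\<omega>. ennreal (f' t \<omega>) \<partial>M)"
      proof (rule nn_integral_cong_AE)
        have "AE \<omega> in M. \<omega> \<notin> N" using N(2) by (rule AE_not_in)
        then show "AE \<omega> in M. g (t, \<omega>) = ennreal (f' t \<omega>)"
          using AE_space by eventually_elim (use True v_eq in \<open>auto simp: g_def\<close>)
      qed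
      then show ?thesis using bound[of t] True by auto
    qed (simp add: g_def)
  qed
  also have "\<dots> = ennreal (\<Psi> T - \<Psi> 0)"
    using T \<Psi> \<psi> by (intro nn_integral_FTC_Icc)
      (auto intro!: borel_measurable_continuous_onI simp: has_real_derivative_iff_has_vector_derivative)
  finally have W_int: "(\<integral>\<^sup>+\<omega>. W \<omega> \<partial>M) \<le> ennreal (\<Psi> T - \<Psi> 0)" .
  then have W_fin: "AE \<omega> in M. W \<omega> \<noteq> \<infinity>"
    using W_meas by (intro nn_integral_PInf_AE) (auto simp: top_unique)
  have "AE \<omega> in M. \<forall>t\<in>{0..T}. ennreal (f t \<omega> - f 0 \<omega>) \<le> W \<omega>"
    using W_fin AE_not_in[OF N(2)] AE_space
  proof eventually_elim
    case (elim \<omega>)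
    define h where "h s = max 0 (v (s, \<omega>)) * indicator {0..<T} s" for s
    have h_meas: "h \<in> borel_measurable lborel"
    proof -
      have "(\<lambda>s. v (s, \<omega>)) \<in> borel_measurable borel"
        using measurable_compose[OF measurable_Pair2'[OF elim(3)] v_meas] by simp
      then show ?thesis unfolding h_def by measurable
    qed
    have h0: "0 \<le> h s" for s by (simp add: h_def)
    have Wh: "W \<omega> = (\<integral>\<^sup>+s. ennreal (h s) \<partial>lborel)"
      unfolding W_def by (intro nn_integral_cong) (auto simp: g_def h_def max_def ennreal_neg split: split_indicator)
    have h_int: "integrable lborel h"
      using elim(1) h_meas h0 unfolding Wh by (intro integrableI_nonneg) (auto simp: less_top)
    have hI: "(h has_integral integral\<^sup>L lborel h) UNIV" by (rule has_integral_integral_lborel[OF h_int])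
    have hW: "ennreal (integral\<^sup>L lborel h) = W \<omega>"
      unfolding Wh by (rule nn_integral_eq_integral[symmetric]) (use h_int h0 in auto)
    show ?case
    proof
      fix t assume t: "t \<in> {0..T}"
      \<comment> \<open>The gauge integral of \<open>f'\<close> exists without any integrability
        assumption; only the dominating \<open>h\<close> is shown to be Lebesgue integrable.\<close>
      have ftc: "((\<lambda>s. f' s \<omega>) has_integral (f t \<omega> - f 0 \<omega>)) {0..t}"
      proof (rule fundamental_theorem_of_calculus)
        fix s assume s: "s \<in> {0..t}"
        have "((\<lambda>s. f s \<omega>) has_vector_derivative f' s \<omega>) (at s within {0..T})"
          using DN[OF elim(3,2)] t s by (auto simp: D_def has_real_derivative_iff_has_vector_derivative)
        then show "((\<lambda>s. f s \<omega>) has_vector_derivative f' s \<omega>) (at s within {0..t})"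
          by (rule has_vector_derivative_within_subset) (use t in auto)
      qed (use t in auto)
      have "((\<lambda>s. if s \<in> {0..t} then (if s = T then 0 else f' s \<omega>) else 0) has_integral (f t \<omega> - f 0 \<omega>)) UNIV"
        unfolding has_integral_restrict_UNIV
        by (rule has_integral_spike[OF negligible_sing[of T] _ ftc]) auto
      then have "f t \<omega> - f 0 \<omega> \<le> integral\<^sup>L lborel h"
      proof (rule has_integral_le[OF _ hI])
        fix s
        show "(if s \<in> {0..t} then if s = T then 0 else f' s \<omega> else 0) \<le> h s"
        proof (cases "0 \<le> s \<and> s < T")
          case True
          then show ?thesis using v_eq[OF elim(3,2), of s] h0[of s] by (auto simp: h_def)
        next
          case False
          then show ?thesis using t h0[of s] by auto
        qed
      qed
      then show "ennreal (f t \<omega> - f 0 \<omega>) \<le> W \<omega>" unfolding hW[symmetric] by (rule ennreal_leI)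
    qed
  qed
  from that[OF W_meas this W_int] show thesis .
qed

lemma inner_self_has_real_derivative:
  fixes x :: "real \<Rightarrow> 'b::real_inner"
  assumes "(x has_vector_derivative v) (at t within S)"
  shows "((\<lambda>s. (norm (x s))\<^sup>2) has_real_derivative 2 * (x t \<bullet> v)) (at t within S)"
proof -
  have "((\<lambda>s. x s \<bullet> x s) has_derivative (\<lambda>h. x t \<bullet> (h *\<^sub>R v) + (h *\<^sub>R v) \<bullet> x t)) (at t within S)"
    using assms unfolding has_vector_derivative_def by (intro has_derivative_inner)
  moreover have "(\<lambda>h. x t \<bullet> (h *\<^sub>R v) + (h *\<^sub>R v) \<bullet> x t) = (*) (2 * (x t \<bullet> v))"
    by (auto simp: inner_commute)
  ultimately show ?thesis
    by (simp add: has_field_derivative_def power2_norm_eq_inner)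
qed

section \<open>Confinement and stability by differential inequalities\<close>

lemma le_of_halving_steps:
  fixes y b e c :: real
  assumes "\<And>k :: nat. y \<le> (b + c / 2 ^ k) * e"
  shows "y \<le> b * e"
proof -
  have "(\<lambda>k. (b + c * (1 / 2) ^ k) * e) \<longlonglongrightarrow> (b + c * 0) * e"
    by (intro tendsto_intros LIMSEQ_realpow_zero) auto
  then show ?thesis
    using LIMSEQ_le_const[of _ "(b + c * 0) * e" y] assms by (auto simp: power_one_over)
qed

text \<open>The velocity at time \<open>t\<close> is controlled only through an almost sure bound on
  the norm over all of \<open>E\<close> at that time. A bound \<open>q * exp (4 * D * t)\<close> on
  the squared norm bounds its derivative by \<open>2 * D * q * exp (4 * D * t)\<close>, whose time
  integral is \<open>q / 2 * (exp (4 * D * t) - 1)\<close>. So \<open>q\<close> improves to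
  \<open>R0^2 + q / 2\<close>, and iterating leads to the fixed point \<open>2 * R0^2\<close>. The
  event \<open>E\<close> allows for an a priori radius \<open>n\<close> that is known only for part
  of the heads.\<close>

lemma (in prob_space) AE_norm_confined:
  fixes x v :: "real \<Rightarrow> 'a \<Rightarrow> 'b::euclidean_space" and T D R0 n :: real
  assumes T: "0 < T" and D: "0 \<le> D"
    and meas: "\<And>t. t \<in> {0..T} \<Longrightarrow> x t \<in> borel_measurable M"
    and deriv: "AE \<omega> in M. \<forall>t\<in>{0..T}. ((\<lambda>s. x s \<omega>) has_vector_derivative v t \<omega>) (at t within {0..T})"
    and init: "AE \<omega> in M. norm (x 0 \<omega>) \<le> R0"
    and E: "E \<in> events"
    and bounded: "\<And>t. t \<in> {0..T} \<Longrightarrow> AE \<omega> in M. \<omega> \<in> E \<longrightarrow> norm (x t \<omega>) \<le> n"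
    and velocity: "\<And>t c. t \<in> {0..T} \<Longrightarrow> 0 \<le> c \<Longrightarrow> AE \<omega> in M. \<omega> \<in> E \<longrightarrow> norm (x t \<omega>) \<le> c \<Longrightarrow>
      AE \<omega> in M. \<omega> \<in> E \<longrightarrow> norm (v t \<omega>) \<le> D * c"
  shows "AE \<omega> in M. \<omega> \<in> E \<longrightarrow> (\<forall>t\<in>{0..T}. (norm (x t \<omega>))\<^sup>2 \<le> 2 * R0\<^sup>2 * exp (4 * D * t))"
proof -
  have step: "AE \<omega> in M. \<omega> \<in> E \<longrightarrow> (\<forall>t\<in>{0..T}. (norm (x t \<omega>))\<^sup>2 \<le> (R0\<^sup>2 + q / 2) * exp (4 * D * t))"
    if q: "0 \<le> q" and le: "\<And>t. t \<in> {0..T} \<Longrightarrow> AE \<omega> in M. \<omega> \<in> E \<longrightarrow> (norm (x t \<omega>))\<^sup>2 \<le> q * exp (4 * D * t)" for q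
  proof -
    \<comment> \<open>With the integrated bound subtracted the derivative is nonpositive almost
      surely, so \<open>AE_increment_le\<close> applies with bound zero and excludes any increase,
      at all times outside one null set.\<close>
    define f where "f t \<omega> = indicator E \<omega> * ((norm (x t \<omega>))\<^sup>2 - q / 2 * exp (4 * D * t))" for t \<omega>
    define f' where "f' t \<omega> = indicator E \<omega> * (2 * (x t \<omega> \<bullet> v t \<omega>) - 2 * D * q * exp (4 * D * t))" for t \<omega>
    obtain W where W: "W \<in> borel_measurable M" "AE \<omega> in M. \<forall>t\<in>{0..T}. ennreal (f t \<omega> - f 0 \<omega>) \<le> W \<omega>"
      "(\<integral>\<^sup>+ \<omega>. W \<omega> \<partial>M) \<le> ennreal (0 - 0)"
    proof (rule AE_increment_le[OF prob_space_axioms T, where f = f and f' = f' and \<Psi> = "\<lambda>_. 0" and \<psi> = "\<lambda>_. 0"])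
      show "f t \<in> borel_measurable M" if "t \<in> {0..T}" for t
        unfolding f_def using meas[OF that] E by measurable
      show "AE \<omega> in M. \<forall>t\<in>{0..T}. ((\<lambda>s. f s \<omega>) has_real_derivative f' t \<omega>) (at t within {0..T})"
        using deriv
      proof eventually_elim
        case (elim \<omega>)
        show ?case
        proof
          fix t assume "t \<in> {0..T}"
          then have "((\<lambda>s. x s \<omega>) has_vector_derivative v t \<omega>) (at t within {0..T})" using elim by blast
          note [derivative_intros] = inner_self_has_real_derivative[OF this]
          show "((\<lambda>s. f s \<omega>) has_real_derivative f' t \<omega>) (at t within {0..T})"
            unfolding f_def f'_def by (rule derivative_eq_intros refl)+ simp
        qed
      qed
      show "(\<integral>\<^sup>+ \<omega>. ennreal (f' t \<omega>) \<partial>M) \<le> ennreal 0" if t: "t \<in> {0..T}" for t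
      proof -
        define c where "c = sqrt (q * exp (4 * D * t))"
        have c2: "c\<^sup>2 = q * exp (4 * D * t)" "0 \<le> c" using q by (auto simp: c_def)
        have xc: "AE \<omega> in M. \<omega> \<in> E \<longrightarrow> norm (x t \<omega>) \<le> c"
          using le[OF t] by eventually_elim (auto simp: c_def intro: real_le_rsqrt)
        have "AE \<omega> in M. ennreal (f' t \<omega>) = 0"
          using xc velocity[OF t c2(2) xc]
        proof eventually_elim
          case (elim \<omega>)
          have "x t \<omega> \<bullet> v t \<omega> \<le> D * (q * exp (4 * D * t))" if "\<omega> \<in> E"
          proof -
            have "x t \<omega> \<bullet> v t \<omega> \<le> norm (x t \<omega>) * norm (v t \<omega>)" by (rule norm_cauchy_schwarz)
            also have "\<dots> \<le> c * (D * c)" using elim that c2(2) by (intro mult_mono) auto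
            also have "\<dots> = D * c\<^sup>2" by (simp add: power2_eq_square)
            finally show ?thesis unfolding c2(1) .
          qed
          then have "f' t \<omega> \<le> 0" by (auto simp: f'_def split: split_indicator)
          then show ?case by (simp add: ennreal_neg)
        qed
        then have "(\<integral>\<^sup>+ \<omega>. ennreal (f' t \<omega>) \<partial>M) = (\<integral>\<^sup>+ \<omega>. 0 \<partial>M)" by (rule nn_integral_cong_AE)
        then show ?thesis by simp
      qed
    qed auto
    have "AE \<omega> in M. W \<omega> = 0" using W(3) nn_integral_0_iff_AE[OF W(1)] by simp
    with W(2) init show ?thesis
    proof eventually_elim
      case (elim \<omega>)
      show ?case
      proof (intro impI ballI)
        fix t assume \<omega>: "\<omega> \<in> E" and t: "t \<in> {0..T}"
        have "ennreal (f t \<omega> - f 0 \<omega>) \<le> 0" using elim(1,3) t by auto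
        then have "f t \<omega> \<le> f 0 \<omega>" by (auto simp: ennreal_eq_0_iff)
        then have "(norm (x t \<omega>))\<^sup>2 \<le> (norm (x 0 \<omega>))\<^sup>2 + q / 2 * exp (4 * D * t) - q / 2" using \<omega> by (simp add: f_def)
        moreover have "(norm (x 0 \<omega>))\<^sup>2 \<le> R0\<^sup>2" using elim(2) by (intro power_mono) auto
        moreover have "R0\<^sup>2 * 1 \<le> R0\<^sup>2 * exp (4 * D * t)" using t D by (intro mult_left_mono) auto
        moreover have "(R0\<^sup>2 + q / 2) * exp (4 * D * t) = R0\<^sup>2 * exp (4 * D * t) + q / 2 * exp (4 * D * t)"
          by (rule distrib_right)
        ultimately show "(norm (x t \<omega>))\<^sup>2 \<le> (R0\<^sup>2 + q / 2) * exp (4 * D * t)" using q by linarith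
      qed
    qed
  qed
  \<comment> \<open>Solution of the recursion \<open>q (k + 1) = R0^2 + q k / 2\<close>, started
    above \<open>n^2\<close>: the excess over the fixed point is halved each time.\<close>
  define q where "q k = 2 * R0\<^sup>2 + n\<^sup>2 / 2 ^ k" for k :: nat
  have q0: "0 \<le> q k" for k by (simp add: q_def)
  have weak: "AE \<omega> in M. \<omega> \<in> E \<longrightarrow> (norm (x t \<omega>))\<^sup>2 \<le> q k * exp (4 * D * t)" if "t \<in> {0..T}" for t k
    using that
  proof (induction k arbitrary: t)
    case 0
    have "n\<^sup>2 * 1 \<le> q 0 * exp (4 * D * t)"
      using 0 D by (intro mult_mono) (auto simp: q_def)
    then show ?case using bounded[OF 0]
      by (auto elim!: eventually_mono intro: order.trans[OF power_mono[of _ n 2]])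
  next
    case (Suc k)
    have "R0\<^sup>2 + q k / 2 = q (Suc k)" by (simp add: q_def add_divide_distrib)
    with step[OF q0[of k] Suc.IH] Suc.prems show ?case by (auto elim!: eventually_mono)
  qed
  \<comment> \<open>One more step turns bounds at each fixed time into a bound at all times off a
    single null set.\<close>
  have "AE \<omega> in M. \<omega> \<in> E \<longrightarrow> (\<forall>t\<in>{0..T}. (norm (x t \<omega>))\<^sup>2 \<le> q (Suc k) * exp (4 * D * t))" for k
  proof -
    have "R0\<^sup>2 + q k / 2 = q (Suc k)" by (simp add: q_def add_divide_distrib)
    with step[OF q0[of k] weak] show ?thesis by simp
  qed
  then have "AE \<omega> in M. \<forall>k. \<omega> \<in> E \<longrightarrow> (\<forall>t\<in>{0..T}. (norm (x t \<omega>))\<^sup>2 \<le> q (Suc k) * exp (4 * D * t))"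
    unfolding AE_all_countable by (rule allI)
  then show ?thesis
  proof eventually_elim
    case (elim \<omega>)
    show ?case
    proof (intro impI ballI)
      fix t assume *: "\<omega> \<in> E" "t \<in> {0..T}"
      show "(norm (x t \<omega>))\<^sup>2 \<le> 2 * R0\<^sup>2 * exp (4 * D * t)"
      proof (rule le_of_halving_steps)
        fix k
        show "(norm (x t \<omega>))\<^sup>2 \<le> (2 * R0\<^sup>2 + n\<^sup>2 / 2 / 2 ^ k) * exp (4 * D * t)"
          using elim * by (auto simp: q_def)
      qed
    qed
  qed
qed

text \<open>Its case of equal initial values is uniqueness, which makes the flow map of
  \<open>AE_flow_map\<close> well defined. The weighted square \<open>g\<close> is
  nonincreasing.\<close>

lemma flow_stability:
  fixes x y :: "real \<Rightarrow> 'b::real_inner" and F :: "real \<Rightarrow> 'b \<Rightarrow> 'b"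
  assumes x: "\<And>s. s \<in> {0..t} \<Longrightarrow> (x has_vector_derivative F s (x s)) (at s within {0..t})"
    and y: "\<And>s. s \<in> {0..t} \<Longrightarrow> (y has_vector_derivative F s (y s)) (at s within {0..t})"
    and lip: "\<And>s. s \<in> {0..t} \<Longrightarrow> norm (F s (x s) - F s (y s)) \<le> L * norm (x s - y s)"
    and t: "0 \<le> t"
  shows "norm (x t - y t) \<le> exp (L * t) * norm (x 0 - y 0)"
proof -
  define g where "g s = exp (- 2 * L * s) * (norm (x s - y s))\<^sup>2" for s
  define g' where "g' s = exp (- 2 * L * s) * (2 * ((x s - y s) \<bullet> (F s (x s) - F s (y s))) - 2 * L * (norm (x s - y s))\<^sup>2)" for s
  have deriv: "(g has_real_derivative g' s) (at s within {0..t})" if "s \<in> {0..t}" for s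
  proof -
    have "((\<lambda>s. x s - y s) has_vector_derivative F s (x s) - F s (y s)) (at s within {0..t})"
      using x y that by (intro has_vector_derivative_diff)
    note [derivative_intros] = inner_self_has_real_derivative[OF this]
    show ?thesis unfolding g_def g'_def
      by (rule derivative_eq_intros refl)+ (simp add: algebra_simps)
  qed
  have "g t \<le> g 0"
  proof (rule DERIV_nonpos_imp_decreasing_open[OF t])
    show "continuous_on {0..t} g" using deriv by (rule DERIV_continuous_on)
    fix s assume s: "0 < s" "s < t"
    have "(g has_real_derivative g' s) (at s)" using deriv[of s] s at_within_Icc_at[of 0 s t] by simp
    moreover have "g' s \<le> 0"
    proof -
      have "(x s - y s) \<bullet> (F s (x s) - F s (y s)) \<le> norm (x s - y s) * (L * norm (x s - y s))"
        using lip[of s] s by (intro order.trans[OF norm_cauchy_schwarz] mult_left_mono) auto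
      then show ?thesis unfolding g'_def by (simp add: mult_le_0_iff power2_eq_square mult.left_commute)
    qed
    ultimately show "\<exists>y. DERIV g s :> y \<and> y \<le> 0" by blast
  qed
  then have "exp (- 2 * L * t) * (norm (x t - y t))\<^sup>2 \<le> (norm (x 0 - y 0))\<^sup>2" by (simp add: g_def)
  then have "exp (2 * L * t) * (exp (- 2 * L * t) * (norm (x t - y t))\<^sup>2) \<le> exp (2 * L * t) * (norm (x 0 - y 0))\<^sup>2"
    by (intro mult_left_mono) auto
  moreover have "exp (2 * L * t) * (exp (- 2 * L * t) * (norm (x t - y t))\<^sup>2) = (norm (x t - y t))\<^sup>2"
    by (simp add: mult.assoc[symmetric] exp_add[symmetric])
  moreover have "exp (2 * L * t) = (exp (L * t))\<^sup>2"
    by (simp add: power2_eq_square exp_add[symmetric])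
  ultimately have "(norm (x t - y t))\<^sup>2 \<le> (exp (L * t) * norm (x 0 - y 0))\<^sup>2"
    unfolding power_mult_distrib by metis
  then show ?thesis by (rule power2_le_imp_le) simp
qed

text \<open>
  By stability, the position at time \<open>t\<close> is a Lipschitz function of the initial position on a set
  of full measure; the extension theorems make it a continuous function on the whole space.
\<close>

lemma AE_flow_map:
  fixes x :: "real \<Rightarrow> 'w \<Rightarrow> 'b::euclidean_space" and F :: "real \<Rightarrow> 'b \<Rightarrow> 'b"
  assumes deriv: "AE \<omega> in M. \<forall>s\<in>{0..T}. ((\<lambda>s. x s \<omega>) has_vector_derivative F s (x s \<omega>)) (at s within {0..T})"
    and bounded: "AE \<omega> in M. \<forall>s\<in>{0..T}. norm (x s \<omega>) \<le> R"
    and lip: "\<And>s y z. s \<in> {0..T} \<Longrightarrow> norm y \<le> R \<Longrightarrow> norm z \<le> R \<Longrightarrow> norm (F s y - F s z) \<le> L * norm (y - z)"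
    and t: "t \<in> {0..T}"
  obtains \<Phi> where "continuous_on UNIV \<Phi>" "AE \<omega> in M. x t \<omega> = \<Phi> (x 0 \<omega>)"
proof -
  define G where "G = {\<omega> \<in> space M. (\<forall>s\<in>{0..T}. ((\<lambda>s. x s \<omega>) has_vector_derivative F s (x s \<omega>)) (at s within {0..T}))
      \<and> (\<forall>s\<in>{0..T}. norm (x s \<omega>) \<le> R)}"
  have stab: "norm (x t \<omega> - x t \<omega>') \<le> exp (L * t) * norm (x 0 \<omega> - x 0 \<omega>')" if "\<omega> \<in> G" "\<omega>' \<in> G" for \<omega> \<omega>'
  proof (rule flow_stability[where F = F])
    fix s assume s: "s \<in> {0..t}"
    then have sT: "s \<in> {0..T}" using t by auto
    show "((\<lambda>s. x s \<omega>) has_vector_derivative F s (x s \<omega>)) (at s within {0..t})"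
      "((\<lambda>s. x s \<omega>') has_vector_derivative F s (x s \<omega>')) (at s within {0..t})"
      using that sT t by (auto simp: G_def intro: has_vector_derivative_within_subset[where S = "{0..T}"])
    show "norm (F s (x s \<omega>) - F s (x s \<omega>')) \<le> L * norm (x s \<omega> - x s \<omega>')"
      using that sT by (intro lip) (auto simp: G_def)
  qed (use t in auto)
  define S where "S = x 0 ` G"
  \<comment> \<open>Any path starting at \<open>y\<close> may be chosen: by \<open>stab\<close> all
    of them are at the same point at time \<open>t\<close>.\<close>
  define h where "h y = x t (SOME \<omega>. \<omega> \<in> G \<and> x 0 \<omega> = y)" for y
  have h: "h (x 0 \<omega>) = x t \<omega>" if "\<omega> \<in> G" for \<omega>
  proof -
    have "\<exists>\<omega>'. \<omega>' \<in> G \<and> x 0 \<omega>' = x 0 \<omega>" using that by blast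
    then have "(SOME \<omega>'. \<omega>' \<in> G \<and> x 0 \<omega>' = x 0 \<omega>) \<in> G \<and> x 0 (SOME \<omega>'. \<omega>' \<in> G \<and> x 0 \<omega>' = x 0 \<omega>) = x 0 \<omega>"
      by (rule someI_ex)
    then show ?thesis using stab[of "SOME \<omega>'. \<omega>' \<in> G \<and> x 0 \<omega>' = x 0 \<omega>" \<omega>] that by (simp add: h_def)
  qed
  have "(exp (L * t))-lipschitz_on S h"
  proof (rule lipschitz_onI)
    fix y z assume "y \<in> S" "z \<in> S"
    then show "dist (h y) (h z) \<le> exp (L * t) * dist y z"
      using stab h by (auto simp: S_def dist_norm)
  qed simp
  then obtain g where g: "uniformly_continuous_on (closure S) g" "\<And>y. y \<in> S \<Longrightarrow> h y = g y"
    using uniformly_continuous_on_extension_on_closure[OF lipschitz_on_uniformly_continuous] by metis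
  from uniformly_continuous_imp_continuous[OF g(1)]
  obtain \<Phi> where \<Phi>: "continuous_on UNIV \<Phi>" "\<And>y. y \<in> closure S \<Longrightarrow> \<Phi> y = g y"
    using Tietze_unbounded[of "closure S" g UNIV] by (metis closed_closure closed_closedin subtopology_UNIV)
  have "AE \<omega> in M. x t \<omega> = \<Phi> (x 0 \<omega>)"
    using deriv bounded AE_space
  proof eventually_elim
    case (elim \<omega>)
    then have "\<omega> \<in> G" by (simp add: G_def)
    moreover from this have "x 0 \<omega> \<in> S" by (simp add: S_def)
    ultimately show ?case using h[of \<omega>] g(2)[of "x 0 \<omega>"] \<Phi>(2)[of "x 0 \<omega>"] closure_subset[of S] by auto
  qed
  with \<Phi>(1) show thesis by (rule that)
qed

section \<open>Conditional laws\<close>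

text \<open>The mass of \<open>B\<close> under \<open>\<kappa>\<close> and the indicator of
  \<open>X \<in> B\<close> have the same integral over \<open>E\<close>, by the definition of
  conditional expectation. A function that is at most 1 equals 1 almost everywhere on
  \<open>E\<close> exactly if its integral over \<open>E\<close> is \<open>prob E\<close>. In this
  way bounds pass between a token and its conditional law on events determined by the heads.\<close>

lemma cond_law_AE_iff:
  assumes M: "prob_space M" and sub: "subalgebra M F" and \<kappa>: "cond_law M F X \<kappa>"
    and X: "X \<in> borel_measurable M" and B: "B \<in> sets borel" and E: "E \<in> sets F"
  shows "(AE \<omega> in M. \<omega> \<in> E \<longrightarrow> measure (\<kappa> \<omega>) B = 1) \<longleftrightarrow> (AE \<omega> in M. \<omega> \<in> E \<longrightarrow> X \<omega> \<in> B)"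
proof -
  interpret prob_space M by fact
  interpret finite_measure_subalgebra M F using sub by unfold_locales
  have EM: "E \<in> events" using E sub by (auto simp: subalgebra_def)
  have XB[measurable]: "X -` B \<inter> space M \<in> events" using X B by (rule measurable_sets)
  define I where "I = (indicator (X -` B \<inter> space M) :: _ \<Rightarrow> real)"
  define m where "m \<omega> = measure (\<kappa> \<omega>) B" for \<omega>
  have \<kappa>F: "\<kappa> \<in> F \<rightarrow>\<^sub>M prob_algebra borel" using \<kappa> by (simp add: cond_law_def)
  have mF: "m \<in> borel_measurable F"
    unfolding m_def by (rule measurable_compose[OF \<kappa>F measurable_measure_prob_algebra[OF B]])
  have m_meas[measurable]: "m \<in> borel_measurable M" using mF by (rule measurable_from_subalg[OF sub])
  have m01: "0 \<le> m \<omega>" "m \<omega> \<le> 1" if "\<omega> \<in> space M" for \<omega>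
  proof -
    have "\<omega> \<in> space F" using that sub by (simp add: subalgebra_def)
    then have "prob_space (\<kappa> \<omega>)" using measurable_space[OF \<kappa>F] by (auto simp: space_prob_algebra)
    then show "0 \<le> m \<omega>" "m \<omega> \<le> 1" unfolding m_def by (auto intro: prob_space.prob_le_1)
  qed
  have I_int: "integrable M I" unfolding I_def by (rule integrable_real_indicator) (auto simp: emeasure_eq_measure)
  have EI_int: "integrable M (\<lambda>\<omega>. indicator E \<omega> * I \<omega>)"
    using integrable_mult_indicator[OF EM I_int] by simp
  have Em_int: "integrable M (\<lambda>\<omega>. indicator E \<omega> * m \<omega>)"
    by (rule integrable_const_bound[of _ 1]) (use m01 EM in \<open>auto split: split_indicator\<close>)
  have E_int: "integrable M (indicator E :: _ \<Rightarrow> real)" using EM by (intro integrable_real_indicator) (auto simp: emeasure_eq_measure)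
  have eq: "(\<integral>\<omega>. indicator E \<omega> * I \<omega> \<partial>M) = (\<integral>\<omega>. indicator E \<omega> * m \<omega> \<partial>M)"
  proof -
    have "(\<integral>\<omega>. indicator E \<omega> * I \<omega> \<partial>M) = (\<integral>\<omega>. indicator E \<omega> * real_cond_exp M F I \<omega> \<partial>M)"
      using real_cond_exp_intA[OF I_int E] by (simp add: set_lebesgue_integral_def)
    also have "\<dots> = (\<integral>\<omega>. indicator E \<omega> * m \<omega> \<partial>M)"
    proof (rule integral_cong_AE)
      have "AE \<omega> in M. m \<omega> = real_cond_exp M F I \<omega>"
        using \<kappa> B by (simp add: cond_law_def m_def I_def)
      then show "AE \<omega> in M. indicator E \<omega> * real_cond_exp M F I \<omega> = indicator E \<omega> * m \<omega>"
        by eventually_elim simp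
    qed (use EM in measurable)
    finally show ?thesis .
  qed
  have *: "(AE \<omega> in M. \<omega> \<in> E \<longrightarrow> u \<omega> = 1) \<longleftrightarrow> (\<integral>\<omega>. indicator E \<omega> * u \<omega> \<partial>M) = prob E"
    if u: "integrable M (\<lambda>\<omega>. indicator E \<omega> * u \<omega>)" "\<And>\<omega>. \<omega> \<in> space M \<Longrightarrow> u \<omega> \<le> 1" for u :: "'a \<Rightarrow> real"
  proof -
    have "(\<integral>\<omega>. indicator E \<omega> * u \<omega> \<partial>M) = prob E \<longleftrightarrow> (\<integral>\<omega>. indicator E \<omega> - indicator E \<omega> * u \<omega> \<partial>M) = 0"
      using u(1) E_int EM by (auto simp: Int_absorb2 sets.sets_into_space)
    also have "\<dots> \<longleftrightarrow> (AE \<omega> in M. indicator E \<omega> - indicator E \<omega> * u \<omega> = 0)"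
      using u E_int by (intro integral_nonneg_eq_0_iff_AE) (auto split: split_indicator)
    also have "\<dots> \<longleftrightarrow> (AE \<omega> in M. \<omega> \<in> E \<longrightarrow> u \<omega> = 1)"
      by (intro AE_cong) (auto split: split_indicator)
    finally show ?thesis ..
  qed
  have "(AE \<omega> in M. \<omega> \<in> E \<longrightarrow> m \<omega> = 1) \<longleftrightarrow> (AE \<omega> in M. \<omega> \<in> E \<longrightarrow> I \<omega> = 1)"
    using *[OF Em_int m01(2)] *[OF EI_int] eq by (simp add: I_def)
  also have "\<dots> \<longleftrightarrow> (AE \<omega> in M. \<omega> \<in> E \<longrightarrow> X \<omega> \<in> B)"
    by (intro AE_cong) (auto simp: I_def split: split_indicator)
  finally show ?thesis unfolding m_def .
qed

text \<open>For \<open>N\<close> the restriction of \<open>M\<close> to \<open>A\<close>, mixing the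
  kernel over \<open>N\<close> gives the law of \<open>X\<close> under \<open>N\<close>: on Borel
  sets this is the definition of a conditional law. Equal measures have equal integrals.\<close>

lemma cond_law_nn_integral:
  assumes M: "prob_space M" and sub: "subalgebra M F" and \<kappa>: "cond_law M F X \<kappa>"
    and X[measurable]: "X \<in> borel_measurable M" and A: "A \<in> sets F" and f: "f \<in> borel_measurable borel"
  shows "(\<integral>\<^sup>+ \<omega>. indicator A \<omega> * (\<integral>\<^sup>+ y. f y \<partial>\<kappa> \<omega>) \<partial>M) = (\<integral>\<^sup>+ \<omega>. indicator A \<omega> * f (X \<omega>) \<partial>M)"
proof -
  interpret prob_space M by fact
  interpret finite_measure_subalgebra M F using sub by unfold_locales
  have AM[measurable]: "A \<in> events" using A sub by (auto simp: subalgebra_def)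
  have \<kappa>F: "\<kappa> \<in> F \<rightarrow>\<^sub>M prob_algebra borel" using \<kappa> by (simp add: cond_law_def)
  then have \<kappa>M: "\<kappa> \<in> M \<rightarrow>\<^sub>M subprob_algebra borel"
    by (intro measurable_prob_algebraD measurable_from_subalg[OF sub])
  define N where "N = density M (indicator A)"
  have \<kappa>N: "\<kappa> \<in> N \<rightarrow>\<^sub>M subprob_algebra borel" using \<kappa>M by (simp add: N_def)
  have spN: "space N \<noteq> {}" using not_empty by (simp add: N_def)
  have XN: "X \<in> borel_measurable N" by (simp add: N_def)
  have ps: "prob_space (\<kappa> \<omega>)" if "\<omega> \<in> space M" for \<omega>
  proof -
    have "\<omega> \<in> space F" using that sub by (simp add: subalgebra_def)
    then show ?thesis using measurable_space[OF \<kappa>F] by (auto simp: space_prob_algebra)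
  qed
  have "N \<bind> \<kappa> = distr N borel X"
  proof (rule measure_eqI)
    show "sets (N \<bind> \<kappa>) = sets (distr N borel X)"
      using sets_bind[OF sets_kernel[OF \<kappa>N] spN] by simp
    fix B assume "B \<in> sets (N \<bind> \<kappa>)"
    then have B: "B \<in> sets borel" using sets_bind[OF sets_kernel[OF \<kappa>N] spN] by simp
    have XB[measurable]: "X -` B \<inter> space M \<in> events" using X B by (rule measurable_sets)
    have I_int: "integrable M (indicator (X -` B \<inter> space M) :: _ \<Rightarrow> real)" by (rule integrable_real_indicator) (auto simp: emeasure_eq_measure)
    have [measurable]: "(\<lambda>\<omega>. measure (\<kappa> \<omega>) B) \<in> borel_measurable M"
      by (rule measurable_from_subalg[OF sub measurable_compose[OF \<kappa>F measurable_measure_prob_algebra[OF B]]])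
    have "emeasure (N \<bind> \<kappa>) B = (\<integral>\<^sup>+ \<omega>. emeasure (\<kappa> \<omega>) B \<partial>N)" by (rule emeasure_bind[OF spN \<kappa>N B])
    also have "\<dots> = (\<integral>\<^sup>+ \<omega>. indicator A \<omega> * emeasure (\<kappa> \<omega>) B \<partial>M)"
      unfolding N_def using measurable_emeasure_kernel[OF \<kappa>M B] by (subst nn_integral_density) auto
    also have "\<dots> = (\<integral>\<^sup>+ \<omega>. ennreal (indicator A \<omega> * measure (\<kappa> \<omega>) B) \<partial>M)"
      by (intro nn_integral_cong) (auto simp: ennreal_mult' finite_measure.emeasure_eq_measure[OF prob_space.finite_measure[OF ps]] split: split_indicator)
    also have "\<dots> = ennreal (\<integral>\<omega>. indicator A \<omega> * measure (\<kappa> \<omega>) B \<partial>M)"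
    proof (rule nn_integral_eq_integral)
      show "integrable M (\<lambda>\<omega>. indicator A \<omega> * measure (\<kappa> \<omega>) B)"
        by (rule integrable_const_bound[of _ 1])
           (use prob_space.prob_le_1[OF ps] in \<open>auto split: split_indicator\<close>)
    qed auto
    also have "(\<integral>\<omega>. indicator A \<omega> * measure (\<kappa> \<omega>) B \<partial>M)
        = (\<integral>\<omega>. indicator A \<omega> * real_cond_exp M F (indicator (X -` B \<inter> space M)) \<omega> \<partial>M)"
    proof (rule integral_cong_AE)
      have "AE \<omega> in M. measure (\<kappa> \<omega>) B = real_cond_exp M F (indicator (X -` B \<inter> space M)) \<omega>"
        using \<kappa> B by (simp add: cond_law_def)
      then show "AE \<omega> in M. indicator A \<omega> * measure (\<kappa> \<omega>) B
          = indicator A \<omega> * real_cond_exp M F (indicator (X -` B \<inter> space M)) \<omega>"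
        by eventually_elim simp
    qed measurable
    also have "\<dots> = (\<integral>\<omega>. indicator A \<omega> * indicator (X -` B \<inter> space M) \<omega> \<partial>M)"
      using real_cond_exp_intA[OF I_int A] by (simp add: set_lebesgue_integral_def)
    also have "\<dots> = prob (A \<inter> (X -` B \<inter> space M))"
      by (subst indicator_inter_arith[symmetric]) (simp add: sets.sets_into_space Int_absorb2)
    also have "ennreal \<dots> = emeasure N (X -` B \<inter> space M)"
      unfolding N_def by (subst emeasure_density) (auto simp: emeasure_eq_measure[symmetric] indicator_inter_arith[symmetric])
    also have "\<dots> = emeasure (distr N borel X) B"
      using B XN by (subst emeasure_distr) (auto simp: N_def)
    finally show "emeasure (N \<bind> \<kappa>) B = emeasure (distr N borel X) B" .
  qed
  then have "(\<integral>\<^sup>+ y. f y \<partial>(N \<bind> \<kappa>)) = (\<integral>\<^sup>+ y. f y \<partial>distr N borel X)" by simp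
  then have "(\<integral>\<^sup>+ \<omega>. \<integral>\<^sup>+ y. f y \<partial>\<kappa> \<omega> \<partial>N) = (\<integral>\<^sup>+ \<omega>. f (X \<omega>) \<partial>N)"
    using nn_integral_bind[OF f \<kappa>N] nn_integral_distr[OF XN, of f] f by simp
  moreover have "(\<integral>\<^sup>+ \<omega>. \<integral>\<^sup>+ y. f y \<partial>\<kappa> \<omega> \<partial>N) = (\<integral>\<^sup>+ \<omega>. indicator A \<omega> * (\<integral>\<^sup>+ y. f y \<partial>\<kappa> \<omega>) \<partial>M)"
    unfolding N_def using measurable_compose[OF \<kappa>M nn_integral_measurable_subprob_algebra[OF f]]
    by (subst nn_integral_density) auto
  moreover have "(\<integral>\<^sup>+ \<omega>. f (X \<omega>) \<partial>N) = (\<integral>\<^sup>+ \<omega>. indicator A \<omega> * f (X \<omega>) \<partial>M)"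
    unfolding N_def using measurable_compose[OF X f] by (subst nn_integral_density) auto
  ultimately show ?thesis by simp
qed

text \<open>Adding \<open>c\<close> makes the function nonnegative, so that
  \<open>cond_law_nn_integral\<close> verifies the characterisation of conditional expectation; the
  constant is then removed by linearity.\<close>

lemma cond_law_integral:
  fixes f :: "'a::topological_space \<Rightarrow> real"
  assumes M: "prob_space M" and sub: "subalgebra M F" and \<kappa>: "cond_law M F X \<kappa>"
    and X[measurable]: "X \<in> borel_measurable M" and f[measurable]: "f \<in> borel_measurable borel" and bound: "\<And>y. \<bar>f y\<bar> \<le> c"
  shows "AE \<omega> in M. real_cond_exp M F (\<lambda>\<omega>. f (X \<omega>)) \<omega> = (\<integral>y. f y \<partial>\<kappa> \<omega>)"
proof -
  interpret prob_space M by fact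
  interpret finite_measure_subalgebra M F using sub by unfold_locales
  have \<kappa>F: "\<kappa> \<in> F \<rightarrow>\<^sub>M prob_algebra borel" using \<kappa> by (simp add: cond_law_def)
  have ps: "prob_space (\<kappa> \<omega>)" "sets (\<kappa> \<omega>) = sets borel" if "\<omega> \<in> space M" for \<omega>
  proof -
    have "\<omega> \<in> space F" using that sub by (simp add: subalgebra_def)
    then show "prob_space (\<kappa> \<omega>)" "sets (\<kappa> \<omega>) = sets borel"
      using measurable_space[OF \<kappa>F] by (auto simp: space_prob_algebra)
  qed
  define g where "g y = f y + c" for y
  have g0: "0 \<le> g y" "g y \<le> 2 * c" for y using bound[of y] by (auto simp: g_def abs_le_iff)
  have gm[measurable]: "g \<in> borel_measurable borel" unfolding g_def by measurable
  have f_int: "integrable (\<kappa> \<omega>) f" if "\<omega> \<in> space M" for \<omega>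
    using ps[OF that] bound by (intro finite_measure.integrable_const_bound[OF prob_space.finite_measure]) (auto cong: measurable_cong_sets)
  have g_int: "integrable (\<kappa> \<omega>) g" if "\<omega> \<in> space M" for \<omega>
    using ps[OF that] g0 by (intro finite_measure.integrable_const_bound[OF prob_space.finite_measure, of _ _ "2 * c"]) (auto cong: measurable_cong_sets)
  have gI: "(\<integral>y. g y \<partial>\<kappa> \<omega>) = (\<integral>y. f y \<partial>\<kappa> \<omega>) + c" if "\<omega> \<in> space M" for \<omega>
  proof -
    interpret K: prob_space "\<kappa> \<omega>" by (rule ps(1)[OF that])
    show ?thesis unfolding g_def using f_int[OF that] by (simp add: K.prob_space)
  qed
  have kg: "0 \<le> (\<integral>y. g y \<partial>\<kappa> \<omega>)" "(\<integral>y. g y \<partial>\<kappa> \<omega>) \<le> 2 * c" if "\<omega> \<in> space M" for \<omega>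
  proof -
    interpret K: prob_space "\<kappa> \<omega>" by (rule ps(1)[OF that])
    show "0 \<le> (\<integral>y. g y \<partial>\<kappa> \<omega>)" using g0 by simp
    have "(\<integral>y. g y \<partial>\<kappa> \<omega>) \<le> (\<integral>y. 2 * c \<partial>\<kappa> \<omega>)" using g_int[OF that] g0 by (intro integral_mono) auto
    then show "(\<integral>y. g y \<partial>\<kappa> \<omega>) \<le> 2 * c" by (simp add: K.prob_space)
  qed
  have kgF: "(\<lambda>\<omega>. \<integral>y. g y \<partial>\<kappa> \<omega>) \<in> borel_measurable F"
    by (rule measurable_compose[OF measurable_prob_algebraD[OF \<kappa>F] integral_measurable_subprob_algebra[OF gm]])
  then have kgM[measurable]: "(\<lambda>\<omega>. \<integral>y. g y \<partial>\<kappa> \<omega>) \<in> borel_measurable M" by (rule measurable_from_subalg[OF sub])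
  have gX_int: "integrable M (\<lambda>\<omega>. g (X \<omega>))"
    using g0 by (intro integrable_const_bound[of _ "2 * c"]) auto
  have kg_int: "integrable M (\<lambda>\<omega>. \<integral>y. g y \<partial>\<kappa> \<omega>)"
    using kg by (intro integrable_const_bound[of _ "2 * c"]) auto
  have rg: "AE \<omega> in M. real_cond_exp M F (\<lambda>\<omega>. g (X \<omega>)) \<omega> = (\<integral>y. g y \<partial>\<kappa> \<omega>)"
  proof (rule real_cond_exp_charact[OF _ gX_int kg_int kgF])
    fix A assume A: "A \<in> sets F"
    have AM[measurable]: "A \<in> events" using A sub by (auto simp: subalgebra_def)
    have "ennreal (\<integral>\<omega>\<in>A. g (X \<omega>) \<partial>M) = (\<integral>\<^sup>+ \<omega>. ennreal (indicator A \<omega> * g (X \<omega>)) \<partial>M)"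
      unfolding set_lebesgue_integral_def real_scaleR_def
      using integrable_mult_indicator[OF AM gX_int] g0 by (intro nn_integral_eq_integral[symmetric]) auto
    also have "\<dots> = (\<integral>\<^sup>+ \<omega>. indicator A \<omega> * ennreal (g (X \<omega>)) \<partial>M)"
      by (intro nn_integral_cong) (auto split: split_indicator)
    also have "\<dots> = (\<integral>\<^sup>+ \<omega>. indicator A \<omega> * (\<integral>\<^sup>+ y. ennreal (g y) \<partial>\<kappa> \<omega>) \<partial>M)"
      by (rule cond_law_nn_integral[OF M sub \<kappa> X A, symmetric]) measurable
    also have "\<dots> = (\<integral>\<^sup>+ \<omega>. ennreal (indicator A \<omega> * (\<integral>y. g y \<partial>\<kappa> \<omega>)) \<partial>M)"
      using g_int g0 by (intro nn_integral_cong) (auto simp: nn_integral_eq_integral split: split_indicator)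
    also have "\<dots> = ennreal (\<integral>\<omega>\<in>A. (\<integral>y. g y \<partial>\<kappa> \<omega>) \<partial>M)"
      unfolding set_lebesgue_integral_def real_scaleR_def
      using integrable_mult_indicator[OF AM kg_int] kg by (intro nn_integral_eq_integral) auto
    finally show "(\<integral>\<omega>\<in>A. g (X \<omega>) \<partial>M) = (\<integral>\<omega>\<in>A. (\<integral>y. g y \<partial>\<kappa> \<omega>) \<partial>M)"
      using g0 kg unfolding set_lebesgue_integral_def by (subst (asm) ennreal_inj) (auto intro!: integral_nonneg_AE)
  qed
  have c_int: "integrable M (\<lambda>\<omega>. - c)" by simp
  have "AE \<omega> in M. real_cond_exp M F (\<lambda>\<omega>. g (X \<omega>) + - c) \<omega> = real_cond_exp M F (\<lambda>\<omega>. g (X \<omega>)) \<omega> + real_cond_exp M F (\<lambda>\<omega>. - c) \<omega>"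
    by (rule real_cond_exp_add[OF gX_int c_int])
  moreover have "AE \<omega> in M. real_cond_exp M F (\<lambda>\<omega>. - c) \<omega> = - c"
    by (rule real_cond_exp_F_meas[OF c_int]) simp
  ultimately show ?thesis using rg AE_space
    by eventually_elim (simp add: gI, simp add: g_def)
qed

section \<open>Comparison of the two dynamics\<close>

lemma continuous_le_on_dense:
  fixes f :: "'a::metric_space \<Rightarrow> real"
  assumes "continuous_on S f" "closed S" "Q \<subseteq> S" "S \<subseteq> closure Q" "\<And>q. q \<in> Q \<Longrightarrow> f q \<le> c" "x \<in> S"
  shows "f x \<le> c"
proof (rule continuous_le_on_closure[where S = Q])
  have "closure Q = S" using assms by (metis closure_minimal subset_antisym)
  then show "continuous_on (closure Q) f" "x \<in> closure Q" using assms by auto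
qed (use assms in auto)

text \<open>The square root of the bound of \<open>AE_norm_confined\<close> at the final
  time.\<close>

definition token_radius :: "real \<Rightarrow> real \<Rightarrow> real \<Rightarrow> real" where
  "token_radius D R0 T = sqrt 2 * R0 * exp (2 * D * T)"

locale coupled_dynamics = sampled_heads M \<rho> H \<theta> D
  for M :: "'w measure" and \<rho> :: "('d::finite, 'k::finite) head measure" and H \<theta> D +
  fixes x0 :: "'w \<Rightarrow> real ^ 'd" and xH x :: "real \<Rightarrow> 'w \<Rightarrow> real ^ 'd"
    and \<kappa> :: "real \<Rightarrow> 'w \<Rightarrow> (real ^ 'd) measure" and T R0 :: real
  assumes T: "0 < T"
    and x0_measurable[measurable]: "x0 \<in> borel_measurable M"
    and x0_bounded: "AE \<omega> in M. norm (x0 \<omega>) \<le> R0"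
    and x0_indep: "indep_set (sets (heads_sigma M H \<theta>)) (sets (vimage_algebra (space M) x0 borel))"
    and finite_head: "finite_head_solution M H \<theta> T xH \<kappa>" and xH_init: "AE \<omega> in M. xH 0 \<omega> = x0 \<omega>"
    and mean_field: "mean_field_solution M \<rho> T x" and x_init: "AE \<omega> in M. x 0 \<omega> = x0 \<omega>"
begin

abbreviation F where "F \<equiv> heads_sigma M H \<theta>"

definition \<mu> where "\<mu> t = distr M borel (x t)"

abbreviation R where "R \<equiv> token_radius D R0 T"

section \<open>Measurability and confinement of both processes\<close>

lemma heads_tuple_measurable[measurable]: "heads_tuple H \<theta> \<in> M \<rightarrow>\<^sub>M (\<Pi>\<^sub>M r\<in>{1..H}. borel)"
  unfolding heads_tuple_def[abs_def] by (intro measurable_restrict head_measurable)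

lemma subalgebra_F: "subalgebra M F"
  unfolding subalgebra_def
proof
  show "sets F \<subseteq> sets M"
    unfolding heads_sigma_def sets_vimage_algebra
    using measurable_sets[OF heads_tuple_measurable] by (intro sets.sigma_sets_subset) auto
qed (simp add: heads_sigma_def)

sublocale F: finite_measure_subalgebra M F
  by unfold_locales (rule subalgebra_F)

lemma R0_nonneg: "0 \<le> R0"
proof -
  have "AE \<omega> in M. 0 \<le> R0" using x0_bounded by eventually_elim (meson norm_ge_zero order.trans)
  then show ?thesis by simp
qed

lemma R_nonneg: "0 \<le> R"
  using R0_nonneg by (simp add: token_radius_def)

lemma le_R:
  assumes "(norm v)\<^sup>2 \<le> 2 * R0\<^sup>2 * exp (4 * D * t)" "t \<in> {0..T}"
  shows "norm v \<le> R"
proof (rule power2_le_imp_le[OF _ R_nonneg])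
  have "exp (4 * D * t) \<le> exp (4 * D * T)" using assms(2) D0 by (simp add: mult_left_mono)
  then have "2 * R0\<^sup>2 * exp (4 * D * t) \<le> 2 * R0\<^sup>2 * exp (4 * D * T)" by (intro mult_left_mono) auto
  also have "\<dots> = R\<^sup>2"
  proof -
    have "exp (4 * D * T) = (exp (2 * D * T))\<^sup>2" by (simp add: power2_eq_square exp_add[symmetric])
    then show ?thesis by (simp add: token_radius_def power_mult_distrib)
  qed
  finally show "(norm v)\<^sup>2 \<le> R\<^sup>2" using assms(1) by linarith
qed

lemma x_measurable[measurable]: "t \<in> {0..T} \<Longrightarrow> x t \<in> borel_measurable M"
  using mean_field by (auto simp: mean_field_solution_def)

lemma xH_measurable[measurable]: "t \<in> {0..T} \<Longrightarrow> xH t \<in> borel_measurable M"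
  using finite_head by (auto simp: finite_head_solution_def)

lemma \<kappa>_cond_law: "t \<in> {0..T} \<Longrightarrow> cond_law M F (xH t) (\<kappa> t)"
  using finite_head by (auto simp: finite_head_solution_def)

lemma \<kappa>_measurable: "t \<in> {0..T} \<Longrightarrow> \<kappa> t \<in> F \<rightarrow>\<^sub>M prob_algebra borel"
  using \<kappa>_cond_law by (auto simp: cond_law_def)

lemma \<kappa>_borel_prob: "t \<in> {0..T} \<Longrightarrow> \<omega> \<in> space M \<Longrightarrow> borel_prob (\<kappa> t \<omega>)"
  using measurable_space[OF \<kappa>_measurable, of t \<omega>] subalgebra_F
  by (auto simp: subalgebra_def borel_prob_def space_prob_algebra)

lemma \<kappa>_AE_ball_iff:
  assumes "t \<in> {0..T}" "\<omega> \<in> space M"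
  shows "measure (\<kappa> t \<omega>) (cball 0 c) = 1 \<longleftrightarrow> (AE y in \<kappa> t \<omega>. norm y \<le> c)"
proof -
  interpret K: prob_space "\<kappa> t \<omega>" using \<kappa>_borel_prob[OF assms] by (simp add: borel_prob_def)
  have "sets (\<kappa> t \<omega>) = sets borel" using \<kappa>_borel_prob[OF assms] by (simp add: borel_prob_def)
  then have "K.prob (cball 0 c) = 1 \<longleftrightarrow> (AE y in \<kappa> t \<omega>. y \<in> cball 0 c)"
    by (intro K.prob_eq_1) auto
  then show ?thesis by simp
qed

lemma \<mu>_borel_prob: "t \<in> {0..T} \<Longrightarrow> borel_prob (\<mu> t)"
  by (simp add: borel_prob_def \<mu>_def prob_space_distr)

lemma \<mu>_AE_iff: "t \<in> {0..T} \<Longrightarrow> (AE y in \<mu> t. norm y \<le> c) \<longleftrightarrow> (AE \<omega> in M. norm (x t \<omega>) \<le> c)"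
  unfolding \<mu>_def by (subst AE_distr_iff) auto

lemma x_deriv: "AE \<omega> in M. \<forall>t\<in>{0..T}.
    ((\<lambda>s. x s \<omega>) has_vector_derivative mean_velocity \<rho> (\<mu> t) (x t \<omega>)) (at t within {0..T})"
  using mean_field by (simp add: mean_field_solution_def \<mu>_def)

lemma xH_deriv: "AE \<omega> in M. \<forall>t\<in>{0..T}.
    ((\<lambda>s. xH s \<omega>) has_vector_derivative head_velocity H (\<lambda>r. \<theta> r \<omega>) (xH t \<omega>) (\<kappa> t \<omega>)) (at t within {0..T})"
  using finite_head by (simp add: finite_head_solution_def)

lemma x_confined: "AE \<omega> in M. \<forall>t\<in>{0..T}. norm (x t \<omega>) \<le> R"
proof -
  obtain n where n: "\<forall>t\<in>{0..T}. measure_support (distr M borel (x t)) \<subseteq> cball 0 n"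
    using mean_field by (auto simp: mean_field_solution_def)
  have "AE \<omega> in M. \<omega> \<in> space M \<longrightarrow> (\<forall>t\<in>{0..T}. (norm (x t \<omega>))\<^sup>2 \<le> 2 * R0\<^sup>2 * exp (4 * D * t))"
  proof (rule AE_norm_confined[OF T D0 x_measurable x_deriv])
    show "AE \<omega> in M. norm (x 0 \<omega>) \<le> R0" using x_init x0_bounded by eventually_elim simp
    show "AE \<omega> in M. \<omega> \<in> space M \<longrightarrow> norm (x t \<omega>) \<le> n" if t: "t \<in> {0..T}" for t
    proof -
      have "AE y in distr M borel (x t). y \<in> cball 0 n"
        using n t by (subst measure_support_subset_iff[symmetric]) auto
      then show ?thesis using t by (simp add: AE_distr_iff)
    qed
    fix t c assume t: "t \<in> {0..T}" and c: "0 \<le> c" and "AE \<omega> in M. \<omega> \<in> space M \<longrightarrow> norm (x t \<omega>) \<le> c"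
    then have "AE y in \<mu> t. norm y \<le> c" by (simp add: \<mu>_AE_iff)
    from norm_mean_velocity_le[OF \<rho> \<mu>_borel_prob[OF t] this c D0]
    show "AE \<omega> in M. \<omega> \<in> space M \<longrightarrow> norm (mean_velocity \<rho> (\<mu> t) (x t \<omega>)) \<le> D * c" by simp
  qed auto
  then show ?thesis using AE_space
    by eventually_elim (blast intro: le_R)
qed

text \<open>
  The radius confining \<open>\<kappa>\<close> in the definition of a solution depends on the heads. It is bounded on
  each of countably many events that are measurable with respect to the heads, and these cover
  almost everything.
\<close>

lemma xH_confined: "AE \<omega> in M. \<forall>t\<in>{0..T}. norm (xH t \<omega>) \<le> R"
proof -
  obtain Q where Q: "countable Q" "Q \<subseteq> {0..T}" "{0..T} \<subseteq> closure Q" using separable[of "{0..T}"] by blast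
  have Qt: "t \<in> {0..T}" if "t \<in> Q" for t using Q(2) that by auto
  have Qne: "Q \<noteq> {}" using Q(3) T by auto
  \<comment> \<open>Only the countably many times in \<open>Q\<close> enter, which keeps the event
    measurable with respect to the heads; continuity of the paths recovers the remaining
    times.\<close>
  define E where "E n = {\<omega> \<in> space F. \<forall>t\<in>Q. measure (\<kappa> t \<omega>) (cball 0 (real n)) = 1}" for n :: nat
  have EF: "E n \<in> sets F" for n
  proof -
    have [measurable]: "(\<lambda>\<omega>. measure (\<kappa> t \<omega>) (cball 0 (real n))) \<in> borel_measurable F" if "t \<in> Q" for t
      by (rule measurable_compose[OF \<kappa>_measurable[OF Qt[OF that]] measurable_measure_prob_algebra]) simp
    show ?thesis unfolding E_def using Q(1) by measurable
  qed
  have EM: "E n \<in> events" for n using EF[of n] subalgebra_F by (auto simp: subalgebra_def)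
  have conf: "AE \<omega> in M. \<omega> \<in> E n \<longrightarrow> (\<forall>t\<in>{0..T}. (norm (xH t \<omega>))\<^sup>2 \<le> 2 * R0\<^sup>2 * exp (4 * D * t))" for n
  proof (rule AE_norm_confined[OF T D0 xH_measurable xH_deriv _ EM])
    show "AE \<omega> in M. norm (xH 0 \<omega>) \<le> R0" using xH_init x0_bounded by eventually_elim simp
    have "AE \<omega> in M. \<omega> \<in> E n \<longrightarrow> xH t \<omega> \<in> cball 0 (real n)" if t: "t \<in> Q" for t
    proof -
      have "AE \<omega> in M. \<omega> \<in> E n \<longrightarrow> measure (\<kappa> t \<omega>) (cball 0 (real n)) = 1" using t by (auto simp: E_def)
      then show ?thesis
        using cond_law_AE_iff[OF prob_space_axioms subalgebra_F \<kappa>_cond_law[OF Qt[OF t]] xH_measurable[OF Qt[OF t]] _ EF[of n]] by auto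
    qed
    then have "AE \<omega> in M. \<forall>t\<in>Q. \<omega> \<in> E n \<longrightarrow> xH t \<omega> \<in> cball 0 (real n)"
      using Q(1) by (subst AE_ball_countable) auto
    then have all: "AE \<omega> in M. \<omega> \<in> E n \<longrightarrow> (\<forall>t\<in>{0..T}. norm (xH t \<omega>) \<le> real n)"
      using xH_deriv
    proof eventually_elim
      case (elim \<omega>)
      show ?case
      proof (intro impI ballI)
        fix t assume \<omega>: "\<omega> \<in> E n" and t: "t \<in> {0..T}"
        show "norm (xH t \<omega>) \<le> real n"
        proof (rule continuous_le_on_dense[OF _ _ Q(2,3) _ t])
          show "continuous_on {0..T} (\<lambda>s. norm (xH s \<omega>))"
            using elim(2) by (intro continuous_on_norm continuous_on_vector_derivative) auto
        qed (use elim(1) \<omega> in auto)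
      qed
    qed
    show "AE \<omega> in M. \<omega> \<in> E n \<longrightarrow> norm (xH t \<omega>) \<le> real n" if "t \<in> {0..T}" for t
      using all by eventually_elim (use that in auto)
    fix t c assume t: "t \<in> {0..T}" and c: "0 \<le> c" and "AE \<omega> in M. \<omega> \<in> E n \<longrightarrow> norm (xH t \<omega>) \<le> c"
    \<comment> \<open>Since \<open>E n\<close> is determined by the heads, the bound on the token
      passes to its conditional law, and it is this law that bounds the velocity.\<close>
    then have "AE \<omega> in M. \<omega> \<in> E n \<longrightarrow> measure (\<kappa> t \<omega>) (cball 0 c) = 1"
      using cond_law_AE_iff[OF prob_space_axioms subalgebra_F \<kappa>_cond_law[OF t] xH_measurable[OF t] _ EF[of n], of "cball 0 c"] by auto
    then show "AE \<omega> in M. \<omega> \<in> E n \<longrightarrow> norm (head_velocity H (\<lambda>r. \<theta> r \<omega>) (xH t \<omega>) (\<kappa> t \<omega>)) \<le> D * c"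
      using head_bounded AE_space
      by eventually_elim
        (auto intro!: norm_head_velocity_le[OF H D0 c] simp: \<kappa>_borel_prob[OF t] \<kappa>_AE_ball_iff[OF t])
  qed
  have "AE \<omega> in M. \<exists>n. \<omega> \<in> E n"
  proof -
    have "AE \<omega> in M. \<exists>r. \<forall>t\<in>{0..T}. measure_support (\<kappa> t \<omega>) \<subseteq> cball 0 r"
      using finite_head by (simp add: finite_head_solution_def)
    then show ?thesis using AE_space
    proof eventually_elim
      case (elim \<omega>)
      then obtain r where r: "\<forall>t\<in>{0..T}. measure_support (\<kappa> t \<omega>) \<subseteq> cball 0 r" by blast
      obtain n :: nat where n: "r \<le> real n" using real_arch_simple by blast
      have "measure (\<kappa> t \<omega>) (cball 0 (real n)) = 1" if "t \<in> Q" for t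
      proof -
        have "sets (\<kappa> t \<omega>) = sets borel" using \<kappa>_borel_prob[OF Qt[OF that] elim(2)] by (simp add: borel_prob_def)
        then have "AE y in \<kappa> t \<omega>. y \<in> cball 0 r" using r Qt[OF that] by (subst measure_support_subset_iff[symmetric]) auto
        then have "AE y in \<kappa> t \<omega>. norm y \<le> real n" by eventually_elim (use n in auto)
        then show ?thesis by (simp add: \<kappa>_AE_ball_iff[OF Qt[OF that] elim(2)])
      qed
      then have "\<omega> \<in> E n" using elim(2) subalgebra_F by (simp add: E_def subalgebra_def)
      then show ?case ..
    qed
  qed
  moreover have "AE \<omega> in M. \<forall>n. \<omega> \<in> E n \<longrightarrow> (\<forall>t\<in>{0..T}. (norm (xH t \<omega>))\<^sup>2 \<le> 2 * R0\<^sup>2 * exp (4 * D * t))"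
    unfolding AE_all_countable using conf by blast
  ultimately show ?thesis by eventually_elim (blast intro: le_R)
qed

lemma \<mu>_confined: "t \<in> {0..T} \<Longrightarrow> AE y in \<mu> t. norm y \<le> R"
  using x_confined by (auto simp: \<mu>_AE_iff elim: eventually_mono)

lemma \<kappa>_confined:
  assumes t: "t \<in> {0..T}"
  shows "AE \<omega> in M. AE y in \<kappa> t \<omega>. norm y \<le> R"
proof -
  have "AE \<omega> in M. \<omega> \<in> space M \<longrightarrow> xH t \<omega> \<in> cball 0 R"
    using xH_confined by eventually_elim (use t in auto)
  moreover have "space M \<in> sets F" using subalgebra_F sets.top[of F] by (simp add: subalgebra_def)
  ultimately have "AE \<omega> in M. \<omega> \<in> space M \<longrightarrow> measure (\<kappa> t \<omega>) (cball 0 R) = 1"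
    using cond_law_AE_iff[OF prob_space_axioms subalgebra_F \<kappa>_cond_law[OF t] xH_measurable[OF t], of "cball 0 R" "space M"] by auto
  then show ?thesis using AE_space by eventually_elim (simp add: \<kappa>_AE_ball_iff[OF t])
qed

text \<open>The law \<open>\<mu>\<close> is deterministic, so almost every mean-field path follows
  one fixed time-dependent field, Lipschitz on the confining ball. Up to a null set x(t) is thus a
  Borel function of the initial token, while \<open>x t\<close> itself is only known to be
  measurable with respect to \<open>M\<close>.\<close>

lemma x_flow_map:
  assumes t: "t \<in> {0..T}"
  obtains \<Phi> where "continuous_on UNIV \<Phi>" "AE \<omega> in M. x t \<omega> = \<Phi> (x0 \<omega>)"
proof -
  obtain \<Phi> where \<Phi>: "continuous_on UNIV \<Phi>" "AE \<omega> in M. x t \<omega> = \<Phi> (x 0 \<omega>)"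
  proof (rule AE_flow_map[where F = "\<lambda>s. mean_velocity \<rho> (\<mu> s)", OF x_deriv x_confined _ t])
    show "norm (mean_velocity \<rho> (\<mu> s) y - mean_velocity \<rho> (\<mu> s) z) \<le> attention_lip D R * norm (y - z)"
      if "s \<in> {0..T}" "norm y \<le> R" "norm z \<le> R" for s y z
      using mean_velocity_lipschitz[OF D0 R_nonneg \<mu>_borel_prob[OF that(1)] \<mu>_confined[OF that(1)] \<rho> that(2,3)] .
  qed
  from \<Phi>(2) x_init have "AE \<omega> in M. x t \<omega> = \<Phi> (x0 \<omega>)" by eventually_elim simp
  from that[OF \<Phi>(1) this] show thesis .
qed

section \<open>Independence of the heads and the initial token\<close>

abbreviation G where "G \<equiv> vimage_algebra (space M) x0 borel"

lemma F_G_indep: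
  fixes Y Z :: "'w \<Rightarrow> real"
  assumes Y: "Y \<in> borel_measurable F" and Z: "Z \<in> borel_measurable G"
  shows "indep_var borel Y borel Z"
proof -
  have sub: "sigma_sets (space M) {U -` A \<inter> space M |A. A \<in> sets borel} \<subseteq> sets N"
    if "U \<in> borel_measurable N" "space N = space M" for U :: "'w \<Rightarrow> real" and N
    using sets.sigma_sets_subset[of "{U -` A \<inter> space M |A. A \<in> sets borel}" N] measurable_sets[OF that(1)]
    by (auto simp: that(2))
  have "subalgebra M G"
    using indep_setD_ev2[OF x0_indep] by (simp add: subalgebra_def)
  then have "Y \<in> borel_measurable M" "Z \<in> borel_measurable M"
    using Y Z subalgebra_F by (auto intro: measurable_from_subalg)
  moreover have "space F = space M" using subalgebra_F by (simp add: subalgebra_def)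
  note sF = sub[OF Y this] and sG = sub[OF Z space_vimage_algebra]
  have "indep_set (sigma_sets (space M) {Y -` A \<inter> space M |A. A \<in> sets borel})
      (sigma_sets (space M) {Z -` A \<inter> space M |A. A \<in> sets borel})"
    unfolding indep_sets2_eq
  proof (intro conjI ballI)
    show "sigma_sets (space M) {Y -` A \<inter> space M |A. A \<in> sets borel} \<subseteq> events"
      by (rule order.trans[OF sF indep_setD_ev1[OF x0_indep]])
    show "sigma_sets (space M) {Z -` A \<inter> space M |A. A \<in> sets borel} \<subseteq> events"
      by (rule order.trans[OF sG indep_setD_ev2[OF x0_indep]])
    fix a b
    assume "a \<in> sigma_sets (space M) {Y -` A \<inter> space M |A. A \<in> sets borel}"
      "b \<in> sigma_sets (space M) {Z -` A \<inter> space M |A. A \<in> sets borel}"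
    then show "prob (a \<inter> b) = prob a * prob b"
      by (intro indep_setD[OF x0_indep] subsetD[OF sF] subsetD[OF sG])
  qed
  ultimately show ?thesis unfolding indep_var_eq by blast
qed

text \<open>Independence as a product law, the form in which Tonelli's theorem is applied in
  \<open>sampling_err_square_le\<close>.\<close>

lemma heads_x0_distr:
  "distr M ((\<Pi>\<^sub>M r\<in>{1..H}. borel) \<Otimes>\<^sub>M borel) (\<lambda>\<omega>. (heads_tuple H \<theta> \<omega>, x0 \<omega>))
    = distr M (\<Pi>\<^sub>M r\<in>{1..H}. borel) (heads_tuple H \<theta>) \<Otimes>\<^sub>M distr M borel x0"
proof (rule pair_measure_eqI[symmetric])
  interpret h: prob_space "distr M (\<Pi>\<^sub>M r\<in>{1..H}. borel) (heads_tuple H \<theta>)"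
    by (rule prob_space_distr[OF heads_tuple_measurable])
  interpret x: prob_space "distr M borel x0" by (rule prob_space_distr) simp
  show "sigma_finite_measure (distr M (\<Pi>\<^sub>M r\<in>{1..H}. borel) (heads_tuple H \<theta>))" ..
  show "sigma_finite_measure (distr M borel x0)" ..
  fix A B assume A: "A \<in> sets (distr M (\<Pi>\<^sub>M r\<in>{1..H}. borel) (heads_tuple H \<theta>))" and B: "B \<in> sets (distr M borel x0)"
  have A': "A \<in> sets (\<Pi>\<^sub>M r\<in>{1..H}. borel)" and B': "B \<in> sets borel" using A B unfolding sets_distr .
  have pair: "(\<lambda>\<omega>. (heads_tuple H \<theta> \<omega>, x0 \<omega>)) \<in> M \<rightarrow>\<^sub>M (\<Pi>\<^sub>M r\<in>{1..H}. borel) \<Otimes>\<^sub>M borel"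
    by (rule measurable_Pair[OF heads_tuple_measurable x0_measurable])
  have "prob ((heads_tuple H \<theta> -` A \<inter> space M) \<inter> (x0 -` B \<inter> space M))
      = prob (heads_tuple H \<theta> -` A \<inter> space M) * prob (x0 -` B \<inter> space M)"
    unfolding heads_sigma_def by (rule indep_setD[OF x0_indep[unfolded heads_sigma_def]]; rule in_vimage_algebra; fact)
  moreover have "(\<lambda>\<omega>. (heads_tuple H \<theta> \<omega>, x0 \<omega>)) -` (A \<times> B) \<inter> space M
      = (heads_tuple H \<theta> -` A \<inter> space M) \<inter> (x0 -` B \<inter> space M)" by auto
  ultimately show "emeasure (distr M (\<Pi>\<^sub>M r\<in>{1..H}. borel) (heads_tuple H \<theta>)) A * emeasure (distr M borel x0) B
      = emeasure (distr M ((\<Pi>\<^sub>M r\<in>{1..H}. borel) \<Otimes>\<^sub>M borel) (\<lambda>\<omega>. (heads_tuple H \<theta> \<omega>, x0 \<omega>))) (A \<times> B)"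
    unfolding emeasure_distr[OF heads_tuple_measurable A'] emeasure_distr[OF x0_measurable B']
      emeasure_distr[OF pair pair_measureI[OF A' B']] by (simp add: emeasure_eq_measure ennreal_mult'')
qed (simp cong: sets_pair_measure_cong)

text \<open>Almost surely \<open>x t\<close> is a function of \<open>x0\<close>, so conditioning on
  the heads leaves only the unconditional mean. This is the second marginal of the conditional
  coupling; \<open>cond_law_integral\<close> is the first.\<close>

lemma cond_exp_x:
  fixes f :: "real ^ 'd \<Rightarrow> real"
  assumes t: "t \<in> {0..T}" and f[measurable]: "f \<in> borel_measurable borel" and bound: "\<And>y. \<bar>f y\<bar> \<le> c"
  shows "AE \<omega> in M. real_cond_exp M F (\<lambda>\<omega>. f (x t \<omega>)) \<omega> = (\<integral>y. f y \<partial>\<mu> t)"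
proof -
  obtain \<Phi> where \<Phi>: "continuous_on UNIV \<Phi>" "AE \<omega> in M. x t \<omega> = \<Phi> (x0 \<omega>)" using x_flow_map[OF t] .
  have [measurable]: "\<Phi> \<in> borel_measurable borel" using \<Phi>(1) by (rule borel_measurable_continuous_onI)
  have int: "integrable M (\<lambda>\<omega>. f (x t \<omega>))"
    using t bound by (intro integrable_const_bound[of _ c]) auto
  have int\<Phi>: "integrable M (\<lambda>\<omega>. f (\<Phi> (x0 \<omega>)))"
    using bound by (intro integrable_const_bound[of _ c]) auto
  have \<mu>_eq: "(\<integral>y. f y \<partial>\<mu> t) = expectation (\<lambda>\<omega>. f (\<Phi> (x0 \<omega>)))"
  proof -
    have "(\<integral>y. f y \<partial>\<mu> t) = expectation (\<lambda>\<omega>. f (x t \<omega>))"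
      unfolding \<mu>_def using t by (intro integral_distr) auto
    also have "\<dots> = expectation (\<lambda>\<omega>. f (\<Phi> (x0 \<omega>)))"
      using \<Phi>(2) t by (intro integral_cong_AE) (auto elim!: eventually_mono)
    finally show ?thesis .
  qed
  show ?thesis
  proof (rule F.real_cond_exp_charact[OF _ int])
    fix A assume A: "A \<in> sets F"
    have AM[measurable]: "A \<in> events" using A subalgebra_F by (auto simp: subalgebra_def)
    have "x0 \<in> borel_measurable G" by (rule measurable_vimage_algebra1) auto
    then have "(\<lambda>\<omega>. f (\<Phi> (x0 \<omega>))) \<in> borel_measurable G" by measurable
    then have ind: "indep_var borel (indicator A :: _ \<Rightarrow> real) borel (\<lambda>\<omega>. f (\<Phi> (x0 \<omega>)))"
      using A by (intro F_G_indep borel_measurable_indicator)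
    have intA: "integrable M (indicator A :: _ \<Rightarrow> real)"
      by (rule integrable_const_bound[of _ 1]) (auto split: split_indicator)
    have "(\<integral>\<omega>\<in>A. f (x t \<omega>) \<partial>M) = (\<integral>\<omega>. indicator A \<omega> * f (\<Phi> (x0 \<omega>)) \<partial>M)"
      unfolding set_lebesgue_integral_def
    proof (rule integral_cong_AE)
      show "AE \<omega> in M. indicator A \<omega> *\<^sub>R f (x t \<omega>) = indicator A \<omega> * f (\<Phi> (x0 \<omega>))"
        using \<Phi>(2) by eventually_elim simp
    qed (use t in measurable)
    also have "\<dots> = (\<integral>\<omega>. indicator A \<omega> \<partial>M) * (\<integral>\<omega>. f (\<Phi> (x0 \<omega>)) \<partial>M)"
      by (rule indep_var_lebesgue_integral[OF ind intA int\<Phi>])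
    also have "(\<integral>\<omega>. indicator A \<omega> \<partial>M) = prob A" by (simp add: sets.sets_into_space Int_absorb2)
    also have "prob A * (\<integral>\<omega>. f (\<Phi> (x0 \<omega>)) \<partial>M) = (\<integral>\<omega>\<in>A. (\<integral>y. f y \<partial>\<mu> t) \<partial>M)"
      unfolding \<mu>_eq set_lebesgue_integral_def by (simp add: sets.sets_into_space Int_absorb2)
    finally show "(\<integral>\<omega>\<in>A. f (x t \<omega>) \<partial>M) = (\<integral>\<omega>\<in>A. (\<integral>y. f y \<partial>\<mu> t) \<partial>M)" .
  qed auto
qed

section \<open>The token error and its conditional mean given the heads\<close>

definition err where "err t \<omega> = norm (xH t \<omega> - x t \<omega>)"

text \<open>The cost of the coupling of \<open>\<kappa> t\<close> with \<open>\<mu> t\<close> given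
  the heads; it takes the place of a Wasserstein distance between the two laws.\<close>

definition cond_err where "cond_err t = real_cond_exp M F (err t)"

lemma err_measurable[measurable]: "t \<in> {0..T} \<Longrightarrow> err t \<in> borel_measurable M"
  unfolding err_def[abs_def] by measurable

lemma cond_err_measurable[measurable]: "cond_err t \<in> borel_measurable M"
  unfolding cond_err_def by simp

lemma err_bounded: "AE \<omega> in M. \<forall>t\<in>{0..T}. err t \<omega> \<le> 2 * R"
  using x_confined xH_confined
proof eventually_elim
  case (elim \<omega>)
  show ?case
  proof
    fix t assume "t \<in> {0..T}"
    then have "norm (xH t \<omega>) \<le> R" "norm (x t \<omega>) \<le> R" using elim by auto
    then show "err t \<omega> \<le> 2 * R" using norm_triangle_ineq4[of "xH t \<omega>" "x t \<omega>"] by (simp add: err_def)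
  qed
qed

lemma err_integrable:
  assumes t: "t \<in> {0..T}"
  shows "integrable M (err t)" "integrable M (\<lambda>\<omega>. (err t \<omega>)\<^sup>2)"
proof -
  have b: "AE \<omega> in M. err t \<omega> \<le> 2 * R" using err_bounded by eventually_elim (use t in auto)
  then show "integrable M (err t)"
    using t by (intro integrable_const_bound[of _ "2 * R"]) (auto simp: err_def elim: eventually_mono)
  show "integrable M (\<lambda>\<omega>. (err t \<omega>)\<^sup>2)"
  proof (rule integrable_const_bound)
    show "AE \<omega> in M. norm ((err t \<omega>)\<^sup>2) \<le> (2 * R)\<^sup>2"
      using b
    proof eventually_elim
      case (elim \<omega>)
      then have "(err t \<omega>)\<^sup>2 \<le> (2 * R)\<^sup>2" by (rule power_mono) (simp add: err_def)
      then show ?case by simp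
    qed
  qed (use t in measurable)
qed

text \<open>Conditional Jensen for the square. The error in the law therefore costs no more than the
  error in the token and can be absorbed into the growth rate.\<close>

lemma cond_err_square_le:
  assumes t: "t \<in> {0..T}"
  shows "(\<integral>\<^sup>+ \<omega>. ennreal ((cond_err t \<omega>)\<^sup>2) \<partial>M) \<le> ennreal (expectation (\<lambda>\<omega>. (err t \<omega>)\<^sup>2))"
proof -
  have jensen: "AE \<omega> in M. (cond_err t \<omega>)\<^sup>2 \<le> real_cond_exp M F (\<lambda>\<omega>. (err t \<omega>)\<^sup>2) \<omega>"
    unfolding cond_err_def
    by (rule F.real_cond_exp_jensens_inequality(2)[where I = UNIV and q = "\<lambda>u. u\<^sup>2"])
       (use err_integrable[OF t] convex_power2 in auto)
  have pos: "AE \<omega> in M. 0 \<le> real_cond_exp M F (\<lambda>\<omega>. (err t \<omega>)\<^sup>2) \<omega>"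
    using jensen by eventually_elim (meson order.trans zero_le_power2)
  have "(\<integral>\<^sup>+ \<omega>. ennreal ((cond_err t \<omega>)\<^sup>2) \<partial>M) \<le> (\<integral>\<^sup>+ \<omega>. ennreal (real_cond_exp M F (\<lambda>\<omega>. (err t \<omega>)\<^sup>2) \<omega>) \<partial>M)"
    using jensen by (intro nn_integral_mono_AE) (auto elim!: eventually_mono intro: ennreal_leI)
  also have "\<dots> = ennreal (expectation (real_cond_exp M F (\<lambda>\<omega>. (err t \<omega>)\<^sup>2)))"
    by (rule nn_integral_eq_integral[OF F.real_cond_exp_int(1)[OF err_integrable(2)[OF t]] pos])
  also have "expectation (real_cond_exp M F (\<lambda>\<omega>. (err t \<omega>)\<^sup>2)) = expectation (\<lambda>\<omega>. (err t \<omega>)\<^sup>2)"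
    by (rule F.real_cond_exp_int(2)[OF err_integrable(2)[OF t]])
  finally show ?thesis .
qed

text \<open>The two integrals are the conditional expectations of \<open>f (xH t)\<close> and
  \<open>f (x t)\<close> given the heads, and these differ by at most that of
  \<open>l * err t\<close>. Lipschitz continuity on the ball suffices because both tokens stay
  there.\<close>

lemma cond_exp_diff_le:
  fixes f :: "real ^ 'd \<Rightarrow> real"
  assumes t: "t \<in> {0..T}" and f[measurable]: "f \<in> borel_measurable borel" and bound: "\<And>y. \<bar>f y\<bar> \<le> c"
    and l: "0 \<le> l" and lip: "\<And>y z. norm y \<le> R \<Longrightarrow> norm z \<le> R \<Longrightarrow> \<bar>f y - f z\<bar> \<le> l * norm (y - z)"
  shows "AE \<omega> in M. \<bar>(\<integral>y. f y \<partial>\<kappa> t \<omega>) - (\<integral>y. f y \<partial>\<mu> t)\<bar> \<le> l * cond_err t \<omega>"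
proof -
  have int: "integrable M (\<lambda>\<omega>. f (xH t \<omega>))" "integrable M (\<lambda>\<omega>. f (x t \<omega>))" "integrable M (\<lambda>\<omega>. l * err t \<omega>)"
    using t bound err_integrable(1)[OF t] by (auto intro!: integrable_const_bound[of _ c])
  have ae: "AE \<omega> in M. \<bar>f (xH t \<omega>) - f (x t \<omega>)\<bar> \<le> l * err t \<omega>"
    using x_confined xH_confined by eventually_elim (use t in \<open>auto simp: err_def intro: lip\<close>)
  have *: "AE \<omega> in M. real_cond_exp M F u \<omega> \<le> real_cond_exp M F v \<omega> + l * cond_err t \<omega>"
    if u: "integrable M u" and v: "integrable M v" and le: "AE \<omega> in M. u \<omega> \<le> v \<omega> + l * err t \<omega>" for u v
  proof -
    have "AE \<omega> in M. real_cond_exp M F u \<omega> \<le> real_cond_exp M F (\<lambda>\<omega>. v \<omega> + l * err t \<omega>) \<omega>"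
      using u v int(3) le by (intro F.real_cond_exp_mono) auto
    moreover have "AE \<omega> in M. real_cond_exp M F (\<lambda>\<omega>. v \<omega> + l * err t \<omega>) \<omega>
        = real_cond_exp M F v \<omega> + real_cond_exp M F (\<lambda>\<omega>. l * err t \<omega>) \<omega>"
      by (rule F.real_cond_exp_add[OF v int(3)])
    moreover have "AE \<omega> in M. real_cond_exp M F (\<lambda>\<omega>. l * err t \<omega>) \<omega> = l * cond_err t \<omega>"
      unfolding cond_err_def by (rule F.real_cond_exp_cmult[OF err_integrable(1)[OF t]])
    ultimately show ?thesis by eventually_elim simp
  qed
  have 1: "AE \<omega> in M. f (xH t \<omega>) \<le> f (x t \<omega>) + l * err t \<omega>" using ae by eventually_elim linarith
  have 2: "AE \<omega> in M. f (x t \<omega>) \<le> f (xH t \<omega>) + l * err t \<omega>" using ae by eventually_elim linarith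
  show ?thesis
    using *[OF int(1,2) 1] *[OF int(2,1) 2] cond_exp_x[OF t f bound]
      cond_law_integral[OF prob_space_axioms subalgebra_F \<kappa>_cond_law[OF t] xH_measurable[OF t] f bound]
    by eventually_elim (simp add: abs_le_iff)
qed

lemma attention_cond_diff_le:
  fixes h :: "('d, 'k) head"
  assumes t: "t \<in> {0..T}" and h: "norm h \<le> D" and z: "norm z \<le> R"
  shows "AE \<omega> in M. norm (attention z (\<kappa> t \<omega>) h - attention z (\<mu> t) h)
    \<le> real CARD('d) * attention_lip D R * cond_err t \<omega>"
proof -
  define a where "a = attention z (\<mu> t) h"
  have a: "norm a \<le> D * R"
    unfolding a_def by (rule norm_attention_le[OF \<mu>_borel_prob[OF t] \<mu>_confined[OF t] h R_nonneg D0])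
  \<comment> \<open>Conditional expectations are real-valued, hence the coordinates. The residual is
    bounded only on the ball, hence the cutoff; it leaves the integrals unchanged because both laws
    live on the ball.\<close>
  define f where "f i y = indicator (cball 0 R) y * (attn_residual h z a y $ i)" for i y
  have "AE \<omega> in M. \<bar>(\<integral>y. f i y \<partial>\<kappa> t \<omega>) - (\<integral>y. f i y \<partial>\<mu> t)\<bar> \<le> residual_lip D R * cond_err t \<omega>" for i
  proof (rule cond_exp_diff_le[OF t])
    have "(\<lambda>v :: real ^ 'd. v $ i) \<in> borel_measurable borel"
      by (intro borel_measurable_continuous_onI continuous_intros)
    from measurable_compose[OF measurable_attn_residual[of h z a] this] show "f i \<in> borel_measurable borel"
      unfolding f_def by (intro borel_measurable_times borel_measurable_indicator) simp_all
    show "\<bar>f i y\<bar> \<le> attn_bound D R * (2 * (D * R))" for y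
    proof (cases "norm y \<le> R")
      case True
      from norm_attn_residual_le[OF D0 R_nonneg h z this a] component_le_norm_cart[of "attn_residual h z a y" i] True
      show ?thesis by (simp add: f_def)
    next
      case False
      then show ?thesis using D0 R_nonneg attn_bound_ge_1[of D R] by (simp add: f_def)
    qed
    show "0 \<le> residual_lip D R" by (rule residual_lip_nonneg[OF D0 R_nonneg])
    show "\<bar>f i y - f i w\<bar> \<le> residual_lip D R * norm (y - w)" if "norm y \<le> R" "norm w \<le> R" for y w
      using attn_residual_lipschitz[OF D0 R_nonneg h z that(1) h z that(2) a] that
        component_le_norm_cart[of "attn_residual h z a y - attn_residual h z a w" i]
      by (simp add: f_def)
  qed
  then have "AE \<omega> in M. \<forall>i\<in>UNIV. \<bar>(\<integral>y. f i y \<partial>\<kappa> t \<omega>) - (\<integral>y. f i y \<partial>\<mu> t)\<bar> \<le> residual_lip D R * cond_err t \<omega>"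
    by (intro AE_finite_allI) auto
  then show ?thesis using \<kappa>_confined[OF t] AE_space
  proof eventually_elim
    case (elim \<omega>)
    have comp: "(\<integral>y. attn_residual h z a y \<partial>\<nu>) $ i = (\<integral>y. f i y \<partial>\<nu>)"
      if \<nu>: "borel_prob \<nu>" "AE y in \<nu>. norm y \<le> R" for \<nu> i
    proof -
      have [measurable_cong]: "sets \<nu> = sets borel" using \<nu> by (simp add: borel_prob_def)
      have m: "(\<lambda>v :: real ^ 'd. v $ i) \<in> borel_measurable borel"
        by (intro borel_measurable_continuous_onI continuous_intros)
      note [measurable] = measurable_compose[OF measurable_attn_residual m]
      have "(\<integral>y. attn_residual h z a y \<partial>\<nu>) $ i = (\<integral>y. attn_residual h z a y $ i \<partial>\<nu>)"
        by (rule integral_bounded_linear[OF bounded_linear_vec_nth attn_integrable(2)[OF D0 R_nonneg \<nu> h z a], symmetric])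
      also have "\<dots> = (\<integral>y. f i y \<partial>\<nu>)"
      proof (rule integral_cong_AE)
        have "cball 0 R \<in> sets \<nu>" using \<nu>(1) by (simp add: borel_prob_def)
        then show "f i \<in> borel_measurable \<nu>"
          unfolding f_def by (intro borel_measurable_times borel_measurable_indicator) measurable
        show "AE y in \<nu>. attn_residual h z a y $ i = f i y"
          using \<nu>(2) by eventually_elim (simp add: f_def)
      qed measurable
      finally show ?thesis .
    qed
    let ?d = "(\<integral>y. attn_residual h z a y \<partial>\<kappa> t \<omega>) - (\<integral>y. attn_residual h z a y \<partial>\<mu> t)"
    have "norm ?d \<le> (\<Sum>i\<in>(UNIV :: 'd set). residual_lip D R * cond_err t \<omega>)"
      using elim(1) comp[OF \<kappa>_borel_prob[OF t elim(3)] elim(2)] comp[OF \<mu>_borel_prob[OF t] \<mu>_confined[OF t]]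
      by (intro order.trans[OF norm_le_l1_cart] sum_mono) simp
    then have "attn_bound D R * norm ?d \<le> attn_bound D R * (real CARD('d) * (residual_lip D R * cond_err t \<omega>))"
      using attn_bound_ge_1[of D R] by (intro mult_left_mono) auto
    moreover have "norm (attention z (\<kappa> t \<omega>) h - attention z (\<mu> t) h) \<le> attn_bound D R * norm ?d"
      unfolding a_def
      by (rule norm_attention_measure_diff_le[OF D0 R_nonneg \<kappa>_borel_prob[OF t elim(3)] elim(2) \<mu>_borel_prob[OF t] \<mu>_confined[OF t] h z])
    ultimately show ?case by (simp add: attention_lip_def mult_ac)
  qed
qed

text \<open>In \<open>attention_cond_diff_le\<close> the exceptional set depends on \<open>z\<close>
  and \<open>h\<close>, but the random \<open>xH t \<omega>\<close> and
  \<open>\<theta> r \<omega>\<close> are to be inserted. A countable dense set of pairs and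
  continuity of both outputs give one set for all pairs.\<close>

lemma attention_cond_diff_le_all:
  assumes t: "t \<in> {0..T}"
  shows "AE \<omega> in M. \<forall>z (h :: ('d, 'k) head). norm z \<le> R \<longrightarrow> norm h \<le> D \<longrightarrow>
    norm (attention z (\<kappa> t \<omega>) h - attention z (\<mu> t) h) \<le> real CARD('d) * attention_lip D R * cond_err t \<omega>"
proof -
  define S where "S = cball (0 :: real ^ 'd) R \<times> cball (0 :: ('d, 'k) head) D"
  obtain Q where Q: "countable Q" "Q \<subseteq> S" "S \<subseteq> closure Q" using separable[of S] by blast
  have "AE \<omega> in M. \<forall>q\<in>Q. norm (attention (fst q) (\<kappa> t \<omega>) (snd q) - attention (fst q) (\<mu> t) (snd q))
      \<le> real CARD('d) * attention_lip D R * cond_err t \<omega>"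
    using Q(1)
  proof (subst AE_ball_countable, safe)
    fix q assume "q \<in> Q"
    then have "norm (fst q) \<le> R" "norm (snd q) \<le> D" using Q(2) by (auto simp: S_def)
    then show "AE \<omega> in M. norm (attention (fst q) (\<kappa> t \<omega>) (snd q) - attention (fst q) (\<mu> t) (snd q))
      \<le> real CARD('d) * attention_lip D R * cond_err t \<omega>" by (intro attention_cond_diff_le[OF t])
  qed
  then show ?thesis using \<kappa>_confined[OF t] AE_space
  proof eventually_elim
    case (elim \<omega>)
    have cont: "continuous_on S (\<lambda>q. norm (attention (fst q) (\<kappa> t \<omega>) (snd q) - attention (fst q) (\<mu> t) (snd q)))"
      using continuous_attention[OF \<kappa>_borel_prob[OF t elim(3)] elim(2)] continuous_attention[OF \<mu>_borel_prob[OF t] \<mu>_confined[OF t]]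
      by (intro continuous_on_norm continuous_on_diff) (blast intro: continuous_on_subset)+
    have cl: "closed S" unfolding S_def by (intro closed_Times closed_cball)
    have "norm (attention (fst q) (\<kappa> t \<omega>) (snd q) - attention (fst q) (\<mu> t) (snd q))
        \<le> real CARD('d) * attention_lip D R * cond_err t \<omega>" if "q \<in> S" for q
      using continuous_le_on_dense[OF cont cl Q(2,3) _ that] elim(1) by blast
    then show ?case by (force simp: S_def)
  qed
qed

section \<open>The sampling error along the mean-field path\<close>

definition sampling_err where
  "sampling_err t \<omega> = norm (head_velocity H (\<lambda>r. \<theta> r \<omega>) (x t \<omega>) (\<mu> t) - mean_velocity \<rho> (\<mu> t) (x t \<omega>))"

lemma sampling_err_measurable:
  assumes t: "t \<in> {0..T}"
  shows "sampling_err t \<in> borel_measurable M"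
proof -
  have mv: "mean_velocity \<rho> (\<mu> t) \<in> borel_measurable borel"
    by (rule borel_measurable_continuous_onI[OF continuous_mean_velocity[OF D0 \<mu>_borel_prob[OF t] \<mu>_confined[OF t] \<rho>]])
  show ?thesis
    unfolding sampling_err_def head_velocity_def
    by (intro borel_measurable_norm[THEN measurable_compose[rotated]] borel_measurable_diff borel_measurable_scaleR
          borel_measurable_const borel_measurable_sum measurable_attention[OF \<mu>_borel_prob[OF t] \<mu>_confined[OF t]]
          x_measurable[OF t] head_measurable measurable_compose[OF x_measurable[OF t] mv])
qed

text \<open>The law is changed first, at \<open>xH t\<close> (\<open>cond_err\<close>), then the
  token, under \<open>\<mu> t\<close> (\<open>err\<close>), and last the sampled heads are replaced
  by their mean, at the token \<open>x t\<close> (\<open>sampling_err\<close>).\<close>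

lemma velocity_diff_le:
  assumes t: "t \<in> {0..T}"
  shows "AE \<omega> in M. norm (head_velocity H (\<lambda>r. \<theta> r \<omega>) (xH t \<omega>) (\<kappa> t \<omega>) - mean_velocity \<rho> (\<mu> t) (x t \<omega>))
    \<le> attention_lip D R * err t \<omega> + real CARD('d) * attention_lip D R * cond_err t \<omega> + sampling_err t \<omega>"
  using attention_cond_diff_le_all[OF t] x_confined xH_confined \<kappa>_confined[OF t] head_bounded
proof eventually_elim
  case (elim \<omega>)
  have b: "norm (x t \<omega>) \<le> R" "norm (xH t \<omega>) \<le> R" using elim t by auto
  have "norm (head_velocity H (\<lambda>r. \<theta> r \<omega>) (xH t \<omega>) (\<kappa> t \<omega>) - head_velocity H (\<lambda>r. \<theta> r \<omega>) (x t \<omega>) (\<mu> t))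
      \<le> attention_lip D R * err t \<omega> + real CARD('d) * attention_lip D R * cond_err t \<omega>"
  proof (rule norm_head_velocity_diff_le[OF H])
    fix r assume "r \<in> {1..H}"
    then have r: "norm (\<theta> r \<omega>) \<le> D" using elim by blast
    have "norm (attention (xH t \<omega>) (\<kappa> t \<omega>) (\<theta> r \<omega>) - attention (xH t \<omega>) (\<mu> t) (\<theta> r \<omega>))
        \<le> real CARD('d) * attention_lip D R * cond_err t \<omega>" using elim(1) b r by blast
    moreover have "norm (attention (xH t \<omega>) (\<mu> t) (\<theta> r \<omega>) - attention (x t \<omega>) (\<mu> t) (\<theta> r \<omega>)) \<le> attention_lip D R * err t \<omega>"
      using attention_lipschitz[OF D0 R_nonneg \<mu>_borel_prob[OF t] \<mu>_confined[OF t] r r b(2,1)] by (simp add: err_def)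
    ultimately show "norm (attention (xH t \<omega>) (\<kappa> t \<omega>) (\<theta> r \<omega>) - attention (x t \<omega>) (\<mu> t) (\<theta> r \<omega>))
        \<le> attention_lip D R * err t \<omega> + real CARD('d) * attention_lip D R * cond_err t \<omega>"
      using norm_triangle_le[of "attention (xH t \<omega>) (\<kappa> t \<omega>) (\<theta> r \<omega>) - attention (xH t \<omega>) (\<mu> t) (\<theta> r \<omega>)"
          "attention (xH t \<omega>) (\<mu> t) (\<theta> r \<omega>) - attention (x t \<omega>) (\<mu> t) (\<theta> r \<omega>)"] by simp
  qed
  then show ?case
    using norm_triangle_le[of "head_velocity H (\<lambda>r. \<theta> r \<omega>) (xH t \<omega>) (\<kappa> t \<omega>) - head_velocity H (\<lambda>r. \<theta> r \<omega>) (x t \<omega>) (\<mu> t)"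
        "head_velocity H (\<lambda>r. \<theta> r \<omega>) (x t \<omega>) (\<mu> t) - mean_velocity \<rho> (\<mu> t) (x t \<omega>)"]
    by (simp add: sampling_err_def)
qed

lemma head_velocity_heads_tuple: "head_velocity H (heads_tuple H \<theta> \<omega>) z \<nu> = head_velocity H (\<lambda>r. \<theta> r \<omega>) z \<nu>"
  by (simp add: head_velocity_def heads_tuple_def)

text \<open>Writing \<open>x t\<close> as \<open>\<Phi>\<close> of \<open>x0\<close> and using the
  product law freezes the initial token at \<open>\<xi>\<close>. The inner integral is then a
  variance at the deterministic point \<open>\<Phi> \<xi>\<close>, where
  \<open>head_velocity_variance\<close> applies.\<close>

lemma sampling_err_square_le:
  assumes t: "t \<in> {0..T}"
  shows "(\<integral>\<^sup>+ \<omega>. ennreal ((sampling_err t \<omega>)\<^sup>2) \<partial>M) \<le> ennreal (real CARD('d) * (2 * (D * R))\<^sup>2 / real H)"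
proof -
  note \<mu>' = \<mu>_borel_prob[OF t] \<mu>_confined[OF t]
  obtain \<Phi> where \<Phi>: "continuous_on UNIV \<Phi>" "AE \<omega> in M. x t \<omega> = \<Phi> (x0 \<omega>)" using x_flow_map[OF t] .
  define N where "N = (\<Pi>\<^sub>M r\<in>{1..H}. borel :: ('d, 'k) head measure)"
  define g where "g p = ennreal ((norm (head_velocity H (fst p) (\<Phi> (snd p)) (\<mu> t) - mean_velocity \<rho> (\<mu> t) (\<Phi> (snd p))))\<^sup>2)"
    for p :: "(nat \<Rightarrow> ('d, 'k) head) \<times> (real ^ 'd)"
  have hm: "heads_tuple H \<theta> \<in> M \<rightarrow>\<^sub>M N" unfolding N_def by (rule heads_tuple_measurable)
  have pair: "(\<lambda>\<omega>. (heads_tuple H \<theta> \<omega>, x0 \<omega>)) \<in> M \<rightarrow>\<^sub>M N \<Otimes>\<^sub>M borel"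
    by (rule measurable_Pair[OF hm x0_measurable])
  have g_meas: "g \<in> borel_measurable (N \<Otimes>\<^sub>M borel)"
  proof -
    have mv: "mean_velocity \<rho> (\<mu> t) \<in> borel_measurable borel"
      by (rule borel_measurable_continuous_onI[OF continuous_mean_velocity[OF D0 \<mu>' \<rho>]])
    have \<Phi>m: "(\<lambda>p. \<Phi> (snd p)) \<in> borel_measurable (N \<Otimes>\<^sub>M borel)"
      by (rule measurable_compose[OF measurable_snd borel_measurable_continuous_onI[OF \<Phi>(1)]])
    have co: "(\<lambda>p. fst p r) \<in> borel_measurable (N \<Otimes>\<^sub>M borel)" if "r \<in> {1..H}" for r
      unfolding N_def by (rule measurable_compose[OF measurable_fst measurable_component_singleton[OF that]])
    have "(\<lambda>p. head_velocity H (fst p) (\<Phi> (snd p)) (\<mu> t) - mean_velocity \<rho> (\<mu> t) (\<Phi> (snd p))) \<in> borel_measurable (N \<Otimes>\<^sub>M borel)"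
      unfolding head_velocity_def
      by (intro borel_measurable_diff borel_measurable_scaleR borel_measurable_const borel_measurable_sum
          measurable_attention[OF \<mu>'] \<Phi>m co measurable_compose[OF \<Phi>m mv])
    then show ?thesis unfolding g_def by measurable
  qed
  interpret h: prob_space "distr M N (heads_tuple H \<theta>)" by (rule prob_space_distr[OF hm])
  interpret y: prob_space "distr M borel x0" by (rule prob_space_distr[OF x0_measurable])
  interpret hy: pair_sigma_finite "distr M N (heads_tuple H \<theta>)" "distr M borel x0" ..
  have g_meas': "g \<in> borel_measurable (distr M N (heads_tuple H \<theta>) \<Otimes>\<^sub>M distr M borel x0)"
    using g_meas by (simp cong: measurable_cong_sets sets_pair_measure_cong)
  have "(\<integral>\<^sup>+ \<omega>. ennreal ((sampling_err t \<omega>)\<^sup>2) \<partial>M) = (\<integral>\<^sup>+ \<omega>. g (heads_tuple H \<theta> \<omega>, x0 \<omega>) \<partial>M)"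
    using \<Phi>(2) by (intro nn_integral_cong_AE) (auto simp: g_def sampling_err_def head_velocity_heads_tuple elim!: eventually_mono)
  also have "\<dots> = (\<integral>\<^sup>+ p. g p \<partial>distr M (N \<Otimes>\<^sub>M borel) (\<lambda>\<omega>. (heads_tuple H \<theta> \<omega>, x0 \<omega>)))"
    by (rule nn_integral_distr[OF pair, symmetric]) (use g_meas in simp)
  also have "\<dots> = (\<integral>\<^sup>+ p. g p \<partial>(distr M N (heads_tuple H \<theta>) \<Otimes>\<^sub>M distr M borel x0))"
    unfolding N_def heads_x0_distr ..
  also have "\<dots> = (\<integral>\<^sup>+ \<xi>. \<integral>\<^sup>+ \<eta>. g (\<eta>, \<xi>) \<partial>distr M N (heads_tuple H \<theta>) \<partial>distr M borel x0)"
    by (rule hy.nn_integral_snd[OF g_meas', symmetric])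
  also have "\<dots> \<le> (\<integral>\<^sup>+ \<xi>. ennreal (real CARD('d) * (2 * (D * R))\<^sup>2 / real H) \<partial>distr M borel x0)"
  proof (rule nn_integral_mono)
    fix \<xi>
    have "(\<lambda>\<eta>. g (\<eta>, \<xi>)) \<in> borel_measurable N" by (rule measurable_compose[OF measurable_Pair2' g_meas]) simp
    then have "(\<integral>\<^sup>+ \<eta>. g (\<eta>, \<xi>) \<partial>distr M N (heads_tuple H \<theta>)) = (\<integral>\<^sup>+ \<omega>. g (heads_tuple H \<theta> \<omega>, \<xi>) \<partial>M)"
      by (intro nn_integral_distr[OF hm]) simp
    also have "\<dots> \<le> ennreal (real CARD('d) * (2 * (D * R))\<^sup>2 / real H)"
      unfolding g_def fst_conv snd_conv head_velocity_heads_tuple by (rule head_velocity_variance[OF \<mu>' R_nonneg])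
    finally show "(\<integral>\<^sup>+ \<eta>. g (\<eta>, \<xi>) \<partial>distr M N (heads_tuple H \<theta>)) \<le> ennreal (real CARD('d) * (2 * (D * R))\<^sup>2 / real H)" .
  qed
  also have "\<dots> = ennreal (real CARD('d) * (2 * (D * R))\<^sup>2 / real H)"
    using y.emeasure_space_1 by simp
  finally show ?thesis .
qed

section \<open>The iteration for the mean square error\<close>

definition growth_rate where "growth_rate = 4 * (real CARD('d) * attention_lip D R) + 1"

definition sampling_var where "sampling_var = real CARD('d) * (2 * (D * R))\<^sup>2 / real H"

lemma growth_rate_nonneg: "0 \<le> growth_rate"
  using attention_lip_nonneg[OF D0 R_nonneg] by (simp add: growth_rate_def)

lemma sampling_var_nonneg: "0 \<le> sampling_var"
  by (simp add: sampling_var_def)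

text \<open>With \<open>L' = d * attention_lip D R\<close>, the inequality
  \<open>2 * a * b \<le> a^2 + b^2\<close> leaves \<open>3 * L' + 1\<close> in front of the squared
  error and \<open>L'\<close> in front of the squared conditional error. By
  \<open>cond_err_square_le\<close> the two add up to \<open>growth_rate\<close>. The remaining term
  is the sampling variance.\<close>

lemma err_square_derivative_le:
  assumes t: "t \<in> {0..T}"
  shows "(\<integral>\<^sup>+ \<omega>. ennreal (2 * ((xH t \<omega> - x t \<omega>) \<bullet>
      (head_velocity H (\<lambda>r. \<theta> r \<omega>) (xH t \<omega>) (\<kappa> t \<omega>) - mean_velocity \<rho> (\<mu> t) (x t \<omega>)))) \<partial>M)
    \<le> ennreal (growth_rate * expectation (\<lambda>\<omega>. (err t \<omega>)\<^sup>2) + sampling_var)"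
proof -
  define L where "L = attention_lip D R"
  define L' where "L' = real CARD('d) * L"
  have L: "0 \<le> L" "L \<le> L'"
    using attention_lip_nonneg[OF D0 R_nonneg] by (auto simp: L_def L'_def mult_le_cancel_right1)
  let ?v = "\<lambda>\<omega>. head_velocity H (\<lambda>r. \<theta> r \<omega>) (xH t \<omega>) (\<kappa> t \<omega>) - mean_velocity \<rho> (\<mu> t) (x t \<omega>)"
  note [measurable] = err_measurable[OF t] sampling_err_measurable[OF t]
  have "(\<integral>\<^sup>+ \<omega>. ennreal (2 * ((xH t \<omega> - x t \<omega>) \<bullet> ?v \<omega>)) \<partial>M)
      \<le> (\<integral>\<^sup>+ \<omega>. ennreal ((3 * L' + 1) * (err t \<omega>)\<^sup>2) + ennreal L' * ennreal ((cond_err t \<omega>)\<^sup>2) + ennreal ((sampling_err t \<omega>)\<^sup>2) \<partial>M)"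
  proof (rule nn_integral_mono_AE)
    show "AE \<omega> in M. ennreal (2 * ((xH t \<omega> - x t \<omega>) \<bullet> ?v \<omega>))
        \<le> ennreal ((3 * L' + 1) * (err t \<omega>)\<^sup>2) + ennreal L' * ennreal ((cond_err t \<omega>)\<^sup>2) + ennreal ((sampling_err t \<omega>)\<^sup>2)"
      using velocity_diff_le[OF t]
    proof eventually_elim
      case (elim \<omega>)
      define e u s where "e = err t \<omega>" and "u = cond_err t \<omega>" and "s = sampling_err t \<omega>"
      have e0: "0 \<le> e" by (simp add: e_def err_def)
      have "(xH t \<omega> - x t \<omega>) \<bullet> ?v \<omega> \<le> e * norm (?v \<omega>)"
        unfolding e_def err_def by (rule norm_cauchy_schwarz)
      also have "\<dots> \<le> e * (L * e + L' * u + s)"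
        using elim e0 by (intro mult_left_mono) (simp_all add: e_def u_def s_def L_def L'_def)
      finally have 1: "2 * ((xH t \<omega> - x t \<omega>) \<bullet> ?v \<omega>) \<le> 2 * (L * e\<^sup>2) + L' * (2 * e * u) + 2 * e * s"
        by (simp add: algebra_simps power2_eq_square)
      have 2: "L * e\<^sup>2 \<le> L' * e\<^sup>2" using L by (intro mult_right_mono) auto
      have 3: "L' * (2 * e * u) \<le> L' * (e\<^sup>2 + u\<^sup>2)"
        using L sum_squares_bound[of e u] by (intro mult_left_mono) auto
      have 4: "2 * e * s \<le> e\<^sup>2 + s\<^sup>2" by (rule sum_squares_bound)
      have "2 * ((xH t \<omega> - x t \<omega>) \<bullet> ?v \<omega>) \<le> (3 * L' + 1) * e\<^sup>2 + L' * u\<^sup>2 + s\<^sup>2"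
        using 1 2 3 4 by (simp add: algebra_simps)
      then have "ennreal (2 * ((xH t \<omega> - x t \<omega>) \<bullet> ?v \<omega>)) \<le> ennreal ((3 * L' + 1) * e\<^sup>2 + L' * u\<^sup>2 + s\<^sup>2)"
        by (rule ennreal_leI)
      also have "\<dots> = ennreal ((3 * L' + 1) * e\<^sup>2) + ennreal L' * ennreal (u\<^sup>2) + ennreal (s\<^sup>2)"
        using L by (simp add: ennreal_mult')
      finally show ?case unfolding e_def u_def s_def .
    qed
  qed
  also have "\<dots> = (\<integral>\<^sup>+ \<omega>. ennreal ((3 * L' + 1) * (err t \<omega>)\<^sup>2) \<partial>M)
      + ennreal L' * (\<integral>\<^sup>+ \<omega>. ennreal ((cond_err t \<omega>)\<^sup>2) \<partial>M) + (\<integral>\<^sup>+ \<omega>. ennreal ((sampling_err t \<omega>)\<^sup>2) \<partial>M)"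
    by (simp add: nn_integral_add nn_integral_cmult)
  also have "\<dots> \<le> ennreal ((3 * L' + 1) * expectation (\<lambda>\<omega>. (err t \<omega>)\<^sup>2))
      + ennreal L' * ennreal (expectation (\<lambda>\<omega>. (err t \<omega>)\<^sup>2)) + ennreal sampling_var"
  proof (intro add_mono mult_left_mono)
    have "(\<integral>\<^sup>+ \<omega>. ennreal ((3 * L' + 1) * (err t \<omega>)\<^sup>2) \<partial>M) = ennreal (expectation (\<lambda>\<omega>. (3 * L' + 1) * (err t \<omega>)\<^sup>2))"
      using err_integrable(2)[OF t] L by (intro nn_integral_eq_integral) auto
    then show "(\<integral>\<^sup>+ \<omega>. ennreal ((3 * L' + 1) * (err t \<omega>)\<^sup>2) \<partial>M) \<le> ennreal ((3 * L' + 1) * expectation (\<lambda>\<omega>. (err t \<omega>)\<^sup>2))"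
      by simp
  qed (use cond_err_square_le[OF t] sampling_err_square_le[OF t] in \<open>simp_all add: sampling_var_def\<close>)
  also have "\<dots> = ennreal (growth_rate * expectation (\<lambda>\<omega>. (err t \<omega>)\<^sup>2) + sampling_var)"
  proof -
    have m: "0 \<le> expectation (\<lambda>\<omega>. (err t \<omega>)\<^sup>2)" by simp
    have "ennreal L' * ennreal (expectation (\<lambda>\<omega>. (err t \<omega>)\<^sup>2)) = ennreal (L' * expectation (\<lambda>\<omega>. (err t \<omega>)\<^sup>2))"
      using L by (simp add: ennreal_mult')
    moreover have "growth_rate = (3 * L' + 1) + L'" by (simp add: growth_rate_def L'_def L_def)
    ultimately show ?thesis
      using L m sampling_var_nonneg by (simp add: ennreal_plus[symmetric] distrib_right del: ennreal_plus)
  qed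
  finally show ?thesis .
qed

text \<open>One step of the iteration. The exponent is twice the growth rate, so that integrating
  \<open>growth_rate\<close> times the assumed bound returns half of \<open>c\<close>. The
  dominating \<open>W\<close> serves all times at once, so the supremum stays inside the
  expectation, and the same lemma also yields the final estimate.\<close>

lemma sup_err_square_le:
  assumes c: "0 \<le> c" and le: "\<And>t. t \<in> {0..T} \<Longrightarrow> expectation (\<lambda>\<omega>. (err t \<omega>)\<^sup>2) \<le> c * exp (2 * growth_rate * t)"
    and \<tau>: "0 < \<tau>" "\<tau> \<le> T"
  shows "(\<integral>\<^sup>+ \<omega>. (SUP t\<in>{0..\<tau>}. ennreal ((err t \<omega>)\<^sup>2)) \<partial>M)
    \<le> ennreal (c / 2 * exp (2 * growth_rate * \<tau>) + sampling_var * T)"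
proof -
  define \<psi> where "\<psi> s = growth_rate * (c * exp (2 * growth_rate * s)) + sampling_var" for s
  define \<Psi> where "\<Psi> s = c / 2 * exp (2 * growth_rate * s) + sampling_var * s" for s
  let ?v = "\<lambda>t \<omega>. head_velocity H (\<lambda>r. \<theta> r \<omega>) (xH t \<omega>) (\<kappa> t \<omega>) - mean_velocity \<rho> (\<mu> t) (x t \<omega>)"
  have tT: "t \<in> {0..T}" if "t \<in> {0..\<tau>}" for t using that \<tau> by auto
  obtain W where W: "W \<in> borel_measurable M"
    "AE \<omega> in M. \<forall>t\<in>{0..\<tau>}. ennreal ((err t \<omega>)\<^sup>2 - (err 0 \<omega>)\<^sup>2) \<le> W \<omega>"
    "(\<integral>\<^sup>+ \<omega>. W \<omega> \<partial>M) \<le> ennreal (\<Psi> \<tau> - \<Psi> 0)"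
  proof (rule AE_increment_le[OF prob_space_axioms \<tau>(1), where f = "\<lambda>t \<omega>. (err t \<omega>)\<^sup>2"
        and f' = "\<lambda>t \<omega>. 2 * ((xH t \<omega> - x t \<omega>) \<bullet> ?v t \<omega>)" and \<Psi> = \<Psi> and \<psi> = \<psi>])
    show "(\<lambda>\<omega>. (err t \<omega>)\<^sup>2) \<in> borel_measurable M" if "t \<in> {0..\<tau>}" for t
      using tT[OF that] by measurable
    show "AE \<omega> in M. \<forall>t\<in>{0..\<tau>}. ((\<lambda>s. (err s \<omega>)\<^sup>2) has_real_derivative 2 * ((xH t \<omega> - x t \<omega>) \<bullet> ?v t \<omega>)) (at t within {0..\<tau>})"
      using x_deriv xH_deriv
    proof eventually_elim
      case (elim \<omega>)
      show ?case
      proof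
        fix t assume "t \<in> {0..\<tau>}"
        then have "((\<lambda>s. xH s \<omega> - x s \<omega>) has_vector_derivative ?v t \<omega>) (at t within {0..T})"
          using elim tT by (intro has_vector_derivative_diff) auto
        then have "((\<lambda>s. xH s \<omega> - x s \<omega>) has_vector_derivative ?v t \<omega>) (at t within {0..\<tau>})"
          by (rule has_vector_derivative_within_subset) (use \<tau> in auto)
        from inner_self_has_real_derivative[OF this]
        show "((\<lambda>s. (err s \<omega>)\<^sup>2) has_real_derivative 2 * ((xH t \<omega> - x t \<omega>) \<bullet> ?v t \<omega>)) (at t within {0..\<tau>})"
          unfolding err_def .
      qed
    qed
    show "(\<integral>\<^sup>+ \<omega>. ennreal (2 * ((xH t \<omega> - x t \<omega>) \<bullet> ?v t \<omega>)) \<partial>M) \<le> ennreal (\<psi> t)" if "t \<in> {0..\<tau>}" for t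
    proof (rule order.trans[OF err_square_derivative_le[OF tT[OF that]] ennreal_leI])
      show "growth_rate * expectation (\<lambda>\<omega>. (err t \<omega>)\<^sup>2) + sampling_var \<le> \<psi> t"
        unfolding \<psi>_def using le[OF tT[OF that]] growth_rate_nonneg by (intro add_mono mult_left_mono) auto
    qed
    show "(\<Psi> has_real_derivative \<psi> t) (at t)" for t
      unfolding \<Psi>_def \<psi>_def by (rule derivative_eq_intros refl)+ (simp add: algebra_simps)
    show "continuous_on UNIV \<psi>" unfolding \<psi>_def by (intro continuous_intros)
    show "0 \<le> \<psi> t" for t unfolding \<psi>_def using growth_rate_nonneg sampling_var_nonneg c by simp
  qed
  have "(\<integral>\<^sup>+ \<omega>. (SUP t\<in>{0..\<tau>}. ennreal ((err t \<omega>)\<^sup>2)) \<partial>M) \<le> (\<integral>\<^sup>+ \<omega>. W \<omega> \<partial>M)"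
  proof (rule nn_integral_mono_AE)
    show "AE \<omega> in M. (SUP t\<in>{0..\<tau>}. ennreal ((err t \<omega>)\<^sup>2)) \<le> W \<omega>"
      using W(2) x_init xH_init by eventually_elim (auto simp: err_def intro!: SUP_least)
  qed
  also have "\<dots> \<le> ennreal (c / 2 * exp (2 * growth_rate * \<tau>) + sampling_var * T)"
  proof (rule order.trans[OF W(3) ennreal_leI])
    have "sampling_var * \<tau> \<le> sampling_var * T" using \<tau> sampling_var_nonneg by (intro mult_left_mono) auto
    then show "\<Psi> \<tau> - \<Psi> 0 \<le> c / 2 * exp (2 * growth_rate * \<tau>) + sampling_var * T"
      using c by (simp add: \<Psi>_def)
  qed
  finally show ?thesis .
qed

text \<open>The iteration starts from the trivial bound \<open>(2 * R)^2\<close>. The map from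
  \<open>c\<close> to \<open>c / 2 + sampling_var * T\<close> has the fixed point
  \<open>2 * sampling_var * T\<close>, and the excess over it is halved each time.\<close>

lemma err_square_le:
  assumes t: "t \<in> {0..T}"
  shows "expectation (\<lambda>\<omega>. (err t \<omega>)\<^sup>2) \<le> 2 * sampling_var * T * exp (2 * growth_rate * t)"
proof -
  define q where "q k = 2 * sampling_var * T + (2 * R)\<^sup>2 / 2 ^ k" for k :: nat
  have ST: "0 \<le> sampling_var * T" using sampling_var_nonneg T by simp
  have q0: "0 \<le> q k" for k
    unfolding q_def using sampling_var_nonneg T by (intro add_nonneg_nonneg divide_nonneg_nonneg) auto
  have exp1: "1 \<le> exp (2 * growth_rate * t)" if "t \<in> {0..T}" for t
    using that growth_rate_nonneg by simp
  have "expectation (\<lambda>\<omega>. (err t \<omega>)\<^sup>2) \<le> q k * exp (2 * growth_rate * t)" if "t \<in> {0..T}" for t k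
    using that
  proof (induction k arbitrary: t)
    case 0
    have "expectation (\<lambda>\<omega>. (err t \<omega>)\<^sup>2) \<le> expectation (\<lambda>\<omega>. (2 * R)\<^sup>2)"
    proof (rule integral_mono_AE[OF err_integrable(2)[OF 0]])
      show "AE \<omega> in M. (err t \<omega>)\<^sup>2 \<le> (2 * R)\<^sup>2"
        using err_bounded
      proof eventually_elim
        case (elim \<omega>)
        then have "err t \<omega> \<le> 2 * R" using 0 by blast
        then show ?case by (rule power_mono) (simp add: err_def)
      qed
    qed simp
    also have "\<dots> = (2 * R)\<^sup>2 * 1" by (simp add: prob_space)
    also have "\<dots> \<le> q 0 * exp (2 * growth_rate * t)"
    proof (rule mult_mono)
      show "(2 * R)\<^sup>2 \<le> q 0" using sampling_var_nonneg T by (simp add: q_def)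
    qed (use exp1[OF 0] q0 in auto)
    finally show ?case .
  next
    case (Suc k)
    have bound: "q k / 2 * exp (2 * growth_rate * t) + sampling_var * T \<le> q (Suc k) * exp (2 * growth_rate * t)"
    proof -
      have "sampling_var * T * 1 \<le> sampling_var * T * exp (2 * growth_rate * t)"
        using exp1[OF Suc.prems] ST by (intro mult_left_mono)
      moreover have "q (Suc k) = q k / 2 + sampling_var * T" by (simp add: q_def add_divide_distrib)
      ultimately show ?thesis by (simp add: distrib_right)
    qed
    show ?case
    \<comment> \<open>\<open>sup_err_square_le\<close> requires an interval of positive length; at
      time zero the two tokens coincide.\<close>
    proof (cases "t = 0")
      case True
      have "expectation (\<lambda>\<omega>. (err t \<omega>)\<^sup>2) = expectation (\<lambda>\<omega>. 0)"
        using x_init xH_init Suc.prems True by (intro integral_cong_AE) (auto simp: err_def elim: eventually_elim2)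
      then show ?thesis using q0 by simp
    next
      case False
      then have t0: "0 < t" "t \<le> T" using Suc.prems by auto
      have "ennreal (expectation (\<lambda>\<omega>. (err t \<omega>)\<^sup>2)) = (\<integral>\<^sup>+ \<omega>. ennreal ((err t \<omega>)\<^sup>2) \<partial>M)"
        using err_integrable(2)[OF Suc.prems] by (intro nn_integral_eq_integral[symmetric]) auto
      also have "\<dots> \<le> (\<integral>\<^sup>+ \<omega>. (SUP t\<in>{0..t}. ennreal ((err t \<omega>)\<^sup>2)) \<partial>M)"
        using t0 by (intro nn_integral_mono SUP_upper) auto
      also have "\<dots> \<le> ennreal (q k / 2 * exp (2 * growth_rate * t) + sampling_var * T)"
        by (rule sup_err_square_le[OF q0 Suc.IH t0])
      finally have "expectation (\<lambda>\<omega>. (err t \<omega>)\<^sup>2) \<le> q k / 2 * exp (2 * growth_rate * t) + sampling_var * T"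
        using q0[of k] ST by (subst (asm) ennreal_le_iff) auto
      with bound show ?thesis by linarith
    qed
  qed
  from le_of_halving_steps[OF this[OF t, unfolded q_def]] show ?thesis .
qed

text \<open>One more step from the fixed point moves the supremum over time inside the
  expectation.\<close>

lemma expected_sup_err_le:
  "(\<integral>\<^sup>+ \<omega>. (SUP t\<in>{0..T}. ennreal ((norm (xH t \<omega> - x t \<omega>))\<^sup>2)) \<partial>M)
    \<le> ennreal (2 * sampling_var * T * exp (2 * growth_rate * T))"
proof -
  have ST: "0 \<le> 2 * sampling_var * T" using sampling_var_nonneg T by simp
  have "(\<integral>\<^sup>+ \<omega>. (SUP t\<in>{0..T}. ennreal ((err t \<omega>)\<^sup>2)) \<partial>M)
      \<le> ennreal (2 * sampling_var * T / 2 * exp (2 * growth_rate * T) + sampling_var * T)"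
    by (rule sup_err_square_le[OF ST err_square_le T order.refl])
  also have "\<dots> \<le> ennreal (2 * sampling_var * T * exp (2 * growth_rate * T))"
  proof (rule ennreal_leI)
    have "sampling_var * T * 1 \<le> sampling_var * T * exp (2 * growth_rate * T)"
      using sampling_var_nonneg growth_rate_nonneg T by (intro mult_left_mono) auto
    then show "2 * sampling_var * T / 2 * exp (2 * growth_rate * T) + sampling_var * T
        \<le> 2 * sampling_var * T * exp (2 * growth_rate * T)" by (simp add: mult_ac)
  qed
  finally show ?thesis unfolding err_def .
qed

end

theorem theorem5p1:
  fixes \<Theta> :: "('d::finite, 'k::finite) head set"
    and \<rho> :: "('d, 'k) head measure"
    and \<mu>0 :: "(real ^ 'd) measure"
    and D R0 T C_conf :: real
  assumes "compact \<Theta>" and "\<forall>\<theta>\<in>\<Theta>. norm \<theta> \<le> D"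
    and "0 < T"
    and "prob_measure_on \<Theta> \<rho>"
    and "borel_prob \<mu>0" and "measure_support \<mu>0 \<subseteq> cball 0 R0"
    and "confinement_constant (cball (0 :: ('d, 'k) head) D) C_conf"
  shows
    "(\<exists>C. \<forall>H\<ge>2. \<forall>(M :: 'w measure) \<theta> x0 xH \<kappa> x.
        iid_heads M \<rho> H \<theta> \<longrightarrow>
        x0 \<in> borel_measurable M \<longrightarrow> distr M borel x0 = \<mu>0 \<longrightarrow>
        prob_space.indep_set M (sets (heads_sigma M H \<theta>)) (sets (vimage_algebra (space M) x0 borel)) \<longrightarrow>
        finite_head_solution M H \<theta> T xH \<kappa> \<longrightarrow> (AE \<omega> in M. xH 0 \<omega> = x0 \<omega>) \<longrightarrow>
        mean_field_solution M \<rho> T x \<longrightarrow> (AE \<omega> in M. x 0 \<omega> = x0 \<omega>) \<longrightarrow>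
        (let E = \<integral>\<^sup>+ \<omega>. (SUP t\<in>{0..T}. ennreal ((norm (xH t \<omega> - x t \<omega>))\<^sup>2)) \<partial>M in
           E < \<infinity> \<and> sqrt (enn2real E) \<le> C * real H powr (- 1 / 2) * sqrt (ln (real H)))) \<and>
     (\<forall>\<epsilon>>0. \<exists>C. \<forall>H\<ge>2. \<forall>(M :: 'w measure) \<theta> \<mu>.
        iid_heads M \<rho> H \<theta> \<longrightarrow>
        borel_prob \<mu> \<longrightarrow> measure_support \<mu> \<subseteq> cball 0 (confinement_radius C_conf R0 T) \<longrightarrow>
        (let Z = (\<lambda>\<omega>. SUP x\<in>cball 0 (confinement_radius C_conf R0 T).
                     norm (head_velocity H (\<lambda>r. \<theta> r \<omega>) x \<mu> - mean_velocity \<rho> \<mu> x)) in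
           Z \<in> borel_measurable M \<and>
           measure M {\<omega> \<in> space M. Z \<omega> > C * (real H powr (- 1 / 2) * sqrt (ln (real H)))} \<le> \<epsilon>))"
proof -
  interpret \<rho>: prob_space \<rho> using assms(4) by (simp add: prob_measure_on_def borel_prob_def)
  interpret \<mu>0: prob_space \<mu>0 using assms(5) by (simp add: borel_prob_def)
  have in_ball: "AE h in \<rho>. h \<in> cball 0 D"
    using assms(2,4) by (auto simp: prob_measure_on_def elim: eventually_mono)
  then have \<rho>: "prob_measure_on (cball 0 D) \<rho>" using assms(4) by (simp add: prob_measure_on_def)
  \<comment> \<open>A probability measure cannot live on an empty ball, so \<open>D\<close>, and
    likewise \<open>R0\<close> below, is nonnegative.\<close>
  from in_ball have "AE h in \<rho>. 0 \<le> D" by eventually_elim (auto intro: order.trans[OF norm_ge_zero])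
  then have D0: "0 \<le> D" by simp
  have \<mu>0: "AE y in \<mu>0. norm y \<le> R0"
    using assms(5,6) by (subst (asm) measure_support_subset_iff) (auto simp: borel_prob_def)
  then have "AE y in \<mu>0. 0 \<le> R0" by eventually_elim (auto intro: order.trans[OF norm_ge_zero])
  then have R0: "0 \<le> R0" by simp
  define R where "R = token_radius D R0 T"
  define K where "K = real CARD('d) * (2 * (D * R))\<^sup>2"
  define a where "a = 4 * (real CARD('d) * attention_lip D R) + 1"
  \<comment> \<open>The bound of \<open>expected_sup_err_le\<close> with the factor
    \<open>1 / H\<close> of \<open>sampling_var\<close> taken out; being free of \<open>H\<close>,
    it can be fixed before the sample.\<close>
  define B where "B = 2 * K * T * exp (2 * a * T)"
  have B0: "0 \<le> B" using assms(3) by (simp add: B_def K_def)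
  \<comment> \<open>The root of the mean square error is at most \<open>sqrt B / sqrt H\<close>.
    Dividing by \<open>sqrt (ln 2)\<close> brings in the factor \<open>sqrt (ln H)\<close>, as
    \<open>H\<close> is at least 2.\<close>
  define C where "C = sqrt B / sqrt (ln 2)"
  define Rc where "Rc = confinement_radius C_conf R0 T"
  have Rc0: "0 \<le> Rc"
  proof -
    have "0 \<le> C_conf" using assms(7) by (simp add: confinement_constant_def)
    then have "1 \<le> exp (C_conf * T)" using assms(3) by simp
    then show ?thesis unfolding Rc_def confinement_radius_def using R0 by simp
  qed
  show ?thesis
    unfolding Let_def Rc_def[symmetric]
  proof (rule conjI, goal_cases)
    case 1
    show ?case
    proof (intro exI[of _ C] allI impI)
      fix H and M :: "'w measure" and \<theta> x0 xH \<kappa> x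
      assume H2: "2 \<le> H" and *: "iid_heads M \<rho> H \<theta>" "x0 \<in> borel_measurable M" "distr M borel x0 = \<mu>0"
        "prob_space.indep_set M (sets (heads_sigma M H \<theta>)) (sets (vimage_algebra (space M) x0 borel))"
        "finite_head_solution M H \<theta> T xH \<kappa>" "AE \<omega> in M. xH 0 \<omega> = x0 \<omega>"
        "mean_field_solution M \<rho> T x" "AE \<omega> in M. x 0 \<omega> = x0 \<omega>"
      have x0: "AE \<omega> in M. norm (x0 \<omega>) \<le> R0"
        using \<mu>0 *(2) unfolding *(3)[symmetric] by (subst (asm) AE_distr_iff) auto
      interpret prob_space M using *(1) by (simp add: iid_heads_def)
      interpret coupled_dynamics M \<rho> H \<theta> D x0 xH x \<kappa> T R0
        using * D0 \<rho> H2 x0 assms(3) by unfold_locales auto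
      define E where "E = (\<integral>\<^sup>+ \<omega>. (SUP t\<in>{0..T}. ennreal ((norm (xH t \<omega> - x t \<omega>))\<^sup>2)) \<partial>M)"
      have E: "E \<le> ennreal (B / real H)"
        using expected_sup_err_le unfolding E_def B_def sampling_var_def growth_rate_def K_def a_def R_def by simp
      \<comment> \<open>Finiteness is a claim of its own: \<open>enn2real\<close> sends infinity to
        0, so the bound on the root would not exclude an infinite expectation.\<close>
      then have "E < \<infinity>" by (rule le_less_trans) simp
      moreover have "sqrt (enn2real E) \<le> C * real H powr (- 1 / 2) * sqrt (ln (real H))"
      proof -
        have "enn2real E \<le> enn2real (ennreal (B / real H))" using E by (intro enn2real_mono) auto
        also have "\<dots> = B / real H" using B0 by simp
        finally have "sqrt (enn2real E) \<le> sqrt (B / real H)" by (rule real_sqrt_le_mono)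
        also have "\<dots> = C * (sqrt (ln 2) / sqrt (real H))" by (simp add: C_def real_sqrt_divide)
        also have "\<dots> \<le> C * (real H powr (- 1 / 2) * sqrt (ln (real H)))"
          using powr_half_sqrt_ln(2)[OF H2] B0 by (intro mult_left_mono) (auto simp: C_def)
        finally show ?thesis by (simp add: mult.assoc)
      qed
      ultimately show "(\<integral>\<^sup>+ \<omega>. (SUP t\<in>{0..T}. ennreal ((norm (xH t \<omega> - x t \<omega>))\<^sup>2)) \<partial>M) < \<infinity> \<and>
          sqrt (enn2real (\<integral>\<^sup>+ \<omega>. (SUP t\<in>{0..T}. ennreal ((norm (xH t \<omega> - x t \<omega>))\<^sup>2)) \<partial>M))
            \<le> C * real H powr (- 1 / 2) * sqrt (ln (real H))"
        unfolding E_def by (rule conjI)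
    qed
  next
    case 2
    show ?case
    proof (intro allI impI)
      fix \<epsilon> :: real assume "0 < \<epsilon>"
      from head_velocity_uniform[OF D0 \<rho> Rc0 this, where 'w = 'w]
      obtain C where C: "\<And>H (M :: 'w measure) \<theta> \<mu>. 2 \<le> H \<Longrightarrow> iid_heads M \<rho> H \<theta> \<Longrightarrow> borel_prob \<mu> \<Longrightarrow> AE y in \<mu>. norm y \<le> Rc \<Longrightarrow>
        measure M {\<omega> \<in> space M. (SUP x\<in>cball 0 Rc. norm (head_velocity H (\<lambda>r. \<theta> r \<omega>) x \<mu> - mean_velocity \<rho> \<mu> x))
          > C * (real H powr (- 1 / 2) * sqrt (ln (real H)))} \<le> \<epsilon>" by blast
      show "\<exists>C. \<forall>H\<ge>2. \<forall>(M :: 'w measure) \<theta> \<mu>. iid_heads M \<rho> H \<theta> \<longrightarrow> borel_prob \<mu> \<longrightarrow> measure_support \<mu> \<subseteq> cball 0 Rc \<longrightarrow>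
          (\<lambda>\<omega>. SUP x\<in>cball 0 Rc. norm (head_velocity H (\<lambda>r. \<theta> r \<omega>) x \<mu> - mean_velocity \<rho> \<mu> x)) \<in> borel_measurable M \<and>
          measure M {\<omega> \<in> space M. (SUP x\<in>cball 0 Rc. norm (head_velocity H (\<lambda>r. \<theta> r \<omega>) x \<mu> - mean_velocity \<rho> \<mu> x))
            > C * (real H powr (- 1 / 2) * sqrt (ln (real H)))} \<le> \<epsilon>"
      proof (intro exI[of _ C] allI impI)
        fix H and M :: "'w measure" and \<theta> and \<mu> :: "(real ^ 'd) measure"
        assume *: "2 \<le> H" "iid_heads M \<rho> H \<theta>" "borel_prob \<mu>" "measure_support \<mu> \<subseteq> cball 0 Rc"
        have \<mu>: "AE y in \<mu>. norm y \<le> Rc"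
          using *(3,4) by (subst (asm) measure_support_subset_iff) (auto simp: borel_prob_def)
        interpret prob_space M using *(2) by (simp add: iid_heads_def)
        interpret sampled_heads M \<rho> H \<theta> D using * D0 \<rho> by unfold_locales auto
        show "(\<lambda>\<omega>. SUP x\<in>cball 0 Rc. norm (head_velocity H (\<lambda>r. \<theta> r \<omega>) x \<mu> - mean_velocity \<rho> \<mu> x)) \<in> borel_measurable M \<and>
          measure M {\<omega> \<in> space M. (SUP x\<in>cball 0 Rc. norm (head_velocity H (\<lambda>r. \<theta> r \<omega>) x \<mu> - mean_velocity \<rho> \<mu> x))
            > C * (real H powr (- 1 / 2) * sqrt (ln (real H)))} \<le> \<epsilon>"
          using sup_deviation_measurable[OF *(3) \<mu> Rc0] C[OF *(1-3) \<mu>] by blast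
      qed
    qed
  qed
qed

end
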